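(* The family $\mathcal X_3$ of K3 surfaces (with parameter $r$) $$\mathcal X_3:\quad y^2 = x^3- t^2 (r^2 t-1-2 r) x^2-2 (t+1) t^3 r (r t-1) x-(t+1)^2 t^5 r^2$$ is parametrised by the modular curve $X^*(6)$. The parameter $r$ is related to the Hauptmodul $a$ of $X^*(6)$ by $$a=-\frac{2(r+2)}{4r-1}.$$
   Context: $X^*(6)=X_0(6)/\langle w_2,w_3\rangle$ is the quotient of the modular curve $X_0(6)$ by all Fricke (Atkin--Lehner) involutions. The Hauptmodul $a$ of $X^*(6)$ is the one fixed in Quer's work on $\mathbb Q$-curves: the elliptic curves parametrised by $X^*(6)$ are defined over $\mathbb Q(\sqrt a,\sqrt{2a+1})$, and after writing $$a=a(t)=\Bigl(\frac{2t}{2t^2-1}\Bigr)^2$$ (which makes both square roots rational in $t$) their $j$-invariants are, up to conjugation, $$j(t)=\frac{6912 (5 t^3+6 t^2-2)^3 t^3}{(2 t-1) (t+1)^2 (2 t+1)^3 (t-1)^6}.$$ (In these two formulas $t$ is a parameter unrelated to the coordinate $t$ of the elliptic fibration.) A general member of $\mathcal X_3$ has Picard number 19 and Néron--Severi lattice $U(2)+2E_8(-1)+\langle-6\rangle$. The family also admits the elliptic fibration $$y^2 = x (x^2 -8 t^2 (1+2 r) x + 2 t^3 (64 r+8 t-32 r t+16 r^2 t+t^2 r^3))$$ with two fibres of type $III^*$ (at $t=0,\infty$), two fibres of type $I_2$ (conjugate over the field generated by $\sqrt{1-4r}$) and two-torsion section $(0,0)$. Kummer structure: choose one of the two $I_2$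 fibres. The $III^*$ fibre at $0$, minus its far simple component and the adjacent double component, together with the zero section, the identity component of the $III^*$ fibre at $\infty$ and the identity component of the chosen $I_2$ fibre, supports a divisor of Kodaira type $I_4^*$; it induces an elliptic fibration with two fibres of type $I_4^*$ and a two-torsion section. The minimal resolution of the quotient by translation by this two-torsion section is a Kummer surface $\mathrm{Km}(E\times E')$ of a product of two elliptic curves. "Parametrised by $X^*(6)$" means that, through this Kummer structure (with a suitable choice of the $I_2$ fibre), the $j$-invariants of the elliptic curves $E,E'$ attached to the members of $\mathcal X_3$ are those of the elliptic curves parametrised by $X^*(6)$, namely $j(t)$ and its conjugate $j(-t)$, so that $r$ is identified with a coordinate on $X^*(6)$. *)

theory Defs
  imports Complex_Main "HOL-Computational_Algebra.Polynomial"
begin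

text \<open>
  A smooth projective K3 surface is the unique smooth minimal model of its function field.
  Surfaces over the complex numbers are therefore presented by their function fields: a field
  with an embedding \<open>\<iota>\<close> of the constants, and coordinate functions that generate it. Two K3
  surfaces are isomorphic iff their function fields are isomorphic over the constants, the
  function field of the quotient by an automorphism is the fixed field, and it is not changed by
  resolving singularities.
\<close>

definition const_embedding :: "(complex \<Rightarrow> 'k::field) \<Rightarrow> bool" where
  "const_embedding \<iota> \<longleftrightarrow>
     \<iota> 1 = 1 \<and> (\<forall>a b. \<iota> (a + b) = \<iota> a + \<iota> b) \<and> (\<forall>a b. \<iota> (a * b) = \<iota> a * \<iota> b)"

inductive_set adjoin :: "(complex \<Rightarrow> 'k::field) \<Rightarrow> 'k set \<Rightarrow> 'k set"
  for \<iota> :: "complex \<Rightarrow> 'k" and S :: "'k set" where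
  const: "\<iota> c \<in> adjoin \<iota> S"
| gen: "z \<in> S \<Longrightarrow> z \<in> adjoin \<iota> S"
| add: "z \<in> adjoin \<iota> S \<Longrightarrow> w \<in> adjoin \<iota> S \<Longrightarrow> z + w \<in> adjoin \<iota> S"
| minus: "z \<in> adjoin \<iota> S \<Longrightarrow> - z \<in> adjoin \<iota> S"
| mult: "z \<in> adjoin \<iota> S \<Longrightarrow> w \<in> adjoin \<iota> S \<Longrightarrow> z * w \<in> adjoin \<iota> S"
| inverse: "z \<in> adjoin \<iota> S \<Longrightarrow> inverse z \<in> adjoin \<iota> S"

definition alg_independent :: "(complex \<Rightarrow> 'k::field) \<Rightarrow> 'k \<Rightarrow> 'k \<Rightarrow> bool" where
  "alg_independent \<iota> s t \<longleftrightarrow>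
     (\<forall>P :: complex poly poly. P \<noteq> 0 \<longrightarrow>
        poly (map_poly (\<lambda>p. poly (map_poly \<iota> p) s) P) t \<noteq> 0)"

definition const_automorphism :: "(complex \<Rightarrow> 'k::field) \<Rightarrow> ('k \<Rightarrow> 'k) \<Rightarrow> bool" where
  "const_automorphism \<iota> \<sigma> \<longleftrightarrow>
     bij \<sigma> \<and> (\<forall>z w. \<sigma> (z + w) = \<sigma> z + \<sigma> w) \<and> (\<forall>z w. \<sigma> (z * w) = \<sigma> z * \<sigma> w) \<and>
     (\<forall>c. \<sigma> (\<iota> c) = \<iota> c)"

definition fixed_field :: "('k::field \<Rightarrow> 'k) \<Rightarrow> 'k set" where
  "fixed_field \<sigma> = {z. \<sigma> z = z}"

definition const_isomorphic ::
  "(complex \<Rightarrow> 'k::field) \<Rightarrow> 'k set \<Rightarrow> (complex \<Rightarrow> 'l::field) \<Rightarrow> 'l set \<Rightarrow> bool" where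
  "const_isomorphic \<iota> F \<kappa> G \<longleftrightarrow>
     (\<exists>\<phi>. bij_betw \<phi> F G \<and>
        (\<forall>z\<in>F. \<forall>w\<in>F. \<phi> (z + w) = \<phi> z + \<phi> w \<and> \<phi> (z * w) = \<phi> z * \<phi> w) \<and>
        (\<forall>c. \<phi> (\<iota> c) = \<kappa> c))"

text \<open>
  The whole field is the function field of the elliptic surface
  \<open>y\<^sup>2 = x\<^sup>3 + A2 x\<^sup>2 + A4 x + A6\<close> over the \<open>t\<close>-line; the last
  inequality says that the discriminant of the cubic is not zero.
\<close>

definition weierstrass_fibration ::
  "(complex \<Rightarrow> 'k::field) \<Rightarrow> 'k \<Rightarrow> 'k \<Rightarrow> 'k \<Rightarrow> 'k \<Rightarrow> 'k \<Rightarrow> 'k \<Rightarrow> bool" where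
  "weierstrass_fibration \<iota> t x y A2 A4 A6 \<longleftrightarrow>
     const_embedding \<iota> \<and> alg_independent \<iota> t x \<and> adjoin \<iota> {t, x, y} = UNIV \<and>
     A2 \<in> adjoin \<iota> {t} \<and> A4 \<in> adjoin \<iota> {t} \<and> A6 \<in> adjoin \<iota> {t} \<and>
     y^2 = x^3 + A2 * x^2 + A4 * x + A6 \<and>
     A2^2 * A4^2 - 4 * A4^3 - 4 * A2^3 * A6 - 27 * A6^2 + 18 * A2 * A4 * A6 \<noteq> 0"

definition X3 :: "complex \<Rightarrow> (complex \<Rightarrow> 'k::field) \<Rightarrow> 'k \<Rightarrow> 'k \<Rightarrow> 'k \<Rightarrow> bool" where
  "X3 r \<iota> t x y \<longleftrightarrow> (let \<rho> = \<iota> r in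
     weierstrass_fibration \<iota> t x y
       (- (t^2 * (\<rho>^2 * t - 1 - 2 * \<rho>)))
       (- (2 * (t + 1) * t^3 * \<rho> * (\<rho> * t - 1)))
       (- ((t + 1)^2 * t^5 * \<rho>^2)))"

text \<open>
  The fibration with fibres \<open>III\<^sup>*\<close> at \<open>0\<close> and \<open>\<infinity>\<close> and
  fibres \<open>I\<^sub>2\<close> at the two zeros of the quadratic factor of the coefficient of \<open>x\<close>.
\<close>

definition III_star_fibration ::
  "complex \<Rightarrow> (complex \<Rightarrow> 'k::field) \<Rightarrow> 'k \<Rightarrow> 'k \<Rightarrow> 'k \<Rightarrow> bool" where
  "III_star_fibration r \<iota> t x y \<longleftrightarrow> (let \<rho> = \<iota> r in
     weierstrass_fibration \<iota> t x y
       (- (8 * t^2 * (1 + 2 * \<rho>)))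
       (2 * t^3 * (64 * \<rho> + 8 * t - 32 * \<rho> * t + 16 * \<rho>^2 * t + t^2 * \<rho>^3))
       0)"

definition I2_fibre :: "complex \<Rightarrow> complex \<Rightarrow> bool" where
  "I2_fibre r c \<longleftrightarrow> 64 * r + 8 * c - 32 * r * c + 16 * r^2 * c + c^2 * r^3 = 0"

text \<open>
  A curve is given by the order of vanishing along it, a normalised discrete valuation that is
  trivial on the constants (the value at \<open>0\<close> is irrelevant) and whose residue field is
  transcendental over the constants. As the constants are algebraically closed, the last
  condition says that some function \<open>z\<close> is regular and not constant along the curve.
\<close>

definition discrete_valuation :: "(complex \<Rightarrow> 'k::field) \<Rightarrow> ('k \<Rightarrow> int) \<Rightarrow> bool" where
  "discrete_valuation \<iota> v \<longleftrightarrow>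
     (\<forall>z w. z \<noteq> 0 \<longrightarrow> w \<noteq> 0 \<longrightarrow> v (z * w) = v z + v w) \<and>
     (\<forall>z w. z \<noteq> 0 \<longrightarrow> w \<noteq> 0 \<longrightarrow> z + w \<noteq> 0 \<longrightarrow> min (v z) (v w) \<le> v (z + w)) \<and>
     (\<forall>c. c \<noteq> 0 \<longrightarrow> v (\<iota> c) = 0) \<and>
     (\<exists>z. z \<noteq> 0 \<and> v z = 1)"

definition nonconstant_along :: "(complex \<Rightarrow> 'k::field) \<Rightarrow> ('k \<Rightarrow> int) \<Rightarrow> 'k \<Rightarrow> bool" where
  "nonconstant_along \<iota> v z \<longleftrightarrow> (\<forall>c. z \<noteq> \<iota> c \<and> v (z - \<iota> c) = 0)"

definition curve_orders ::
  "(complex \<Rightarrow> 'k::field) \<Rightarrow> 'k \<Rightarrow> 'k \<Rightarrow> 'k \<Rightarrow> int \<Rightarrow> int \<Rightarrow> int \<Rightarrow> 'k \<Rightarrow> ('k \<Rightarrow> int) \<Rightarrow> bool" where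
  "curve_orders \<iota> s x y a b c z v \<longleftrightarrow>
     discrete_valuation \<iota> v \<and> v s = a \<and> v x = b \<and> v y = c \<and> nonconstant_along \<iota> v z"

text \<open>
  The components of the fibre \<open>III\<^sup>*\<close> over \<open>t = 0\<close> of a minimal Weierstrass
  equation \<open>y\<^sup>2 = x\<^sup>3 + A2 x\<^sup>2 + A4 x\<close> with \<open>A2\<close> of order at
  least \<open>2\<close> and \<open>A4\<close> of order \<open>3\<close>:

    Near1 -- Near2 -- Near3 -- Mid4 -- Far3 -- Far2 -- Far1,  with Branch2 attached to Mid4.

  The digit is the multiplicity in the fibre, i.e. the order of \<open>t\<close>; Near1 is the component
  that meets the zero section. The orders of \<open>(t, x, y)\<close> are those along the strict
  transform of the fibre and along the exceptional curves of the toric resolution of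
  \<open>y\<^sup>2 = x\<^sup>3 + t\<^sup>3 x\<close>; \<open>dt \<and> dx / y\<close> has
  neither zero nor pole along these curves. Together with a function that is not constant along
  the curve the orders determine exactly one valuation: on the field generated by \<open>t\<close>
  and \<open>x\<close> (for Branch2, by \<open>t\<close> and \<open>y\<close>) it is monomial, and it has
  a unique extension with these orders to the whole field.
\<close>

datatype e7_node = Near1 | Near2 | Near3 | Mid4 | Branch2 | Far3 | Far2 | Far1

fun III_star_component ::
  "(complex \<Rightarrow> 'k::field) \<Rightarrow> 'k \<Rightarrow> 'k \<Rightarrow> 'k \<Rightarrow> e7_node \<Rightarrow> ('k \<Rightarrow> int) \<Rightarrow> bool" where
  "III_star_component \<iota> t x y Near1 = curve_orders \<iota> t x y 1 0 0 x"
| "III_star_component \<iota> t x y Near2 = curve_orders \<iota> t x y 2 2 3 (x / t)"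
| "III_star_component \<iota> t x y Near3 = curve_orders \<iota> t x y 3 4 6 (x^3 / t^4)"
| "III_star_component \<iota> t x y Mid4 = curve_orders \<iota> t x y 4 6 9 (x^2 / t^3)"
| "III_star_component \<iota> t x y Branch2 = curve_orders \<iota> t x y 2 3 5 (y^2 / t^5)"
| "III_star_component \<iota> t x y Far3 = curve_orders \<iota> t x y 3 5 7 (x^3 / t^5)"
| "III_star_component \<iota> t x y Far2 = curve_orders \<iota> t x y 2 4 5 (x / t^2)"
| "III_star_component \<iota> t x y Far1 = curve_orders \<iota> t x y 1 3 3 (x / t^3)"

text \<open>
  The component that meets the zero section is the strict transform of the plane cubic obtained
  by reducing a minimal Weierstrass equation modulo the local parameter \<open>s\<close>.
\<close>

definition identity_component ::
  "(complex \<Rightarrow> 'k::field) \<Rightarrow> 'k \<Rightarrow> 'k \<Rightarrow> 'k \<Rightarrow> ('k \<Rightarrow> int) \<Rightarrow> bool" where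
  "identity_component \<iota> s x y = curve_orders \<iota> s x y 1 0 0 x"

definition zero_section ::
  "(complex \<Rightarrow> 'k::field) \<Rightarrow> 'k \<Rightarrow> 'k \<Rightarrow> 'k \<Rightarrow> ('k \<Rightarrow> int) \<Rightarrow> bool" where
  "zero_section \<iota> t x y = curve_orders \<iota> t x y 0 (-2) (-3) t"

text \<open>
  The divisor of type \<open>I\<^sub>4\<^sup>*\<close>, as a set of curves with multiplicities. On a K3
  surface a local parameter of the base at \<open>\<infinity>\<close> is \<open>1/t\<close>, with Weierstrass
  coordinates \<open>x / t\<^sup>4\<close> and \<open>y / t\<^sup>6\<close>.
\<close>

definition I4_star_divisor ::
  "(complex \<Rightarrow> 'k::field) \<Rightarrow> 'k \<Rightarrow> 'k \<Rightarrow> 'k \<Rightarrow> complex \<Rightarrow> (('k \<Rightarrow> int) \<times> nat) set" where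
  "I4_star_divisor \<iota> t x y c =
     {(v, 2) | v. zero_section \<iota> t x y v} \<union>
     {(v, 2) | v k. k \<in> {Near1, Near2, Near3, Mid4} \<and> III_star_component \<iota> t x y k v} \<union>
     {(v, 1) | v k. k \<in> {Branch2, Far3} \<and> III_star_component \<iota> t x y k v} \<union>
     {(v, 1) | v. identity_component \<iota> (1 / t) (x / t^4) (y / t^6) v} \<union>
     {(v, 1) | v. identity_component \<iota> (t - \<iota> c) x y v}"

text \<open>
  If \<open>u\<close> is the parameter of a fibration of the K3 surface into curves of genus one, and has
  poles along the nine curves with exactly these multiplicities, then the divisor is the fibre
  over \<open>u = \<infinity>\<close>: fibres are connected, and the divisor already has self-intersection
  zero. So this is the fibration that the divisor induces, and \<open>u\<close> is unique up to affine
  transformations.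
\<close>

definition induced_fibration ::
  "(complex \<Rightarrow> 'k::field) \<Rightarrow> (('k \<Rightarrow> int) \<times> nat) set \<Rightarrow> 'k \<Rightarrow> 'k \<Rightarrow> 'k \<Rightarrow> 'k \<Rightarrow> 'k \<Rightarrow> 'k \<Rightarrow> bool"
  where
  "induced_fibration \<iota> D u X Y A2 A4 A6 \<longleftrightarrow>
     weierstrass_fibration \<iota> u X Y A2 A4 A6 \<and> (\<forall>(v, m) \<in> D. v u = - int m)"

text \<open>
  Translation by the two-torsion section \<open>(0, 0)\<close> of
  \<open>Y\<^sup>2 = X\<^sup>3 + A X\<^sup>2 + B X\<close>, written with the slope \<open>Y / X\<close> of
  the chord through \<open>(X, Y)\<close> and \<open>(0, 0)\<close>.
\<close>

definition two_torsion_translation ::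
  "(complex \<Rightarrow> 'k::field) \<Rightarrow> 'k \<Rightarrow> 'k \<Rightarrow> 'k \<Rightarrow> 'k \<Rightarrow> ('k \<Rightarrow> 'k) \<Rightarrow> bool" where
  "two_torsion_translation \<iota> u X Y A \<tau> \<longleftrightarrow>
     const_automorphism \<iota> \<tau> \<and> \<tau> u = u \<and>
     \<tau> X = (Y / X)^2 - A - X \<and> \<tau> Y = - ((Y / X) * \<tau> X)"

definition kummer_translation ::
  "(complex \<Rightarrow> 'k::field) \<Rightarrow> 'k \<Rightarrow> 'k \<Rightarrow> 'k \<Rightarrow> complex \<Rightarrow> ('k \<Rightarrow> 'k) \<Rightarrow> bool" where
  "kummer_translation \<iota> t x y c \<tau> \<longleftrightarrow>
     (\<exists>u X Y A B. induced_fibration \<iota> (I4_star_divisor \<iota> t x y c) u X Y A B 0 \<and>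
        two_torsion_translation \<iota> u X Y A \<tau>)"

text \<open>The elliptic curve \<open>y\<^sup>2 = x\<^sup>3 + a x + b\<close>.\<close>

definition elliptic_curve :: "complex \<Rightarrow> complex \<Rightarrow> bool" where
  "elliptic_curve a b \<longleftrightarrow> 4 * a^3 + 27 * b^2 \<noteq> 0"

definition j_invariant :: "complex \<Rightarrow> complex \<Rightarrow> complex" where
  "j_invariant a b = 1728 * (4 * a^3) / (4 * a^3 + 27 * b^2)"

definition elliptic_product ::
  "(complex \<Rightarrow> 'l::field) \<Rightarrow> complex \<Rightarrow> complex \<Rightarrow> complex \<Rightarrow> complex \<Rightarrow> 'l \<Rightarrow> 'l \<Rightarrow> 'l \<Rightarrow> 'l \<Rightarrow> bool"
  where
  "elliptic_product \<kappa> a b a' b' p q p' q' \<longleftrightarrow>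
     const_embedding \<kappa> \<and> elliptic_curve a b \<and> elliptic_curve a' b' \<and>
     alg_independent \<kappa> p p' \<and> adjoin \<kappa> {p, q, p', q'} = UNIV \<and>
     q^2 = p^3 + \<kappa> a * p + \<kappa> b \<and> q'^2 = p'^3 + \<kappa> a' * p' + \<kappa> b'"

text \<open>
  Multiplication by \<open>-1\<close> on the product. Its fixed field is the function field of the
  Kummer surface of the product.
\<close>

definition product_negation ::
  "(complex \<Rightarrow> 'l::field) \<Rightarrow> 'l \<Rightarrow> 'l \<Rightarrow> 'l \<Rightarrow> 'l \<Rightarrow> ('l \<Rightarrow> 'l) \<Rightarrow> bool" where
  "product_negation \<kappa> p q p' q' \<sigma> \<longleftrightarrow>
     const_automorphism \<kappa> \<sigma> \<and> \<sigma> p = p \<and> \<sigma> q = - q \<and> \<sigma> p' = p' \<and> \<sigma> q' = - q'"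

text \<open>
  The Hauptmodul \<open>a\<close> of \<open>X\<^sup>*(6)\<close>, as a function of a parameter
  \<open>s\<close> for which \<open>a\<close> and \<open>2 a + 1\<close> are squares, and the
  \<open>j\<close>-invariant of a parametrised elliptic curve. The zeros of \<open>2 s\<^sup>2 - 1\<close>
  lie over \<open>a = \<infinity>\<close> and those of the denominator of \<open>quer_j s\<close>
  lie over the cusp \<open>a = 4\<close>.
\<close>

definition hauptmodul :: "complex \<Rightarrow> complex" where
  "hauptmodul s = (2 * s / (2 * s^2 - 1))^2"

definition quer_j :: "complex \<Rightarrow> complex" where
  "quer_j s = 6912 * (5 * s^3 + 6 * s^2 - 2)^3 * s^3 /
     ((2 * s - 1) * (s + 1)^2 * (2 * s + 1)^3 * (s - 1)^6)"

end

theory Submission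
  imports Defs "HOL-Algebra.Algebraic_Closure_Type"
begin

text \<open>
  The proof makes every step of the Kummer construction explicit in function fields and then
  compares equations.

  For general \<open>r\<close> the surface carries a fibration over the line of
  \<open>m = x / (t (x + t\<^sup>2 + t))\<close> with full two-torsion, two fibres
  \<open>I\<^sub>2\<^sup>*\<close> and four fibres \<open>I\<^sub>2\<close>. Two disjoint
  configurations of type \<open>III\<^sup>*\<close> can be read off from the components of its
  fibres and its torsion sections; the function \<open>u\<close> with these as zero and pole divisor
  presents the surface as \<open>W\<^sup>2 = u (u m\<^sup>2 + r) (2 u m\<^sup>2 + (1 - r u) m + 1)\<close>,
  a curve of genus one over the \<open>u\<close>-line with a rational point. Its Weierstrass form is
  the fibration with two fibres \<open>III\<^sup>*\<close>, at \<open>t = 8 u\<close>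
  (\<open>X3_double_plane\<close>, \<open>III_star_fibration_of_double_plane\<close>).

  The divisor of type \<open>I\<^sub>4\<^sup>*\<close> is the polar divisor of
  \<open>x / (t\<^sup>2 (t - c))\<close>. With a multiple of this function as \<open>u\<close> the surface
  becomes \<open>y\<^sup>2 = x\<^sup>3 + A x\<^sup>2 + B x\<close>, where \<open>A\<close> is \<open>u\<close> times
  a quadratic polynomial and \<open>B\<close> is a constant times \<open>u\<^sup>4\<close>
  (\<open>I4_star_fibration\<close>), and the quotient by the two-torsion translation is
  \<open>y\<^sup>2 = x ((x - A)\<^sup>2 - 4 B)\<close> (\<open>two_torsion_quotient\<close>).

  On the other side let \<open>q\<^sup>2 = p (p\<^sup>2 + M p + N)\<close> and
  \<open>q'\<^sup>2 = p' (p'\<^sup>2 + M' p' + N')\<close> be two elliptic curves with a marked two-torsion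
  point. The fibration of their Kummer surface with parameter \<open>u = p / p'\<close> has the same shape
  with \<open>A = u (N' u\<^sup>2 - M M' u / 2 + N)\<close> and
  \<open>16 B = (M\<^sup>2 - 4 N) (M'\<^sup>2 - 4 N') u\<^sup>4\<close> (\<open>kummer_field\<close>).

  The curves with invariant \<open>quer_j s\<close> have a two-torsion point that is rational in
  \<open>s\<close>, because \<open>X\<^sub>0(6)\<close> parametrises curves with a cyclic subgroup of order
  six, which contains a subgroup of order two. With \<open>M\<close> and \<open>N\<close> taken from it at
  \<open>s\<close> and at \<open>-s\<close> the two pairs \<open>(A, B)\<close> agree up to scaling when the
  Hauptmodul of \<open>s\<close> is
  \<open>-2 (r + 2) / (4 r - 1)\<close>; the coordinate \<open>c\<close> of the \<open>I\<^sub>2\<close> fibre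
  is rational in \<open>s\<close> since \<open>1 - 4 r\<close> is then the square of
  \<open>3 (2 s\<^sup>2 - 1) / (2 s\<^sup>2 + 1)\<close> (\<open>quer_parameters\<close>). Equal equations
  give isomorphic function fields (\<open>double_plane_isomorphism\<close>).

  All changes of coordinates have to preserve algebraic independence. This is
  the exchange property \<open>alg_independent_exchange\<close>, a consequence of the fact that the
  elements algebraic over a subfield form a field.
\<close>

section \<open>Algebraic dependence over the constants\<close>

definition ring_morphism :: "('a::comm_ring_1 \<Rightarrow> 'b::comm_ring_1) \<Rightarrow> bool" where
  "ring_morphism f \<longleftrightarrow>
     f 1 = 1 \<and> (\<forall>a b. f (a + b) = f a + f b) \<and> (\<forall>a b. f (a * b) = f a * f b)"

lemma ring_morphism_1: "ring_morphism f \<Longrightarrow> f 1 = 1"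
  and ring_morphism_add: "ring_morphism f \<Longrightarrow> f (a + b) = f a + f b"
  and ring_morphism_mult: "ring_morphism f \<Longrightarrow> f (a * b) = f a * f b"
  by (simp_all add: ring_morphism_def)

lemma ring_morphism_0: "ring_morphism f \<Longrightarrow> f 0 = 0"
  using ring_morphism_add[of f 0 0] by simp

lemma ring_morphism_uminus: "ring_morphism f \<Longrightarrow> f (- a) = - f a"
  using ring_morphism_add[of f a "- a"] ring_morphism_0[of f] by (simp add: eq_neg_iff_add_eq_0 add.commute)

lemma ring_morphism_diff: "ring_morphism f \<Longrightarrow> f (a - b) = f a - f b"
  using ring_morphism_add[of f a "- b"] ring_morphism_uminus[of f b] by simp

lemma ring_morphism_power: "ring_morphism f \<Longrightarrow> f (a ^ n) = f a ^ n"
  by (induction n) (simp_all add: ring_morphism_1 ring_morphism_mult)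

lemma ring_morphism_of_nat: "ring_morphism f \<Longrightarrow> f (of_nat n) = of_nat n"
  by (induction n) (simp_all add: ring_morphism_0 ring_morphism_1 ring_morphism_add)

lemma ring_morphism_numeral: "ring_morphism f \<Longrightarrow> f (numeral n) = numeral n"
  using ring_morphism_of_nat[of f "numeral n"] by simp

lemma ring_morphism_sum: "ring_morphism f \<Longrightarrow> f (sum g A) = (\<Sum>i\<in>A. f (g i))"
  by (induction A rule: infinite_finite_induct) (simp_all add: ring_morphism_0 ring_morphism_add)

lemmas ring_morphism_simps =
  ring_morphism_0 ring_morphism_1 ring_morphism_add ring_morphism_mult ring_morphism_uminus
  ring_morphism_diff ring_morphism_power ring_morphism_numeral

lemma ring_morphism_const_embedding: "const_embedding \<iota> \<longleftrightarrow> ring_morphism \<iota>"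
  by (simp add: const_embedding_def ring_morphism_def)

lemma ring_morphism_inverse:
  fixes f :: "'a::field \<Rightarrow> 'b::field"
  assumes "ring_morphism f" shows "f (inverse a) = inverse (f a)"
proof (cases "a = 0")
  case True thus ?thesis using ring_morphism_0[OF assms] by simp
next
  case False
  have "f a * f (inverse a) = 1"
    using False ring_morphism_mult[OF assms, of a "inverse a"] ring_morphism_1[OF assms] by simp
  thus ?thesis by (metis inverse_unique)
qed

lemma ring_morphism_divide:
  fixes f :: "'a::field \<Rightarrow> 'b::field"
  assumes "ring_morphism f" shows "f (a / b) = f a / f b"
  by (simp add: divide_inverse ring_morphism_mult[OF assms] ring_morphism_inverse[OF assms])

lemma ring_morphism_eq_0_iff:
  fixes f :: "'a::field \<Rightarrow> 'b::field"
  assumes "ring_morphism f" shows "f a = 0 \<longleftrightarrow> a = 0"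
proof
  assume "f a = 0"
  hence "f (a * inverse a) = 0" by (simp add: ring_morphism_mult[OF assms])
  thus "a = 0" using ring_morphism_1[OF assms] by (cases "a = 0") auto
qed (simp add: ring_morphism_0[OF assms])

lemma ring_morphism_eval:
  assumes "ring_morphism f"
  shows "ring_morphism (\<lambda>p. poly (map_poly f p) s)"
proof -
  note 0 = ring_morphism_0[OF assms]
  have add: "map_poly f (p + q) = map_poly f p + map_poly f q" for p q
    by (rule poly_eqI) (simp add: coeff_map_poly 0 ring_morphism_add[OF assms])
  have mult: "map_poly f (p * q) = map_poly f p * map_poly f q" for p q
    by (rule poly_eqI)
      (simp add: coeff_map_poly 0 coeff_mult ring_morphism_mult[OF assms] ring_morphism_sum[OF assms])
  show ?thesis
    using ring_morphism_1[OF assms] 0 by (simp add: ring_morphism_def add mult map_poly_1')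
qed

text \<open>
  A polynomial in two variables is a polynomial in the second variable whose coefficients are
  polynomials in the first, so its value is obtained by evaluating twice.
\<close>

definition eval1 :: "('a::comm_ring_1 \<Rightarrow> 'k::comm_ring_1) \<Rightarrow> 'k \<Rightarrow> 'a poly \<Rightarrow> 'k" where
  "eval1 f s p = poly (map_poly f p) s"

abbreviation eval2 :: "('a::comm_ring_1 \<Rightarrow> 'k::comm_ring_1) \<Rightarrow> 'k \<Rightarrow> 'k \<Rightarrow> 'a poly poly \<Rightarrow> 'k" where
  "eval2 f s t \<equiv> eval1 (eval1 f s) t"

lemma eval1_morphism: "ring_morphism f \<Longrightarrow> ring_morphism (eval1 f s)"
  using ring_morphism_eval[of f s] by (simp add: eval1_def[abs_def])

lemma eval1_pCons: "ring_morphism f \<Longrightarrow> eval1 f s (pCons c p) = f c + s * eval1 f s p"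
  by (simp add: eval1_def map_poly_pCons ring_morphism_0)

lemma eval1_0: "eval1 f s 0 = 0"
  by (simp add: eval1_def)

lemma eval1_altdef:
  assumes "ring_morphism f" "Polynomial.degree p < n"
  shows "eval1 f s p = (\<Sum>i<n. f (Polynomial.coeff p i) * s ^ i)"
proof -
  have "eval1 f s p = (\<Sum>i\<le>Polynomial.degree (map_poly f p). f (Polynomial.coeff p i) * s ^ i)"
    by (simp add: eval1_def poly_altdef coeff_map_poly ring_morphism_0[OF assms(1)])
  also have "\<dots> = (\<Sum>i<n. f (Polynomial.coeff p i) * s ^ i)"
  proof (rule sum.mono_neutral_left)
    have "Polynomial.degree (map_poly f p) \<le> Polynomial.degree p"
      by (rule map_poly_degree_leq)
    thus "{..Polynomial.degree (map_poly f p)} \<subseteq> {..<n}"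
      using assms(2) by auto
    show "\<forall>i\<in>{..<n} - {..Polynomial.degree (map_poly f p)}. f (Polynomial.coeff p i) * s ^ i = 0"
    proof
      fix i assume "i \<in> {..<n} - {..Polynomial.degree (map_poly f p)}"
      hence "Polynomial.coeff (map_poly f p) i = 0" by (intro coeff_eq_0) auto
      thus "f (Polynomial.coeff p i) * s ^ i = 0"
        by (simp add: coeff_map_poly ring_morphism_0[OF assms(1)])
    qed
  qed simp
  finally show ?thesis .
qed

lemma alg_independent_eval2:
  "alg_independent \<iota> s t \<longleftrightarrow> (\<forall>P. P \<noteq> 0 \<longrightarrow> eval2 \<iota> s t P \<noteq> 0)"
  by (simp add: alg_independent_def eval1_def eval1_def[abs_def])

text \<open>
  Written with a matrix of coefficients, algebraic independence is visibly symmetric.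
\<close>

lemma alg_independent_sum:
  fixes \<iota> :: "complex \<Rightarrow> 'k::field"
  assumes \<iota>: "ring_morphism \<iota>"
  shows "alg_independent \<iota> s t \<longleftrightarrow>
    (\<forall>c n. (\<Sum>i<n. \<Sum>j<n. \<iota> (c i j) * s ^ i * t ^ j) = 0 \<longrightarrow> (\<forall>i<n. \<forall>j<n. c i j = 0))"
    (is "_ \<longleftrightarrow> ?R")
proof
  assume ind: "alg_independent \<iota> s t"
  show ?R
  proof (intro allI impI)
    fix c :: "nat \<Rightarrow> nat \<Rightarrow> complex" and n i0 j0
    assume 0: "(\<Sum>i<n. \<Sum>j<n. \<iota> (c i j) * s ^ i * t ^ j) = 0" and ij: "i0 < n" "j0 < n"
    define P where "P = (\<Sum>j<n. Polynomial.monom (\<Sum>i<n. Polynomial.monom (c i j) i) j)"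
    have m1: "eval1 f s (Polynomial.monom a i) = f a * s ^ i"
      if "ring_morphism f" for f :: "'b::comm_ring_1 \<Rightarrow> 'k" and a i s
      using that by (simp add: eval1_def map_poly_monom ring_morphism_0 poly_monom)
    have "eval2 \<iota> s t P = (\<Sum>j<n. \<Sum>i<n. \<iota> (c i j) * s ^ i * t ^ j)"
      by (simp add: P_def ring_morphism_sum eval1_morphism \<iota> m1 sum_distrib_right)
    also have "\<dots> = 0" using 0 by (subst sum.swap)
    finally have "P = 0" using ind by (auto simp: alg_independent_eval2)
    have "Polynomial.coeff P j0 = (\<Sum>i<n. Polynomial.monom (c i j0) i)"
      using ij by (simp add: P_def coeff_sum)
    hence "Polynomial.coeff (Polynomial.coeff P j0) i0 = c i0 j0"
      using ij by (simp add: coeff_sum)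
    thus "c i0 j0 = 0" using \<open>P = 0\<close> by simp
  qed
next
  assume R: ?R
  show "alg_independent \<iota> s t"
    unfolding alg_independent_eval2
  proof (intro allI impI notI)
    fix P :: "complex poly poly" assume "P \<noteq> 0" and 0: "eval2 \<iota> s t P = 0"
    define n where "n = Suc (Max (insert (Polynomial.degree P) ((\<lambda>j. Polynomial.degree (Polynomial.coeff P j)) ` {..Polynomial.degree P})))"
    have dP: "Polynomial.degree P < n"
      unfolding n_def less_Suc_eq_le by (intro Max_ge) auto
    have dj: "Polynomial.degree (Polynomial.coeff P j) < n" for j
    proof (cases "j \<le> Polynomial.degree P")
      case True thus ?thesis unfolding n_def less_Suc_eq_le by (intro Max_ge) auto
    next
      case False
      hence "Polynomial.coeff P j = 0" by (intro coeff_eq_0) auto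
      thus ?thesis using dP by simp
    qed
    have "eval2 \<iota> s t P = (\<Sum>j<n. (\<Sum>i<n. \<iota> (Polynomial.coeff (Polynomial.coeff P j) i) * s ^ i) * t ^ j)"
      by (simp add: eval1_altdef[OF eval1_morphism[OF \<iota>] dP] eval1_altdef[OF \<iota> dj])
    also have "\<dots> = (\<Sum>i<n. \<Sum>j<n. \<iota> (Polynomial.coeff (Polynomial.coeff P j) i) * s ^ i * t ^ j)"
      by (subst sum.swap) (simp add: sum_distrib_right)
    finally have "\<forall>i<n. \<forall>j<n. Polynomial.coeff (Polynomial.coeff P j) i = 0"
      using R[rule_format, of "\<lambda>i j. Polynomial.coeff (Polynomial.coeff P j) i" n] 0 by auto
    moreover have "Polynomial.coeff (Polynomial.coeff P (Polynomial.degree P))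
        (Polynomial.degree (Polynomial.coeff P (Polynomial.degree P))) \<noteq> 0"
      using \<open>P \<noteq> 0\<close> by simp
    ultimately show False using dP dj by blast
  qed
qed

lemma alg_independent_sym:
  fixes \<iota> :: "complex \<Rightarrow> 'k::field"
  assumes "ring_morphism \<iota>" "alg_independent \<iota> s t"
  shows "alg_independent \<iota> t s"
  unfolding alg_independent_sum[OF assms(1)]
proof (intro allI impI)
  fix c :: "nat \<Rightarrow> nat \<Rightarrow> complex" and n i j
  assume 0: "(\<Sum>i<n. \<Sum>j<n. \<iota> (c i j) * t ^ i * s ^ j) = 0" and "i < n" "j < n"
  have "(\<Sum>i<n. \<Sum>j<n. \<iota> (c j i) * s ^ i * t ^ j) = 0"
    using 0 by (subst sum.swap) (simp add: mult_ac)
  thus "c i j = 0"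
    using assms(2)[unfolded alg_independent_sum[OF assms(1)], rule_format, of "\<lambda>i j. c j i" n j i]
      \<open>i < n\<close> \<open>j < n\<close> by simp
qed

lemma adjoin_0: "ring_morphism \<iota> \<Longrightarrow> 0 \<in> adjoin \<iota> S"
  using adjoin.const[of \<iota> 0 S] by (simp add: ring_morphism_0)

lemma adjoin_1: "ring_morphism \<iota> \<Longrightarrow> 1 \<in> adjoin \<iota> S"
  using adjoin.const[of \<iota> 1 S] by (simp add: ring_morphism_1)

lemma adjoin_numeral: "ring_morphism \<iota> \<Longrightarrow> numeral n \<in> adjoin \<iota> S"
  using adjoin.const[of \<iota> "numeral n" S] by (simp add: ring_morphism_numeral)

lemma adjoin_diff: "z \<in> adjoin \<iota> S \<Longrightarrow> w \<in> adjoin \<iota> S \<Longrightarrow> z - w \<in> adjoin \<iota> S"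
  using adjoin.add[of z \<iota> S "- w"] adjoin.minus[of w \<iota> S] by simp

lemma adjoin_divide: "z \<in> adjoin \<iota> S \<Longrightarrow> w \<in> adjoin \<iota> S \<Longrightarrow> z / w \<in> adjoin \<iota> S"
  unfolding divide_inverse by (intro adjoin.mult adjoin.inverse)

lemma adjoin_power: "ring_morphism \<iota> \<Longrightarrow> z \<in> adjoin \<iota> S \<Longrightarrow> z ^ n \<in> adjoin \<iota> S"
  by (induction n) (auto intro: adjoin_1 adjoin.mult)

lemmas adjoin_intros = adjoin_0 adjoin_1 adjoin_numeral adjoin.add adjoin.minus adjoin_diff
  adjoin.mult adjoin_divide adjoin_power adjoin.const

lemma adjoin_subset:
  assumes "S \<subseteq> adjoin \<iota> T" shows "adjoin \<iota> S \<subseteq> adjoin \<iota> T"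
proof
  fix z assume "z \<in> adjoin \<iota> S"
  thus "z \<in> adjoin \<iota> T"
    by induction (use assms in \<open>auto intro: adjoin.intros\<close>)
qed

lemma eval1_in_adjoin:
  assumes "ring_morphism \<iota>" "s \<in> adjoin \<iota> S" shows "eval1 \<iota> s p \<in> adjoin \<iota> S"
  by (induction p) (use assms in \<open>auto simp: eval1_0 eval1_pCons intro!: adjoin_intros\<close>)

lemma adjoin_singletonE:
  fixes \<iota> :: "complex \<Rightarrow> 'k::field"
  assumes \<iota>: "ring_morphism \<iota>" and z: "z \<in> adjoin \<iota> {s}"
  obtains p q where "eval1 \<iota> s q \<noteq> 0" "z * eval1 \<iota> s q = eval1 \<iota> s p"
proof -
  note m = eval1_morphism[OF \<iota>, of s]
  have "\<exists>p q. eval1 \<iota> s q \<noteq> 0 \<and> z * eval1 \<iota> s q = eval1 \<iota> s p"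
    using z
  proof induction
    case (const c)
    have "eval1 \<iota> s 1 \<noteq> 0 \<and> \<iota> c * eval1 \<iota> s 1 = eval1 \<iota> s [:c:]"
      by (simp add: ring_morphism_1[OF m] eval1_pCons[OF \<iota>] eval1_0)
    thus ?case by blast
  next
    case (gen z)
    hence "eval1 \<iota> s 1 \<noteq> 0 \<and> z * eval1 \<iota> s 1 = eval1 \<iota> s [:0, 1:]"
      by (simp add: ring_morphism_1[OF m] eval1_pCons[OF \<iota>] eval1_0 ring_morphism_simps[OF \<iota>])
    thus ?case by blast
  next
    case (add z w)
    then obtain p q p' q' where
      "eval1 \<iota> s q \<noteq> 0" "z * eval1 \<iota> s q = eval1 \<iota> s p"
      "eval1 \<iota> s q' \<noteq> 0" "w * eval1 \<iota> s q' = eval1 \<iota> s p'" by blast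
    hence "eval1 \<iota> s (q * q') \<noteq> 0 \<and> (z + w) * eval1 \<iota> s (q * q') = eval1 \<iota> s (p * q' + p' * q)"
      by (simp add: ring_morphism_simps[OF m] flip: \<open>z * _ = _\<close> \<open>w * _ = _\<close>)
        (simp add: algebra_simps)
    thus ?case by blast
  next
    case (minus z)
    then obtain p q where "eval1 \<iota> s q \<noteq> 0" "z * eval1 \<iota> s q = eval1 \<iota> s p" by blast
    hence "eval1 \<iota> s q \<noteq> 0 \<and> (- z) * eval1 \<iota> s q = eval1 \<iota> s (- p)"
      by (simp add: ring_morphism_simps[OF m])
    thus ?case by blast
  next
    case (mult z w)
    then obtain p q p' q' where
      "eval1 \<iota> s q \<noteq> 0" "z * eval1 \<iota> s q = eval1 \<iota> s p"
      "eval1 \<iota> s q' \<noteq> 0" "w * eval1 \<iota> s q' = eval1 \<iota> s p'" by blast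
    hence "eval1 \<iota> s (q * q') \<noteq> 0 \<and> (z * w) * eval1 \<iota> s (q * q') = eval1 \<iota> s (p * p')"
      by (simp add: ring_morphism_simps[OF m] flip: \<open>z * _ = _\<close> \<open>w * _ = _\<close>)
    thus ?case by blast
  next
    case (inverse z)
    then obtain p q where pq: "eval1 \<iota> s q \<noteq> 0" "z * eval1 \<iota> s q = eval1 \<iota> s p" by blast
    show ?case
    proof (cases "z = 0")
      case True
      have "eval1 \<iota> s 1 \<noteq> 0 \<and> Fields.inverse z * eval1 \<iota> s 1 = eval1 \<iota> s 0"
        using True by (simp add: ring_morphism_simps[OF m])
      thus ?thesis by blast
    next
      case False
      hence "eval1 \<iota> s p \<noteq> 0 \<and> Fields.inverse z * eval1 \<iota> s p = eval1 \<iota> s q"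
        using pq(1) by (simp flip: pq(2))
      thus ?thesis by blast
    qed
  qed
  thus ?thesis using that by blast
qed

definition algebraic_over :: "'k::field set \<Rightarrow> 'k \<Rightarrow> bool" where
  "algebraic_over F z \<longleftrightarrow> (\<exists>p. p \<noteq> 0 \<and> (\<forall>i. Polynomial.coeff p i \<in> F) \<and> poly p z = 0)"

text \<open>
  Clearing denominators turns a relation over \<open>adjoin \<iota> {s}\<close> into a polynomial
  relation between \<open>s\<close> and \<open>t\<close>.
\<close>

lemma clear_denominators:
  fixes \<iota> :: "complex \<Rightarrow> 'k::field"
  assumes \<iota>: "ring_morphism \<iota>" and "\<forall>i. Polynomial.coeff p i \<in> adjoin \<iota> {s}"
  shows "\<exists>D P. eval1 \<iota> s D \<noteq> 0 \<and> Polynomial.smult (eval1 \<iota> s D) p = map_poly (eval1 \<iota> s) P"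
  using assms(2)
proof (induction p)
  case 0
  have "eval1 \<iota> s 1 \<noteq> 0 \<and> Polynomial.smult (eval1 \<iota> s 1) 0 = map_poly (eval1 \<iota> s) 0"
    by (simp add: ring_morphism_1[OF eval1_morphism[OF \<iota>]])
  thus ?case by blast
next
  case (pCons a p)
  note m = eval1_morphism[OF \<iota>, of s]
  have "a \<in> adjoin \<iota> {s}"
    using pCons.prems[rule_format, of 0] by simp
  then obtain n d where a: "eval1 \<iota> s d \<noteq> 0" "a * eval1 \<iota> s d = eval1 \<iota> s n"
    using adjoin_singletonE[OF \<iota>] by blast
  have "\<forall>i. Polynomial.coeff p i \<in> adjoin \<iota> {s}"
    using pCons.prems by (auto simp: coeff_pCons split: nat.splits)
  then obtain D P where DP: "eval1 \<iota> s D \<noteq> 0" "Polynomial.smult (eval1 \<iota> s D) p = map_poly (eval1 \<iota> s) P"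
    using pCons.IH by blast
  have sm: "map_poly (eval1 \<iota> s) (Polynomial.smult d P) = Polynomial.smult (eval1 \<iota> s d) (map_poly (eval1 \<iota> s) P)"
    by (rule poly_eqI) (simp add: coeff_map_poly ring_morphism_simps[OF m])
  have "Polynomial.smult (eval1 \<iota> s (d * D)) (pCons a p) =
      pCons (eval1 \<iota> s (n * D)) (Polynomial.smult (eval1 \<iota> s d) (Polynomial.smult (eval1 \<iota> s D) p))"
    by (simp add: ring_morphism_simps[OF m] a(2)[symmetric] mult_ac)
  also have "\<dots> = map_poly (eval1 \<iota> s) (pCons (n * D) (Polynomial.smult d P))"
    by (simp add: DP(2) sm map_poly_pCons ring_morphism_0[OF m])
  finally have "Polynomial.smult (eval1 \<iota> s (d * D)) (pCons a p) = map_poly (eval1 \<iota> s) (pCons (n * D) (Polynomial.smult d P))" .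
  moreover have "eval1 \<iota> s (d * D) \<noteq> 0"
    using a DP by (simp add: ring_morphism_simps[OF m])
  ultimately show ?case by blast
qed

text \<open>
  Independence of a pair as a tower: the second element is transcendental over the field
  generated by the first. This is the form in which field theory applies.
\<close>

lemma alg_independent_iff:
  fixes \<iota> :: "complex \<Rightarrow> 'k::field"
  assumes \<iota>: "ring_morphism \<iota>"
  shows "alg_independent \<iota> s t \<longleftrightarrow>
    (\<forall>p. p \<noteq> 0 \<longrightarrow> eval1 \<iota> s p \<noteq> 0) \<and> \<not> algebraic_over (adjoin \<iota> {s}) t"
proof safe
  note m = eval1_morphism[OF \<iota>, of s]
  {
    fix p assume "alg_independent \<iota> s t" "p \<noteq> 0" "eval1 \<iota> s p = 0"
    hence "eval2 \<iota> s t [:p:] = 0" by (simp add: eval1_pCons[OF m] eval1_0)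
    thus False using \<open>alg_independent \<iota> s t\<close> \<open>p \<noteq> 0\<close> by (auto simp: alg_independent_eval2)
  next
    assume ind: "alg_independent \<iota> s t" and "algebraic_over (adjoin \<iota> {s}) t"
    then obtain p where p: "p \<noteq> 0" "\<forall>i. Polynomial.coeff p i \<in> adjoin \<iota> {s}" "poly p t = 0"
      by (auto simp: algebraic_over_def)
    obtain D P where D: "eval1 \<iota> s D \<noteq> 0" "Polynomial.smult (eval1 \<iota> s D) p = map_poly (eval1 \<iota> s) P"
      using clear_denominators[OF \<iota> p(2)] by blast
    have "P \<noteq> 0" using D p(1) by auto
    moreover have "eval2 \<iota> s t P = 0"
      using p(3) by (simp add: eval1_def[of "eval1 \<iota> s"] flip: D(2))
    ultimately show False using ind by (auto simp: alg_independent_eval2)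
  next
    assume s: "\<forall>p. p \<noteq> 0 \<longrightarrow> eval1 \<iota> s p \<noteq> 0" and t: "\<not> algebraic_over (adjoin \<iota> {s}) t"
    show "alg_independent \<iota> s t"
      unfolding alg_independent_eval2
    proof (intro allI impI notI)
      fix P assume "P \<noteq> 0" "eval2 \<iota> s t P = 0"
      moreover have "Polynomial.coeff (map_poly (eval1 \<iota> s) P) (Polynomial.degree P) \<noteq> 0"
        using s \<open>P \<noteq> 0\<close> by (simp add: coeff_map_poly eval1_0)
      hence "map_poly (eval1 \<iota> s) P \<noteq> 0" by auto
      moreover have "\<forall>i. Polynomial.coeff (map_poly (eval1 \<iota> s) P) i \<in> adjoin \<iota> {s}"
        by (simp add: coeff_map_poly eval1_0 eval1_in_adjoin \<iota> adjoin.gen)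
      ultimately show False
        using t by (auto simp: algebraic_over_def eval1_def[of "eval1 \<iota> s"])
    qed
  }
qed

lemma algebraic_over_self:
  assumes "ring_morphism \<iota>" "z \<in> adjoin \<iota> S" shows "algebraic_over (adjoin \<iota> S) z"
  unfolding algebraic_over_def
  by (rule exI[of _ "[:- z, 1:]"])
    (use assms in \<open>auto simp: coeff_pCons split: nat.splits intro!: adjoin_intros\<close>)

lemma alg_independent_not_in_adjoin:
  assumes "ring_morphism \<iota>" "alg_independent \<iota> s t" shows "t \<notin> adjoin \<iota> {s}"
  using assms algebraic_over_self alg_independent_iff by blast

text \<open>
  A relation for \<open>z\<^sup>2\<close> is a relation for \<open>z\<close> in which only even powers
  occur.
\<close>

lemma algebraic_over_sqrt:
  assumes "algebraic_over F (z ^ 2)" "0 \<in> F" shows "algebraic_over F z"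
proof -
  obtain p where p: "p \<noteq> 0" "\<forall>i. Polynomial.coeff p i \<in> F" "poly p (z ^ 2) = 0"
    using assms by (auto simp: algebraic_over_def)
  have "\<forall>i. Polynomial.coeff (p \<circ>\<^sub>p [:0, 0, 1:]) i \<in> F"
    using p(2)
  proof (induction p)
    case (pCons a p)
    have "\<forall>i. Polynomial.coeff p i \<in> F"
      using pCons.prems by (auto simp: coeff_pCons split: nat.splits)
    moreover have "a \<in> F"
      using pCons.prems[rule_format, of 0] by simp
    moreover have "pCons a p \<circ>\<^sub>p [:0, 0, 1:] = pCons a (pCons 0 (p \<circ>\<^sub>p [:0, 0, 1:]))"
      by (simp add: pcompose_pCons)
    ultimately show ?case
      using pCons.IH assms(2) by (auto simp: coeff_pCons split: nat.splits)
  qed simp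
  moreover have "p \<circ>\<^sub>p [:0, 0, 1:] \<noteq> 0"
    using p(1) by (simp add: pcompose_eq_0_iff)
  ultimately show ?thesis
    using p(3) unfolding algebraic_over_def
    by (intro exI[of _ "p \<circ>\<^sub>p [:0, 0, 1:]"]) (simp add: poly_pcompose power2_eq_square)
qed

section \<open>The algebraic elements form a field\<close>

text \<open>
  The closure properties of algebraic elements are known for rings with a carrier and polynomials
  given as lists of coefficients, the leading one first. The next three lemmas translate.
\<close>

lemma eval_type_algebra:
  "ring.eval (ring_of_type_algebra :: 'k::field ring) l z = poly (Poly (rev l)) z"
proof -
  define R where "R = (ring_of_type_algebra :: 'k ring)"
  interpret R: Ring.field R unfolding R_def by (rule field_from_type_algebra)
  have R: "carrier R = UNIV" "\<And>x y. x \<otimes>\<^bsub>R\<^esub> y = x * y" "\<And>x y. x \<oplus>\<^bsub>R\<^esub> y = x + y"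
    "\<one>\<^bsub>R\<^esub> = 1" "\<zero>\<^bsub>R\<^esub> = 0"
    by (simp_all add: R_def ring_of_type_algebra_def)
  have pow: "z [^]\<^bsub>R\<^esub> (n::nat) = z ^ n" for n
    by (induction n) (simp_all add: R)
  show ?thesis unfolding R_def[symmetric]
    by (induction l) (simp_all add: R pow Poly_append poly_monom)
qed

lemma subfield_type_algebra:
  fixes F :: "'k::field set"
  shows "subfield F (ring_of_type_algebra :: 'k ring) \<longleftrightarrow>
    1 \<in> F \<and> (\<forall>x\<in>F. \<forall>y\<in>F. x + y \<in> F \<and> x * y \<in> F) \<and> (\<forall>x\<in>F. - x \<in> F \<and> inverse x \<in> F)"
    (is "_ \<longleftrightarrow> ?R")
proof -
  define R where "R = (ring_of_type_algebra :: 'k ring)"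
  interpret R: Ring.field R unfolding R_def by (rule field_from_type_algebra)
  have R: "carrier R = UNIV" "\<And>x y. x \<otimes>\<^bsub>R\<^esub> y = x * y" "\<And>x y. x \<oplus>\<^bsub>R\<^esub> y = x + y"
    "\<one>\<^bsub>R\<^esub> = 1" "\<zero>\<^bsub>R\<^esub> = 0"
    by (simp_all add: R_def ring_of_type_algebra_def)
  have minus: "\<ominus>\<^bsub>R\<^esub> x = - x" for x
    by (rule R.minus_equality) (simp_all add: R)
  have inv: "inv\<^bsub>R\<^esub> x = inverse x" if "x \<noteq> 0" for x
    by (rule R.comm_inv_char) (use that in \<open>simp_all add: R\<close>)
  show ?thesis unfolding R_def[symmetric]
  proof
    assume F: "subfield F R"
    have "inverse x \<in> F" if "x \<in> F" for x
      using R.subfield_m_inv(1)[OF F, of x] that inv[of x] by (cases "x = 0") (auto simp: R)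
    thus ?R
      using subringE[OF subfieldE(1)[OF F]] by (auto simp: R minus)
  next
    assume ?R
    show "subfield F R"
      by (rule R.subfieldI'[OF R.subringI]) (use \<open>?R\<close> in \<open>auto simp: R minus inv\<close>)
  qed
qed

lemma algebraic_over_type_algebra:
  fixes F :: "'k::field set"
  assumes F: "subfield F (ring_of_type_algebra :: 'k ring)"
  shows "(ring.algebraic (ring_of_type_algebra :: 'k ring) over F) z \<longleftrightarrow> algebraic_over F z"
proof -
  define R where "R = (ring_of_type_algebra :: 'k ring)"
  interpret R: Ring.field R unfolding R_def by (rule field_from_type_algebra)
  have R: "carrier R = UNIV" "\<zero>\<^bsub>R\<^esub> = 0"
    by (simp_all add: R_def ring_of_type_algebra_def)
  note sub = subfieldE(1)[OF F, folded R_def]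
  have "0 \<in> F" using subringE(2)[OF sub] by (simp add: R)
  show ?thesis unfolding R_def[symmetric]
  proof
    assume "(R.algebraic over F) z"
    then obtain l where l: "l \<in> carrier (F [X]\<^bsub>R\<^esub>)" "l \<noteq> []" "R.eval l z = \<zero>\<^bsub>R\<^esub>"
      using R.algebraicE[OF sub, of z] by (auto simp: R)
    have l': "set l \<subseteq> F" "hd l \<noteq> 0"
      using l(1,2) by (auto simp: univ_poly_def polynomial_def R)
    have "Polynomial.coeff (Poly (rev l)) (length l - 1) = hd l"
      using l(2) by (simp add: nth_default_def rev_nth hd_conv_nth)
    hence "Poly (rev l) \<noteq> 0" using l'(2) by (metis coeff_0)
    moreover have "Polynomial.coeff (Poly (rev l)) i \<in> F" for i
      using l'(1) \<open>0 \<in> F\<close> by (auto simp: nth_default_def rev_nth)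
    moreover have "poly (Poly (rev l)) z = 0"
      using l(3) by (simp add: R) (simp add: R_def eval_type_algebra)
    ultimately show "algebraic_over F z" by (auto simp: algebraic_over_def)
  next
    assume "algebraic_over F z"
    then obtain p where p: "p \<noteq> 0" "\<forall>i. Polynomial.coeff p i \<in> F" "poly p z = 0"
      by (auto simp: algebraic_over_def)
    have "set (coeffs p) \<subseteq> F" using p(2) by (auto simp: coeffs_def)
    show "(R.algebraic over F) z"
    proof (rule R.algebraicI)
      show "rev (coeffs p) \<in> carrier (F [X]\<^bsub>R\<^esub>)"
        using p(1) \<open>set (coeffs p) \<subseteq> F\<close>
        by (auto simp: univ_poly_def polynomial_def R hd_rev last_coeffs_eq_coeff_degree)
      show "rev (coeffs p) \<noteq> []" using p(1) by simp
      show "R.eval (rev (coeffs p)) z = \<zero>\<^bsub>R\<^esub>"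
        using p(3) by (simp add: R) (simp add: R_def eval_type_algebra)
    qed
  qed
qed

lemma adjoin_subfield:
  "ring_morphism \<iota> \<Longrightarrow> subfield (adjoin \<iota> S) (ring_of_type_algebra :: 'k::field ring)"
  by (auto simp: subfield_type_algebra intro: adjoin_intros adjoin.intros)

lemma adjoin_algebraic:
  fixes \<iota> :: "complex \<Rightarrow> 'k::field"
  assumes \<iota>: "ring_morphism \<iota>" and T: "\<And>z. z \<in> T \<Longrightarrow> algebraic_over (adjoin \<iota> S) z"
    and z: "z \<in> adjoin \<iota> T"
  shows "algebraic_over (adjoin \<iota> S) z"
proof -
  interpret R: Ring.field "ring_of_type_algebra :: 'k ring" by (rule field_from_type_algebra)
  have "subfield {z. algebraic_over (adjoin \<iota> S) z} (ring_of_type_algebra :: 'k ring)"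
    using R.subfield_of_algebraics[OF adjoin_subfield[OF \<iota>, of S]]
    by (simp add: algebraic_over_type_algebra[OF adjoin_subfield[OF \<iota>]]) (simp add: ring_of_type_algebra_def)
  note closed = this[unfolded subfield_type_algebra]
  show ?thesis
    using z
  proof induction
    case (const c)
    show ?case by (rule algebraic_over_self[OF \<iota>]) (rule adjoin.const)
  qed (use closed T in auto)
qed

text \<open>
  Used for changes of coordinates: if \<open>b'\<close> were algebraic over the field of \<open>a\<close>, then
  so would be the square roots \<open>Y\<close> and everything expressed through them, in particular
  \<open>b\<close>.
\<close>

lemma alg_independent_exchange:
  fixes \<iota> :: "complex \<Rightarrow> 'k::field"
  assumes \<iota>: "ring_morphism \<iota>" and ind: "alg_independent \<iota> a b"
    and b: "b \<in> adjoin \<iota> (Y \<union> {a, b'})"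
    and Y: "\<And>y. y \<in> Y \<Longrightarrow> y ^ 2 \<in> adjoin \<iota> {a, b'}"
  shows "alg_independent \<iota> a b'"
  unfolding alg_independent_iff[OF \<iota>]
proof (intro conjI notI)
  show "\<forall>p. p \<noteq> 0 \<longrightarrow> eval1 \<iota> a p \<noteq> 0"
    using ind by (simp add: alg_independent_iff[OF \<iota>])
  let ?F = "adjoin \<iota> {a}"
  assume b': "algebraic_over ?F b'"
  have a: "algebraic_over ?F a"
    by (rule algebraic_over_self[OF \<iota>]) (simp add: adjoin.gen)
  have ab': "algebraic_over ?F z" if "z \<in> adjoin \<iota> {a, b'}" for z
    using adjoin_algebraic[OF \<iota> _ that] a b' by blast
  have "algebraic_over ?F y" if "y \<in> Y" for y
    using algebraic_over_sqrt[OF ab'[OF Y[OF that]] adjoin_0[OF \<iota>]] .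
  hence "algebraic_over ?F b"
    using adjoin_algebraic[OF \<iota> _ b] a b' by blast
  thus False using ind by (simp add: alg_independent_iff[OF \<iota>])
qed

section \<open>Function fields of double planes\<close>

text \<open>
  The functions on the double plane \<open>y\<^sup>2 = F(s, t)\<close> are the fractions
  \<open>(P + Q y) / D\<close> with polynomials \<open>D\<close>, \<open>P\<close>, \<open>Q\<close> in
  \<open>s\<close> and \<open>t\<close>. Here \<open>e\<close> is the evaluation of polynomials.
\<close>

definition fraction_form :: "('a::comm_ring_1 \<Rightarrow> 'k::field) \<Rightarrow> 'k \<Rightarrow> 'a \<Rightarrow> 'a \<Rightarrow> 'a \<Rightarrow> 'k \<Rightarrow> bool" where
  "fraction_form e y D P Q z \<longleftrightarrow> z * e D = e P + e Q * y"

lemma fraction_form_add: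
  assumes "ring_morphism e" "fraction_form e y D P Q z" "fraction_form e y D' P' Q' z'"
  shows "fraction_form e y (D * D') (P * D' + P' * D) (Q * D' + Q' * D) (z + z')"
proof -
  have "(z + z') * (e D * e D') = (z * e D) * e D' + (z' * e D') * e D"
    by (simp add: algebra_simps)
  also have "\<dots> = (e P + e Q * y) * e D' + (e P' + e Q' * y) * e D"
    using assms(2,3) by (simp add: fraction_form_def)
  finally show ?thesis
    by (simp add: fraction_form_def ring_morphism_simps[OF assms(1)] algebra_simps)
qed

lemma fraction_form_minus:
  assumes "ring_morphism e" "fraction_form e y D P Q z"
  shows "fraction_form e y D (- P) (- Q) (- z)"
  using assms(2) by (simp add: fraction_form_def ring_morphism_simps[OF assms(1)])

lemma fraction_form_mult:
  assumes "ring_morphism e" "y ^ 2 = e F" "fraction_form e y D P Q z" "fraction_form e y D' P' Q' z'"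
  shows "fraction_form e y (D * D') (P * P' + Q * Q' * F) (P * Q' + Q * P') (z * z')"
proof -
  have "(z * z') * (e D * e D') = (z * e D) * (z' * e D')"
    by (simp add: algebra_simps)
  also have "\<dots> = (e P + e Q * y) * (e P' + e Q' * y)"
    using assms(3,4) by (simp add: fraction_form_def)
  also have "\<dots> = (e P * e P' + e Q * e Q' * y ^ 2) + (e P * e Q' + e Q * e P') * y"
    by (simp add: algebra_simps power2_eq_square)
  finally show ?thesis
    by (simp add: fraction_form_def ring_morphism_simps[OF assms(1)] assms(2))
qed

text \<open>
  The denominator becomes the norm \<open>(P + Q y) (P - Q y)\<close>.
\<close>

lemma fraction_form_inverse:
  assumes "ring_morphism e" "y ^ 2 = e F" "fraction_form e y D P Q z" "z \<noteq> 0"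
  shows "fraction_form e y (P ^ 2 - Q ^ 2 * F) (D * P) (- (D * Q)) (inverse z)"
proof -
  have "inverse z * (e P ^ 2 - e Q ^ 2 * y ^ 2) = inverse z * ((e P + e Q * y) * (e P - e Q * y))"
    by (simp add: algebra_simps power2_eq_square)
  also have "\<dots> = inverse z * ((z * e D) * (e P - e Q * y))"
    using assms(3) by (simp add: fraction_form_def)
  also have "\<dots> = e D * (e P - e Q * y)"
    using assms(4) by (simp add: field_simps)
  finally show ?thesis
    by (simp add: fraction_form_def ring_morphism_simps[OF assms(1)] assms(2) algebra_simps)
qed

lemma odd_degree_not_square:
  fixes P Q F :: "'a::idom poly"
  assumes "odd (Polynomial.degree F)" "P ^ 2 = Q ^ 2 * F"
  shows "P = 0 \<and> Q = 0"
proof (rule ccontr)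
  assume "\<not> (P = 0 \<and> Q = 0)"
  moreover have "F \<noteq> 0" using assms(1) by auto
  ultimately have "P \<noteq> 0" "Q \<noteq> 0" using assms(2) by auto
  have "Polynomial.degree (P ^ 2) = Polynomial.degree (Q ^ 2 * F)"
    using assms(2) by simp
  hence "2 * Polynomial.degree P = 2 * Polynomial.degree Q + Polynomial.degree F"
    using \<open>P \<noteq> 0\<close> \<open>Q \<noteq> 0\<close> \<open>F \<noteq> 0\<close> by (simp add: degree_power_eq degree_mult_eq)
  thus False using assms(1) by presburger
qed

text \<open>
  Two functions on different double planes correspond if one fraction represents both. For equal
  branch polynomials this turns out to be the graph of an isomorphism.
\<close>

definition corresponding ::
  "('a::idom \<Rightarrow> 'k::field) \<Rightarrow> 'k \<Rightarrow> ('a \<Rightarrow> 'l::field) \<Rightarrow> 'l \<Rightarrow> 'k \<Rightarrow> 'l \<Rightarrow> bool" where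
  "corresponding e y e' y' z z' \<longleftrightarrow>
     (\<exists>D P Q. D \<noteq> 0 \<and> fraction_form e y D P Q z \<and> fraction_form e' y' D P Q z')"

lemma corresponding_sym: "corresponding e y e' y' z z' \<longleftrightarrow> corresponding e' y' e y z' z"
  by (auto simp: corresponding_def)

text \<open>
  Odd degree of \<open>F\<close> in the outer variable is an easily checked reason for \<open>F\<close>
  not to be a square, so that a fraction vanishes only if its numerator is zero as a polynomial.
\<close>

locale double_plane =
  fixes e :: "'b::idom poly \<Rightarrow> 'k::field" and y :: 'k and F :: "'b poly"
  assumes morphism: "ring_morphism e" and e_nonzero: "P \<noteq> 0 \<Longrightarrow> e P \<noteq> 0"
    and odd: "odd (Polynomial.degree F)" and y: "y ^ 2 = e F"
begin

lemma norm_nonzero: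
  assumes "P \<noteq> 0 \<or> Q \<noteq> 0" shows "P ^ 2 - Q ^ 2 * F \<noteq> 0"
  using odd_degree_not_square[OF odd, of P Q] assms by auto

lemma fraction_form_0:
  assumes "fraction_form e y D P Q 0" shows "P = 0 \<and> Q = 0"
proof (rule ccontr)
  assume "\<not> ?thesis"
  hence "e (P ^ 2 - Q ^ 2 * F) \<noteq> 0" by (intro e_nonzero norm_nonzero) auto
  moreover have "e (P ^ 2 - Q ^ 2 * F) = (e P + e Q * y) * (e P - e Q * y)"
    by (simp add: ring_morphism_simps[OF morphism] y[symmetric] algebra_simps power2_eq_square)
  ultimately show False using assms by (simp add: fraction_form_def)
qed

end

locale double_plane_pair = E: double_plane e y F + E': double_plane e' y' F
  for e :: "'b::idom poly \<Rightarrow> 'k::field" and y F and e' :: "'b poly \<Rightarrow> 'l::field" and y'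
begin

abbreviation R where "R \<equiv> corresponding e y e' y'"

lemma R_eval: "R (e P) (e' P)"
  unfolding corresponding_def fraction_form_def
  by (intro exI[of _ 1] exI[of _ P] exI[of _ 0])
    (simp add: ring_morphism_simps[OF E.morphism] ring_morphism_simps[OF E'.morphism])

lemma R_y: "R y y'"
  unfolding corresponding_def fraction_form_def
  by (intro exI[of _ 1] exI[of _ 0])
    (simp add: ring_morphism_simps[OF E.morphism] ring_morphism_simps[OF E'.morphism])

lemma R_intro: "D \<noteq> 0 \<Longrightarrow> fraction_form e y D P Q z \<Longrightarrow> fraction_form e' y' D P Q z' \<Longrightarrow> R z z'"
  unfolding corresponding_def by blast

lemma R_add: assumes "R z z'" "R w w'" shows "R (z + w) (z' + w')"
proof -
  obtain D P Q where D: "D \<noteq> 0" "fraction_form e y D P Q z" "fraction_form e' y' D P Q z'"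
    using assms(1) unfolding corresponding_def by blast
  obtain D' P' Q' where D': "D' \<noteq> 0" "fraction_form e y D' P' Q' w" "fraction_form e' y' D' P' Q' w'"
    using assms(2) unfolding corresponding_def by blast
  show ?thesis
    using D(1) D'(1)
    by (intro R_intro[OF _ fraction_form_add[OF E.morphism D(2) D'(2)]
          fraction_form_add[OF E'.morphism D(3) D'(3)]]) simp
qed

lemma R_minus: assumes "R z z'" shows "R (- z) (- z')"
proof -
  obtain D P Q where D: "D \<noteq> 0" "fraction_form e y D P Q z" "fraction_form e' y' D P Q z'"
    using assms(1) unfolding corresponding_def by blast
  show ?thesis
    by (rule R_intro[OF D(1) fraction_form_minus[OF E.morphism D(2)] fraction_form_minus[OF E'.morphism D(3)]])
qed

lemma R_mult: assumes "R z z'" "R w w'" shows "R (z * w) (z' * w')"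
proof -
  obtain D P Q where D: "D \<noteq> 0" "fraction_form e y D P Q z" "fraction_form e' y' D P Q z'"
    using assms(1) unfolding corresponding_def by blast
  obtain D' P' Q' where D': "D' \<noteq> 0" "fraction_form e y D' P' Q' w" "fraction_form e' y' D' P' Q' w'"
    using assms(2) unfolding corresponding_def by blast
  show ?thesis
    using D(1) D'(1)
    by (intro R_intro[OF _ fraction_form_mult[OF E.morphism E.y D(2) D'(2)]
          fraction_form_mult[OF E'.morphism E'.y D(3) D'(3)]]) simp
qed

lemma R_0: assumes "R z z'" shows "z = 0 \<longleftrightarrow> z' = 0"
proof -
  obtain D P Q where D: "D \<noteq> 0" "fraction_form e y D P Q z" "fraction_form e' y' D P Q z'"
    using assms by (auto simp: corresponding_def)
  show ?thesis
  proof
    assume "z = 0"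
    hence "P = 0 \<and> Q = 0" using E.fraction_form_0 D(2) by simp
    thus "z' = 0" using D(3) E'.e_nonzero[OF D(1)]
      by (simp add: fraction_form_def ring_morphism_0[OF E'.morphism])
  next
    assume "z' = 0"
    hence "P = 0 \<and> Q = 0" using E'.fraction_form_0 D(3) by simp
    thus "z = 0" using D(2) E.e_nonzero[OF D(1)]
      by (simp add: fraction_form_def ring_morphism_0[OF E.morphism])
  qed
qed

lemma R_inverse: assumes "R z z'" shows "R (inverse z) (inverse z')"
proof (cases "z = 0")
  case True
  thus ?thesis using assms R_0[OF assms] by simp
next
  case False
  hence False': "z' \<noteq> 0" using R_0[OF assms] by simp
  obtain D P Q where D: "D \<noteq> 0" "fraction_form e y D P Q z" "fraction_form e' y' D P Q z'"
    using assms by (auto simp: corresponding_def)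
  have "P \<noteq> 0 \<or> Q \<noteq> 0"
    using D(2) False E.e_nonzero[OF D(1)]
    by (auto simp: fraction_form_def ring_morphism_0[OF E.morphism])
  thus ?thesis
    by (rule R_intro[OF E.norm_nonzero fraction_form_inverse[OF E.morphism E.y D(2) False]
      fraction_form_inverse[OF E'.morphism E'.y D(3) False']])
qed

lemma R_adjoin:
  assumes const: "\<And>c. R (\<iota> c) (\<kappa> c)" and gens: "\<And>z. z \<in> S \<Longrightarrow> \<exists>z'\<in>S'. R z z'"
    and z: "z \<in> adjoin \<iota> S"
  shows "\<exists>z'\<in>adjoin \<kappa> S'. R z z'"
  using z
proof induction
  case (const c)
  show ?case by (intro bexI[of _ "\<kappa> c"] assms adjoin.const)
next
  case (gen z)
  then obtain z' where "z' \<in> S'" "R z z'" using gens by blast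
  thus ?case by (intro bexI[of _ z'] adjoin.gen)
next
  case (add z w)
  then obtain z' w' where "z' \<in> adjoin \<kappa> S'" "R z z'" "w' \<in> adjoin \<kappa> S'" "R w w'" by blast
  thus ?case by (intro bexI[of _ "z' + w'"] R_add adjoin.add)
next
  case (minus z)
  then obtain z' where "z' \<in> adjoin \<kappa> S'" "R z z'" by blast
  thus ?case by (intro bexI[of _ "- z'"] R_minus adjoin.minus)
next
  case (mult z w)
  then obtain z' w' where "z' \<in> adjoin \<kappa> S'" "R z z'" "w' \<in> adjoin \<kappa> S'" "R w w'" by blast
  thus ?case by (intro bexI[of _ "z' * w'"] R_mult adjoin.mult)
next
  case (inverse z)
  then obtain z' where "z' \<in> adjoin \<kappa> S'" "R z z'" by blast
  thus ?case by (intro bexI[of _ "Fields.inverse z'"] R_inverse adjoin.inverse)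
qed

lemma R_unique: assumes "R z z'" "R z w'" shows "z' = w'"
  using R_0[OF R_add[OF assms(1) R_minus[OF assms(2)]]] by simp

lemma R_unique': assumes "R z z'" "R w z'" shows "z = w"
  using R_0[OF R_add[OF assms(1) R_minus[OF assms(2)]]] by simp

end

text \<open>
  Two double planes with the same branch polynomial are birational, by the map that
  identifies their coordinates.
\<close>

lemma double_plane_isomorphism:
  fixes \<iota> :: "complex \<Rightarrow> 'k::field" and \<kappa> :: "complex \<Rightarrow> 'l::field" and F :: "complex poly poly"
  assumes \<iota>: "ring_morphism \<iota>" and \<kappa>: "ring_morphism \<kappa>"
    and ind: "alg_independent \<iota> s t" and ind': "alg_independent \<kappa> s' t'"
    and odd: "odd (Polynomial.degree F)"
    and y: "y ^ 2 = eval2 \<iota> s t F" and y': "y' ^ 2 = eval2 \<kappa> s' t' F"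
  obtains \<phi> where "bij_betw \<phi> (adjoin \<iota> {s, t, y}) (adjoin \<kappa> {s', t', y'})"
    and "\<And>z w. z \<in> adjoin \<iota> {s, t, y} \<Longrightarrow> w \<in> adjoin \<iota> {s, t, y} \<Longrightarrow>
           \<phi> (z + w) = \<phi> z + \<phi> w \<and> \<phi> (z * w) = \<phi> z * \<phi> w"
    and "\<And>c. \<phi> (\<iota> c) = \<kappa> c" "\<phi> s = s'" "\<phi> t = t'" "\<phi> y = y'"
proof -
  define e where "e = eval2 \<iota> s t"
  define e' where "e' = eval2 \<kappa> s' t'"
  have e: "ring_morphism e" "ring_morphism e'"
    unfolding e_def e'_def by (intro eval1_morphism \<iota> \<kappa>)+
  interpret double_plane_pair e y F e' y'
  proof
    show "P \<noteq> 0 \<Longrightarrow> e P \<noteq> 0" "P \<noteq> 0 \<Longrightarrow> e' P \<noteq> 0" for P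
      using ind ind' by (auto simp: alg_independent_eval2 e_def e'_def)
  qed (use e odd y y' in \<open>auto simp: e_def e'_def\<close>)
  let ?K = "adjoin \<iota> {s, t, y}" and ?L = "adjoin \<kappa> {s', t', y'}"
  have e_simps: "e [:[:c:]:] = \<iota> c" "e' [:[:c:]:] = \<kappa> c" "e [:[:0, 1:]:] = s" "e' [:[:0, 1:]:] = s'"
    "e [:0, 1:] = t" "e' [:0, 1:] = t'" for c
    unfolding e_def e'_def
    by (simp_all add: eval1_pCons eval1_morphism \<iota> \<kappa> eval1_0 ring_morphism_simps[OF \<iota>] ring_morphism_simps[OF \<kappa>]
        ring_morphism_simps[OF eval1_morphism[OF \<iota>]] ring_morphism_simps[OF eval1_morphism[OF \<kappa>]])
  have Rc: "R (\<iota> c) (\<kappa> c)" for c using R_eval[of "[:[:c:]:]"] by (simp add: e_simps)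
  have Rs: "R s s'" using R_eval[of "[:[:0, 1:]:]"] by (simp add: e_simps)
  have Rt: "R t t'" using R_eval[of "[:0, 1:]"] by (simp add: e_simps)
  interpret swap: double_plane_pair e' y' F e y ..
  have ex: "\<exists>z'\<in>?L. R z z'" if "z \<in> ?K" for z
    by (rule R_adjoin[OF Rc _ that]) (use Rs Rt R_y in auto)
  have ex': "\<exists>z\<in>?K. R z z'" if "z' \<in> ?L" for z'
    unfolding corresponding_sym[of e]
    by (rule swap.R_adjoin[OF Rc[unfolded corresponding_sym[of e]] _ that])
      (use Rs Rt R_y in \<open>auto simp: corresponding_sym[of e]\<close>)
  define \<phi> where "\<phi> z = (THE z'. R z z')" for z
  have \<phi>: "\<phi> z = z'" if "R z z'" for z z'
    unfolding \<phi>_def using that R_unique by blast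
  have R\<phi>: "R z (\<phi> z)" "\<phi> z \<in> ?L" if z: "z \<in> ?K" for z
  proof -
    obtain z' where "z' \<in> ?L" "R z z'" using ex[OF z] by blast
    thus "R z (\<phi> z)" "\<phi> z \<in> ?L" using \<phi>[of z z'] by simp_all
  qed
  show ?thesis
  proof
    show "bij_betw \<phi> ?K ?L"
    proof (rule bij_betw_imageI)
      show "inj_on \<phi> ?K"
      proof (rule inj_onI)
        fix z w assume "z \<in> ?K" "w \<in> ?K" "\<phi> z = \<phi> w"
        thus "z = w" using R_unique'[OF R\<phi>(1)[of z]] R\<phi>(1)[of w] by simp
      qed
      show "\<phi> ` ?K = ?L"
      proof
        show "?L \<subseteq> \<phi> ` ?K"
        proof
          fix z' assume "z' \<in> ?L"
          then obtain z where "z \<in> ?K" "R z z'" using ex' by blast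
          thus "z' \<in> \<phi> ` ?K" using \<phi>[of z z'] by blast
        qed
      qed (use R\<phi>(2) in blast)
    qed
    show "\<phi> (z + w) = \<phi> z + \<phi> w \<and> \<phi> (z * w) = \<phi> z * \<phi> w" if "z \<in> ?K" "w \<in> ?K" for z w
      using \<phi>[OF R_add[OF R\<phi>(1)[OF that(1)] R\<phi>(1)[OF that(2)]]]
        \<phi>[OF R_mult[OF R\<phi>(1)[OF that(1)] R\<phi>(1)[OF that(2)]]] by simp
  qed (rule \<phi> Rc Rs Rt R_y)+
qed

section \<open>Fixed fields of involutions\<close>

lemma const_automorphism_morphism:
  assumes "ring_morphism \<iota>" "const_automorphism \<iota> \<sigma>" shows "ring_morphism \<sigma>"
  using assms(2) ring_morphism_1[OF assms(1)]
  unfolding const_automorphism_def ring_morphism_def by metis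

lemma const_automorphism_fixes_adjoin:
  assumes \<iota>: "ring_morphism \<iota>" and \<sigma>: "const_automorphism \<iota> \<sigma>"
    and S: "\<And>z. z \<in> S \<Longrightarrow> \<sigma> z = z" and z: "z \<in> adjoin \<iota> S"
  shows "\<sigma> z = z"
proof -
  note m = const_automorphism_morphism[OF \<iota> \<sigma>]
  show ?thesis
    using z
  proof induction
    case (const c) thus ?case using \<sigma> by (simp add: const_automorphism_def)
  qed (simp_all add: S ring_morphism_simps[OF m] ring_morphism_inverse[OF m])
qed

text \<open>
  Every element is \<open>\<alpha> + \<beta> \<theta>\<close> with coefficients in the smaller field, and
  \<open>\<sigma>\<close> changes the sign of \<open>\<beta>\<close>. For inverses the conjugate
  \<open>\<alpha> - \<beta> \<theta>\<close> is the image under \<open>\<sigma>\<close>, hence not zero.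
\<close>

lemma fixed_field_quadratic:
  fixes \<iota> :: "complex \<Rightarrow> 'k::field"
  assumes \<iota>: "ring_morphism \<iota>" and \<sigma>: "const_automorphism \<iota> \<sigma>"
    and S: "\<And>z. z \<in> S \<Longrightarrow> \<sigma> z = z" and \<theta>: "\<sigma> \<theta> = - \<theta>" "\<theta> \<noteq> 0" "\<theta> ^ 2 \<in> adjoin \<iota> S"
    and gen: "adjoin \<iota> (insert \<theta> S) = UNIV"
  shows "fixed_field \<sigma> = adjoin \<iota> S"
proof
  note fix_S = const_automorphism_fixes_adjoin[OF \<iota> \<sigma> S]
  note m = const_automorphism_morphism[OF \<iota> \<sigma>]
  show "adjoin \<iota> S \<subseteq> fixed_field \<sigma>"
    using fix_S by (auto simp: fixed_field_def)
  have form: "\<exists>\<alpha>\<in>adjoin \<iota> S. \<exists>\<beta>\<in>adjoin \<iota> S. z = \<alpha> + \<beta> * \<theta>" for z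
  proof -
    have "z \<in> adjoin \<iota> (insert \<theta> S)" by (simp add: gen)
    thus ?thesis
    proof induction
      case (const c)
      have "\<iota> c = \<iota> c + 0 * \<theta>" by simp
      thus ?case using adjoin.const adjoin_0[OF \<iota>] by blast
    next
      case (gen z)
      have "z = z + 0 * \<theta>" "\<theta> = 0 + 1 * \<theta>" by simp_all
      thus ?case using gen adjoin.gen adjoin_0[OF \<iota>] adjoin_1[OF \<iota>] by blast
    next
      case (add z w)
      then obtain \<alpha> \<beta> \<alpha>' \<beta>' where *: "\<alpha> \<in> adjoin \<iota> S" "\<beta> \<in> adjoin \<iota> S" "\<alpha>' \<in> adjoin \<iota> S" "\<beta>' \<in> adjoin \<iota> S"
        "z = \<alpha> + \<beta> * \<theta>" "w = \<alpha>' + \<beta>' * \<theta>" by blast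
      hence "z + w = (\<alpha> + \<alpha>') + (\<beta> + \<beta>') * \<theta>" by (simp add: algebra_simps)
      thus ?case using * adjoin.add by blast
    next
      case (minus z)
      then obtain \<alpha> \<beta> where *: "\<alpha> \<in> adjoin \<iota> S" "\<beta> \<in> adjoin \<iota> S" "z = \<alpha> + \<beta> * \<theta>" by blast
      hence "- z = (- \<alpha>) + (- \<beta>) * \<theta>" by (simp add: algebra_simps)
      thus ?case using * adjoin.minus by blast
    next
      case (mult z w)
      then obtain \<alpha> \<beta> \<alpha>' \<beta>' where *: "\<alpha> \<in> adjoin \<iota> S" "\<beta> \<in> adjoin \<iota> S" "\<alpha>' \<in> adjoin \<iota> S" "\<beta>' \<in> adjoin \<iota> S"
        "z = \<alpha> + \<beta> * \<theta>" "w = \<alpha>' + \<beta>' * \<theta>" by blast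
      hence "z * w = (\<alpha> * \<alpha>' + \<beta> * \<beta>' * \<theta> ^ 2) + (\<alpha> * \<beta>' + \<beta> * \<alpha>') * \<theta>"
        by (simp add: algebra_simps power2_eq_square)
      moreover have "\<alpha> * \<alpha>' + \<beta> * \<beta>' * \<theta> ^ 2 \<in> adjoin \<iota> S" "\<alpha> * \<beta>' + \<beta> * \<alpha>' \<in> adjoin \<iota> S"
        using * \<theta>(3) by (auto intro!: adjoin.add adjoin.mult)
      ultimately show ?case by blast
    next
      case (inverse z)
      then obtain \<alpha> \<beta> where *: "\<alpha> \<in> adjoin \<iota> S" "\<beta> \<in> adjoin \<iota> S" "z = \<alpha> + \<beta> * \<theta>" by blast
      show ?case
      proof (cases "z = 0")
        case True
        hence "Fields.inverse z = 0 + 0 * \<theta>" by simp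
        thus ?thesis using adjoin_0[OF \<iota>] by blast
      next
        case False
        define n where "n = \<alpha> ^ 2 - \<beta> ^ 2 * \<theta> ^ 2"
        have "\<sigma> z = \<alpha> - \<beta> * \<theta>"
          using * by (simp add: ring_morphism_simps[OF m] fix_S \<theta>(1))
        moreover have "(\<alpha> + \<beta> * \<theta>) * (\<alpha> - \<beta> * \<theta>) = n"
          by (simp add: n_def algebra_simps power2_eq_square)
        ultimately have n: "n = z * \<sigma> z" using *(3) by simp
        have "\<sigma> z \<noteq> 0" using False ring_morphism_eq_0_iff[OF m] by simp
        hence "Fields.inverse z = \<sigma> z / n"
          unfolding n using False by (simp add: inverse_eq_divide)
        also have "\<dots> = \<alpha> / n + (- \<beta> / n) * \<theta>"
          unfolding \<open>\<sigma> z = _\<close> by (simp add: diff_divide_distrib)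
        finally have "Fields.inverse z = \<alpha> / n + (- \<beta> / n) * \<theta>" .
        moreover have "n \<in> adjoin \<iota> S"
          unfolding n_def
          by (rule adjoin_diff[OF adjoin_power[OF \<iota> *(1)] adjoin.mult[OF adjoin_power[OF \<iota> *(2)] \<theta>(3)]])
        hence "\<alpha> / n \<in> adjoin \<iota> S" "- \<beta> / n \<in> adjoin \<iota> S"
          using * by (simp_all add: adjoin_divide adjoin.minus)
        ultimately show ?thesis by blast
      qed
    qed
  qed
  show "fixed_field \<sigma> \<subseteq> adjoin \<iota> S"
  proof
    fix z assume "z \<in> fixed_field \<sigma>"
    hence "\<sigma> z = z" by (simp add: fixed_field_def)
    obtain \<alpha> \<beta> where *: "\<alpha> \<in> adjoin \<iota> S" "\<beta> \<in> adjoin \<iota> S" "z = \<alpha> + \<beta> * \<theta>"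
      using form[of z] by blast
    have "\<sigma> z = \<alpha> - \<beta> * \<theta>"
      using * by (simp add: ring_morphism_simps[OF m] fix_S \<theta>(1))
    moreover have "2 * (\<beta> * \<theta>) = (\<alpha> + \<beta> * \<theta>) - (\<alpha> - \<beta> * \<theta>)" by simp
    ultimately have "2 * (\<beta> * \<theta>) = z - \<sigma> z" using *(3) by argo
    hence "2 * (\<beta> * \<theta>) = 0" using \<open>\<sigma> z = z\<close> by simp
    moreover have "(2::'k) \<noteq> 0"
      using ring_morphism_eq_0_iff[OF \<iota>, of 2] by (simp add: ring_morphism_numeral[OF \<iota>])
    ultimately have "\<beta> = 0" using \<theta>(2) by simp
    thus "z \<in> adjoin \<iota> S" using * by simp
  qed
qed

section \<open>The fibration with two fibres of type \<open>III\<^sup>*\<close>\<close>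

lemma alg_independent_eval1_nonzero:
  fixes \<iota> :: "complex \<Rightarrow> 'k::field"
  assumes "ring_morphism \<iota>" "alg_independent \<iota> s t" "p \<noteq> 0"
  shows "eval1 \<iota> s p \<noteq> 0"
  using assms alg_independent_iff by blast

lemma ring_morphism_numeral_nonzero:
  fixes \<iota> :: "complex \<Rightarrow> 'k::field"
  assumes "ring_morphism \<iota>" shows "(numeral n :: 'k) \<noteq> 0"
  using ring_morphism_eq_0_iff[OF assms, of "numeral n"] by (simp add: ring_morphism_numeral[OF assms])

text \<open>
  With \<open>D = x + t\<^sup>2 + t\<close> the equation of the surface reads
  \<open>y\<^sup>2 = x\<^sup>2 D - t (r t D - x)\<^sup>2\<close>, which suggests the parameter
  \<open>m = x / (t D)\<close>. Over the \<open>m\<close>-line it becomes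
  \<open>\<eta>\<^sup>2 = \<xi> (\<xi> + P) (\<xi> - m r (2 m - r))\<close> with
  \<open>P = m (m\<^sup>2 + (1 - 2 r) m + r\<^sup>2)\<close> and \<open>\<xi> = - m P t\<close>.
  In this fibration two configurations of type \<open>III\<^sup>*\<close> consist of the zero section,
  a two-torsion section, and fibre components over \<open>0\<close>, \<open>\<infinity>\<close>, \<open>-1\<close>
  and \<open>r / 2\<close>; for general \<open>r\<close> they are the zero and pole divisors of
  \<open>u = (\<xi> - m r (2 m - r)) / (m\<^sup>3 (2 m - r))\<close>.
\<close>

lemma X3_double_plane:
  fixes \<iota> :: "complex \<Rightarrow> 'k::field"
  assumes X3: "X3 r \<iota> t x y" and \<rho>: "\<rho> = \<iota> r"
  obtains u m W where "alg_independent \<iota> u m" "adjoin \<iota> {u, m, W} = UNIV"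
    "W ^ 2 = u * (u * m ^ 2 + \<rho>) * (2 * u * m ^ 2 + (1 - \<rho> * u) * m + 1)"
proof -
  have \<iota>: "ring_morphism \<iota>" and tx: "alg_independent \<iota> t x" and gen: "adjoin \<iota> {t, x, y} = UNIV"
    and y: "y ^ 2 = x ^ 3 + (- (t ^ 2 * (\<rho> ^ 2 * t - 1 - 2 * \<rho>))) * x ^ 2
      + (- (2 * (t + 1) * t ^ 3 * \<rho> * (\<rho> * t - 1))) * x + (- ((t + 1) ^ 2 * t ^ 5 * \<rho> ^ 2))"
    using X3 by (simp_all add: X3_def weierstrass_fibration_def Let_def ring_morphism_const_embedding \<rho>)
  note m\<iota> = ring_morphism_simps[OF \<iota>]
  note I = adjoin_intros(1-3,9)[OF \<iota>] adjoin_intros(4-8,10)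
  have \<rho>_in: "\<rho> \<in> adjoin \<iota> S" for S unfolding \<rho> by (rule adjoin.const)
  have "t \<noteq> 0"
    using alg_independent_eval1_nonzero[OF \<iota> tx, of "[:0, 1:]"] by (simp add: eval1_pCons[OF \<iota>] eval1_0 m\<iota>)
  have "t + 1 \<noteq> 0"
    using alg_independent_eval1_nonzero[OF \<iota> tx, of "[:1, 1:]"]
    by (simp add: eval1_pCons[OF \<iota>] eval1_0 m\<iota> add.commute)
  define D where "D = x + t ^ 2 + t"
  have "D \<noteq> 0"
  proof
    assume "D = 0"
    hence "x = - (t ^ 2 + t)" by (simp add: D_def add_eq_0_iff2 add.assoc)
    moreover have "- (t ^ 2 + t) \<in> adjoin \<iota> {t}" by (intro I adjoin.gen) simp_all
    ultimately show False using alg_independent_not_in_adjoin[OF \<iota> tx] by simp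
  qed
  define m where "m = x / (t * D)"
  have x: "x = m * t * D" using \<open>t \<noteq> 0\<close> \<open>D \<noteq> 0\<close> by (simp add: m_def)
  have D: "D * (1 - m * t) = t * (t + 1)"
    using x by (simp add: D_def algebra_simps power2_eq_square)
  have nz: "1 - m * t \<noteq> 0" using D \<open>t \<noteq> 0\<close> \<open>t + 1 \<noteq> 0\<close> by auto
  have D': "D = t * (t + 1) / (1 - m * t)" using D nz by (simp add: field_simps)
  have tm: "alg_independent \<iota> t m"
  proof (rule alg_independent_exchange[OF \<iota> tx, of "{}"])
    have g: "t \<in> adjoin \<iota> {t, m}" "m \<in> adjoin \<iota> {t, m}" by (simp_all add: adjoin.gen)
    have "D \<in> adjoin \<iota> {t, m}" unfolding D' by (intro I g)
    hence "x \<in> adjoin \<iota> {t, m}" by (subst x) (intro I g)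
    thus "x \<in> adjoin \<iota> ({} \<union> {t, m})" by simp
  qed simp
  note mt = alg_independent_sym[OF \<iota> tm]
  have nonzero: "p \<noteq> 0 \<Longrightarrow> eval1 \<iota> m p \<noteq> 0" for p
    by (rule alg_independent_eval1_nonzero[OF \<iota> mt])
  have "m \<noteq> 0"
    using nonzero[of "[:0, 1:]"] by (simp add: eval1_pCons[OF \<iota>] eval1_0 m\<iota>)
  define P where "P = m * (m ^ 2 + (1 - 2 * \<rho>) * m + \<rho> ^ 2)"
  have "P \<noteq> 0"
    using nonzero[of "[:0, r ^ 2, 1 - 2 * r, 1:]"]
    by (simp add: eval1_pCons[OF \<iota>] eval1_0 m\<iota> P_def \<rho> algebra_simps power2_eq_square)
  define L where "L = 2 * m - \<rho>"
  have "L \<noteq> 0"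
    using nonzero[of "[:- r, 2:]"] by (simp add: eval1_pCons[OF \<iota>] eval1_0 m\<iota> L_def \<rho> mult.commute)
  \<comment> \<open>The factor \<open>m\<close> of \<open>\<xi>\<close> has been cancelled.\<close>
  define u where "u = - (P * t + \<rho> * L) / (m ^ 2 * L)"
  have u: "P * t + \<rho> * L = - (u * m ^ 2 * L)"
    using \<open>m \<noteq> 0\<close> \<open>L \<noteq> 0\<close> by (simp add: u_def)
  have Pt: "P * t = - L * (\<rho> + u * m ^ 2)"
  proof -
    have "P * t = - (u * m ^ 2 * L) - \<rho> * L" unfolding u[symmetric] by simp
    also have "\<dots> = - L * (\<rho> + u * m ^ 2)" by (simp add: algebra_simps)
    finally show ?thesis .
  qed
  hence t: "t = - L * (\<rho> + u * m ^ 2) / P" using \<open>P \<noteq> 0\<close> by (simp add: field_simps)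
  have t_in: "t \<in> adjoin \<iota> S" if "u \<in> adjoin \<iota> S" "m \<in> adjoin \<iota> S" for S
    unfolding t P_def L_def using that \<rho>_in by (intro I)
  have mu: "alg_independent \<iota> m u"
    by (rule alg_independent_exchange[OF \<iota> mt, of "{}"], rule t_in) (simp_all add: adjoin.gen)
  note um = alg_independent_sym[OF \<iota> mu]
  have q2: "(1 - m * t) * P = m ^ 2 * (2 * u * m ^ 2 + (1 - \<rho> * u) * m + 1)"
  proof -
    have "(1 - m * t) * P = P - m * (P * t)" by (simp add: algebra_simps)
    also have "\<dots> = m ^ 2 * (2 * u * m ^ 2 + (1 - \<rho> * u) * m + 1)"
      unfolding Pt unfolding P_def L_def by Groebner_Basis.algebra
    finally show ?thesis .
  qed
  have y': "y ^ 2 * (1 - m * t) = t ^ 3 * D ^ 2 * (P * t + \<rho> * L)"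
  proof -
    have "y ^ 2 = x ^ 2 * D - t * (\<rho> * t * D - x) ^ 2"
      unfolding y D_def by Groebner_Basis.algebra
    also have "\<dots> = t ^ 2 * D ^ 2 * (m ^ 2 * D - t * (\<rho> - m) ^ 2)"
      unfolding x by Groebner_Basis.algebra
    finally have "y ^ 2 * (1 - m * t) =
        t ^ 2 * D ^ 2 * (m ^ 2 * (D * (1 - m * t)) - t * (\<rho> - m) ^ 2 * (1 - m * t))"
      by Groebner_Basis.algebra
    also have "\<dots> = t ^ 3 * D ^ 2 * (P * t + \<rho> * L)"
      unfolding D P_def L_def by Groebner_Basis.algebra
    finally show ?thesis .
  qed
  define E where "E = t * D * m ^ 2 * L"
  have "E \<noteq> 0" using \<open>t \<noteq> 0\<close> \<open>D \<noteq> 0\<close> \<open>m \<noteq> 0\<close> \<open>L \<noteq> 0\<close> by (simp add: E_def)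
  define W where "W = y * ((1 - m * t) * P) / E"
  have "W ^ 2 = u * (u * m ^ 2 + \<rho>) * (2 * u * m ^ 2 + (1 - \<rho> * u) * m + 1)"
  proof -
    have "(W * E) ^ 2 = (y ^ 2 * (1 - m * t)) * ((1 - m * t) * P) * P"
      using \<open>E \<noteq> 0\<close> by (simp add: W_def) Groebner_Basis.algebra
    also have "\<dots> = t ^ 2 * D ^ 2 * (P * t + \<rho> * L) * ((1 - m * t) * P) * (P * t)"
      unfolding y' by Groebner_Basis.algebra
    also have "\<dots> = E ^ 2 * (u * (u * m ^ 2 + \<rho>) * (2 * u * m ^ 2 + (1 - \<rho> * u) * m + 1))"
      unfolding u q2 unfolding Pt E_def by Groebner_Basis.algebra
    finally show ?thesis using \<open>E \<noteq> 0\<close> by (simp add: power_mult_distrib)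
  qed
  moreover have "adjoin \<iota> {u, m, W} = UNIV"
  proof -
    let ?A = "adjoin \<iota> {u, m, W}"
    have g: "u \<in> ?A" "m \<in> ?A" "W \<in> ?A" by (simp_all add: adjoin.gen)
    have "t \<in> ?A" using g by (intro t_in)
    have "D \<in> ?A" unfolding D' using g \<open>t \<in> ?A\<close> by (intro I)
    have "x \<in> ?A" by (subst x) (intro I g \<open>t \<in> ?A\<close> \<open>D \<in> ?A\<close>)
    have "y = W * E / ((1 - m * t) * P)"
      using \<open>E \<noteq> 0\<close> nz \<open>P \<noteq> 0\<close> by (simp add: W_def)
    also have "\<dots> \<in> ?A"
      unfolding E_def P_def L_def by (intro I g \<open>t \<in> ?A\<close> \<open>D \<in> ?A\<close> \<rho>_in)
    finally have "adjoin \<iota> {t, x, y} \<subseteq> ?A"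
      using \<open>t \<in> ?A\<close> \<open>x \<in> ?A\<close> by (intro adjoin_subset) auto
    thus ?thesis using gen by auto
  qed
  ultimately show ?thesis using that um by blast
qed

text \<open>
  The quartic in \<open>m\<close> has the value \<open>((r u + 1) / 2)\<^sup>2\<close> at
  \<open>m = (r u - 1) / (2 u)\<close>. Moving this rational point to infinity makes the leading
  coefficient of the quartic a square, and the standard transformation yields a Weierstrass
  equation; its two-torsion point comes from the factorisation of the quartic.
\<close>

lemma III_star_fibration_of_double_plane:
  fixes \<iota> :: "complex \<Rightarrow> 'k::field"
  assumes \<iota>: "ring_morphism \<iota>" and r: "r \<noteq> 0" and \<rho>: "\<rho> = \<iota> r"
    and um: "alg_independent \<iota> u m" and gen: "adjoin \<iota> {u, m, W} = UNIV"
    and W: "W ^ 2 = u * (u * m ^ 2 + \<rho>) * (2 * u * m ^ 2 + (1 - \<rho> * u) * m + 1)"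
  obtains t x y where "III_star_fibration r \<iota> t x y"
proof -
  note m\<iota> = ring_morphism_simps[OF \<iota>]
  note I = adjoin_intros(1-3,9)[OF \<iota>] adjoin_intros(4-8,10)
  note num = ring_morphism_numeral_nonzero[OF \<iota>]
  have \<rho>_in: "\<rho> \<in> adjoin \<iota> S" for S unfolding \<rho> by (rule adjoin.const)
  have nonzero: "p \<noteq> 0 \<Longrightarrow> eval1 \<iota> u p \<noteq> 0" for p
    by (rule alg_independent_eval1_nonzero[OF \<iota> um])
  have m_notin: "m \<notin> adjoin \<iota> {u}"
    by (rule alg_independent_not_in_adjoin[OF \<iota> um])
  have "u \<noteq> 0"
    using nonzero[of "[:0, 1:]"] by (simp add: eval1_pCons[OF \<iota>] eval1_0 m\<iota>)
  have "\<rho> * u + 1 \<noteq> 0"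
    using nonzero[of "[:1, r:]"]
    by (simp add: eval1_pCons[OF \<iota>] eval1_0 m\<iota> \<rho> mult.commute add.commute)
  have "\<rho> * u - 1 \<noteq> 0"
    using nonzero[of "[:- 1, r:]"]
    by (simp add: eval1_pCons[OF \<iota>] eval1_0 m\<iota> \<rho> mult.commute)
  \<comment> \<open>The rational point \<open>(m0, q)\<close>.\<close>
  define q where "q = (\<rho> * u + 1) / 2"
  have "q \<noteq> 0" using \<open>\<rho> * u + 1 \<noteq> 0\<close> num by (simp add: q_def)
  have "2 * q = \<rho> * u + 1" using num by (simp add: q_def)
  hence \<rho>u: "\<rho> * u = 2 * q - 1" by simp
  have "2 * q - 2 \<noteq> 0" using \<open>\<rho> * u - 1 \<noteq> 0\<close> \<rho>u by simp
  define m0 where "m0 = (\<rho> * u - 1) / (2 * u)"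
  have m0_in: "m0 \<in> adjoin \<iota> S" if "u \<in> adjoin \<iota> S" for S
    unfolding m0_def by (intro I that \<rho>_in)
  have q_in: "q \<in> adjoin \<iota> S" if "u \<in> adjoin \<iota> S" for S
    unfolding q_def by (intro I that \<rho>_in)
  have um0: "u * m0 = q - 1"
  proof -
    have "u * m0 = (2 * (q - 1)) / 2" using \<open>u \<noteq> 0\<close> by (simp add: m0_def \<rho>u)
    thus ?thesis unfolding nonzero_mult_div_cancel_left[OF num] .
  qed
  have u_in: "u \<in> adjoin \<iota> {u}" by (simp add: adjoin.gen)
  have "m \<noteq> m0" using m_notin m0_in[OF u_in] by auto
  define n where "n = 1 / (m - m0)"
  have "n \<noteq> 0" using \<open>m \<noteq> m0\<close> by (simp add: n_def)
  have m: "m = m0 + 1 / n" by (simp add: n_def)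
  have mn: "m * n = m0 * n + 1" using \<open>n \<noteq> 0\<close> by (simp add: m algebra_simps)
  have n_notin: "n \<notin> adjoin \<iota> {u}"
  proof
    assume "n \<in> adjoin \<iota> {u}"
    hence "m \<in> adjoin \<iota> {u}" unfolding m by (intro I m0_in u_in)
    thus False using m_notin by simp
  qed
  define V where "V = n ^ 2 * W"
  have V: "V ^ 2 = (q ^ 2 * n ^ 2 + (2 * q - 2) * u * n + u ^ 2) * (n ^ 2 + (2 * q - 2) * n + 2 * u)"
  proof -
    have umn: "u * m * n = (q - 1) * n + u"
      using mn um0 by Groebner_Basis.algebra
    have "V ^ 2 = u * (u * m ^ 2 + \<rho>) * (2 * u * m ^ 2 + (1 - \<rho> * u) * m + 1) * n ^ 4"
      unfolding V_def by (simp add: power_mult_distrib W)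
    also have "\<dots> = ((u * m * n) ^ 2 + (\<rho> * u) * n ^ 2) * (2 * u * m ^ 2 + (1 - \<rho> * u) * m + 1) * n ^ 2"
      by Groebner_Basis.algebra
    also have "\<dots> = (q ^ 2 * n ^ 2 + (2 * q - 2) * u * n + u ^ 2) * ((2 * u * m ^ 2 + (1 - \<rho> * u) * m + 1) * n ^ 2)"
      unfolding umn \<rho>u by Groebner_Basis.algebra
    also have "(2 * u * m ^ 2 + (1 - \<rho> * u) * m + 1) * n ^ 2 = n ^ 2 + (2 * q - 2) * n + 2 * u"
      using umn mn um0 \<rho>u by Groebner_Basis.algebra
    finally show ?thesis .
  qed
  define \<beta> where "\<beta> = q ^ 2 * (2 * q - 2) + (2 * q - 2) * u"
  define \<gamma> where "\<gamma> = 2 * u * q ^ 2 + (2 * q - 2) ^ 2 * u + u ^ 2"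
  define \<delta> where "\<delta> = 3 * (2 * q - 2) * u ^ 2"
  define \<epsilon> where "\<epsilon> = 2 * u ^ 3"
  define k where "k = \<beta> / (2 * q)"
  have k: "2 * q * k = \<beta>" using \<open>q \<noteq> 0\<close> num by (simp add: k_def)
  have V': "V ^ 2 = q ^ 2 * n ^ 4 + \<beta> * n ^ 3 + \<gamma> * n ^ 2 + \<delta> * n + \<epsilon>"
    unfolding V \<beta>_def \<gamma>_def \<delta>_def \<epsilon>_def by Groebner_Basis.algebra
  \<comment> \<open>As the leading terms of \<open>V\<close> and \<open>q n\<^sup>2 + k n\<close> agree, eliminating
    \<open>V\<close> leaves an equation for \<open>n\<close> that is only quadratic; its discriminant is
    cubic in \<open>z\<close>.\<close>
  define z where "z = V - q * n ^ 2 - k * n"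
  define G where "G = 2 * q * z + k ^ 2 - \<gamma>"
  define H where "H = 2 * k * z - \<delta>"
  have GH: "G * n ^ 2 + H * n + (z ^ 2 - \<epsilon>) = 0"
  proof -
    have "V = z + q * n ^ 2 + k * n" by (simp add: z_def)
    thus ?thesis
      using V' k unfolding G_def H_def by Groebner_Basis.algebra
  qed
  have k_in: "\<beta> \<in> adjoin \<iota> S" "\<gamma> \<in> adjoin \<iota> S" "\<delta> \<in> adjoin \<iota> S" "\<epsilon> \<in> adjoin \<iota> S" "k \<in> adjoin \<iota> S"
    if "u \<in> adjoin \<iota> S" for S
    unfolding k_def \<beta>_def \<gamma>_def \<delta>_def \<epsilon>_def by (intro I that q_in)+
  \<comment> \<open>Otherwise \<open>z\<close> would be a rational function of \<open>u\<close>, and so would be \<open>n\<close>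
    unless the linear coefficient \<open>H\<close> vanishes too; then all three coefficients of the quadratic
    vanish, which gives a non-trivial equation for \<open>u\<close>.\<close>
  have "G \<noteq> 0"
  proof
    assume "G = 0"
    hence z: "z = (\<gamma> - k ^ 2) / (2 * q)"
      using \<open>q \<noteq> 0\<close> num by (simp add: G_def field_simps)
    have z_in: "z \<in> adjoin \<iota> {u}" unfolding z by (intro I k_in q_in u_in)
    have Hn: "H * n = \<epsilon> - z ^ 2" using GH \<open>G = 0\<close> by Groebner_Basis.algebra
    have "H = 0"
    proof (rule ccontr)
      assume "H \<noteq> 0"
      hence "n = (\<epsilon> - z ^ 2) / H" using Hn by (simp add: field_simps)
      also have "\<dots> \<in> adjoin \<iota> {u}" unfolding H_def by (intro I k_in z_in u_in)
      finally show False using n_notin by simp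
    qed
    hence e: "z ^ 2 = \<epsilon>" and d: "2 * k * z = \<delta>" using Hn by (simp_all add: H_def)
    have "\<beta> ^ 2 * \<epsilon> = q ^ 2 * \<delta> ^ 2"
      unfolding k[symmetric] e[symmetric] d[symmetric] by Groebner_Basis.algebra
    hence "(2 * q - 2) ^ 2 * u ^ 3 * (2 * (q ^ 2 + u) ^ 2 - 9 * q ^ 2 * u) = 0"
      unfolding \<beta>_def \<delta>_def \<epsilon>_def by Groebner_Basis.algebra
    hence "2 * (q ^ 2 + u) ^ 2 - 9 * q ^ 2 * u = 0"
      using \<open>2 * q - 2 \<noteq> 0\<close> \<open>u \<noteq> 0\<close> by simp
    hence "((1 + u * \<rho>) ^ 2 + 4 * u) ^ 2 - 18 * (1 + u * \<rho>) ^ 2 * u = 0"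
      using \<rho>u by Groebner_Basis.algebra
    moreover
    define p1 where "p1 = [:1, r:]"
    define p2 :: "complex poly" where "p2 = [:0, 1:]"
    define p where "p = (p1 ^ 2 + 4 * p2) ^ 2 - 18 * p1 ^ 2 * p2"
    have "eval1 \<iota> u p = ((1 + u * \<rho>) ^ 2 + 4 * u) ^ 2 - 18 * (1 + u * \<rho>) ^ 2 * u"
      unfolding p_def by (simp only: ring_morphism_simps[OF eval1_morphism[OF \<iota>]])
        (simp add: p1_def p2_def eval1_pCons[OF \<iota>] eval1_0 m\<iota> \<rho>)
    moreover have "poly p 0 = 1" by (simp add: p_def p1_def p2_def)
    hence "p \<noteq> 0" by auto
    ultimately show False using nonzero[of p] by simp
  qed
  \<comment> \<open>The shift by \<open>u (2 q\<^sup>2 + u)\<close> moves the two-torsion point to the origin.\<close>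
  define Xh where "Xh = u * (2 * q ^ 2 + u) - 2 * q * z"
  define Yh where "Yh = q * (2 * G * n + H)"
  have Z: "2 * q * z = u * (2 * q ^ 2 + u) - Xh" by (simp add: Xh_def)
  have Yh: "Yh ^ 2 = Xh ^ 3 + (- (2 * u ^ 2) * (1 + 2 * \<rho>)) * Xh ^ 2
      + u ^ 3 * (\<rho> + (1 - 4 * \<rho> + 2 * \<rho> ^ 2) * u + \<rho> ^ 3 * u ^ 2) * Xh"
  proof -
    have "Yh ^ 2 = (q * H) ^ 2 - G * ((2 * q * z) ^ 2 - 4 * q ^ 2 * \<epsilon>)"
      using GH unfolding Yh_def by Groebner_Basis.algebra
    also have "\<dots> = - ((2 * q * z) ^ 3) + \<gamma> * (2 * q * z) ^ 2 + (4 * q ^ 2 * \<epsilon> - \<beta> * \<delta>) * (2 * q * z)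
        + q ^ 2 * \<delta> ^ 2 + \<epsilon> * \<beta> ^ 2 - 4 * q ^ 2 * \<epsilon> * \<gamma>"
      unfolding k[symmetric] G_def H_def by Groebner_Basis.algebra
    also have "\<dots> = Xh ^ 3 + (- (2 * u ^ 2) - 4 * u * (2 * q - 1)) * Xh ^ 2
        + (u ^ 2 * (2 * q - 1) + u ^ 4 - 4 * u ^ 3 * (2 * q - 1) + 2 * u ^ 2 * (2 * q - 1) ^ 2
          + u ^ 2 * (2 * q - 1) ^ 3) * Xh"
      unfolding Z \<beta>_def \<gamma>_def \<delta>_def \<epsilon>_def by Groebner_Basis.algebra
    also have "\<dots> = Xh ^ 3 + (- (2 * u ^ 2) * (1 + 2 * \<rho>)) * Xh ^ 2
      + u ^ 3 * (\<rho> + (1 - 4 * \<rho> + 2 * \<rho> ^ 2) * u + \<rho> ^ 3 * u ^ 2) * Xh"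
      unfolding \<rho>u[symmetric] by Groebner_Basis.algebra
    finally show ?thesis .
  qed
  \<comment> \<open>This scaling turns the coefficients into those of the fibration in question.\<close>
  define t x y where "t = 8 * u" and "x = 256 * Xh" and "y = 4096 * Yh"
  let ?A = "adjoin \<iota> {t, x, y}"
  have gen': "m \<in> ?A" "W \<in> ?A" "u \<in> ?A"
  proof -
    have g: "t \<in> ?A" "x \<in> ?A" "y \<in> ?A" by (simp_all add: adjoin.gen)
    have e: "u = t / 8" "Xh = x / 256" "Yh = y / 4096" using num by (simp_all add: t_def x_def y_def)
    have uXY: "u \<in> ?A" "Xh \<in> ?A" "Yh \<in> ?A"
      by (subst e(1), intro I g, subst e(2), intro I g, subst e(3), intro I g)
    have "z = (u * (2 * q ^ 2 + u) - Xh) / (2 * q)"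
      using \<open>q \<noteq> 0\<close> num by (simp add: Xh_def)
    also have "\<dots> \<in> ?A" by (intro I q_in uXY)
    finally have z_in: "z \<in> ?A" .
    have "n = (Yh / q - H) / (2 * G)"
      using \<open>q \<noteq> 0\<close> \<open>G \<noteq> 0\<close> num by (simp add: Yh_def)
    also have "\<dots> \<in> ?A" unfolding G_def H_def by (intro I q_in k_in z_in uXY)
    finally have n_in: "n \<in> ?A" .
    show "m \<in> ?A" unfolding m by (intro I m0_in uXY n_in)
    have "W = (z + q * n ^ 2 + k * n) / n ^ 2"
      using \<open>n \<noteq> 0\<close> by (simp add: z_def V_def)
    also have "\<dots> \<in> ?A" by (intro I z_in q_in k_in uXY n_in)
    finally show "W \<in> ?A" .
    show "u \<in> ?A" by (rule uXY)
  qed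
  define A4 where "A4 = 2 * t ^ 3 * (64 * \<rho> + 8 * t - 32 * \<rho> * t + 16 * \<rho> ^ 2 * t + t ^ 2 * \<rho> ^ 3)"
  define A2 where "A2 = - (8 * t ^ 2 * (1 + 2 * \<rho>))"
  have eq: "y ^ 2 = x ^ 3 + A2 * x ^ 2 + A4 * x + 0"
  proof -
    have "y ^ 2 = 16777216 * Yh ^ 2" unfolding y_def by (simp add: power_mult_distrib)
    also have "\<dots> = x ^ 3 + A2 * x ^ 2 + A4 * x + 0"
      unfolding Yh x_def A2_def A4_def t_def by Groebner_Basis.algebra
    finally show ?thesis .
  qed
  have A_in: "A2 \<in> adjoin \<iota> S" "A4 \<in> adjoin \<iota> S" if "t \<in> adjoin \<iota> S" for S
    unfolding A2_def A4_def by (intro I that \<rho>_in)+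
  have ut: "alg_independent \<iota> t m"
  proof -
    have u: "u = t / 8" using num by (simp add: t_def)
    have g: "m \<in> adjoin \<iota> {m, t}" "t \<in> adjoin \<iota> {m, t}" by (simp_all add: adjoin.gen)
    have "u \<in> adjoin \<iota> {m, t}" unfolding u by (intro I g)
    hence "alg_independent \<iota> m t"
      by (intro alg_independent_exchange[OF \<iota> alg_independent_sym[OF \<iota> um], of "{}"]) simp_all
    thus ?thesis by (rule alg_independent_sym[OF \<iota>])
  qed
  have tx: "alg_independent \<iota> t x"
  proof (rule alg_independent_exchange[OF \<iota> ut, of "{y}"])
    show "m \<in> adjoin \<iota> ({y} \<union> {t, x})" using gen'(1) by (simp add: insert_commute)
    fix y' assume "y' \<in> {y}"
    hence "y' ^ 2 = x ^ 3 + A2 * x ^ 2 + A4 * x + 0" using eq by simp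
    moreover have g: "t \<in> adjoin \<iota> {t, x}" "x \<in> adjoin \<iota> {t, x}" by (simp_all add: adjoin.gen)
    have "x ^ 3 + A2 * x ^ 2 + A4 * x + 0 \<in> adjoin \<iota> {t, x}" by (intro I A_in g)
    ultimately show "y' ^ 2 \<in> adjoin \<iota> {t, x}" by simp
  qed
  have nonzero': "p \<noteq> 0 \<Longrightarrow> eval1 \<iota> t p \<noteq> 0" for p
    by (rule alg_independent_eval1_nonzero[OF \<iota> tx])
  have "t \<noteq> 0" using \<open>u \<noteq> 0\<close> num by (simp add: t_def)
  have disc: "A2 ^ 2 * A4 ^ 2 - 4 * A4 ^ 3 - 4 * A2 ^ 3 * 0 - 27 * 0 ^ 2 + 18 * A2 * A4 * 0 \<noteq> 0"
  proof -
    have "64 * \<rho> + t * ((8 - 32 * \<rho> + 16 * \<rho> ^ 2) + t * \<rho> ^ 3) \<noteq> 0"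
      using nonzero'[of "[:64 * r, 8 - 32 * r + 16 * r ^ 2, r ^ 3:]"] r
      by (simp add: eval1_pCons[OF \<iota>] eval1_0 m\<iota> \<rho>)
    moreover have "A4 = 2 * t ^ 3 * (64 * \<rho> + t * ((8 - 32 * \<rho> + 16 * \<rho> ^ 2) + t * \<rho> ^ 3))"
      unfolding A4_def by Groebner_Basis.algebra
    ultimately have "A4 \<noteq> 0" using \<open>t \<noteq> 0\<close> num by simp
    have "- 512 * \<rho> + t * ((512 * \<rho> + 128 * \<rho> ^ 2) + t * (- 8 * \<rho> ^ 3)) \<noteq> 0"
      using nonzero'[of "[:- 512 * r, 512 * r + 128 * r ^ 2, - 8 * r ^ 3:]"] r
      by (simp add: eval1_pCons[OF \<iota>] eval1_0 m\<iota> \<rho>)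
    moreover have "A2 ^ 2 - 4 * A4 = t ^ 3 * (- 512 * \<rho> + t * ((512 * \<rho> + 128 * \<rho> ^ 2) + t * (- 8 * \<rho> ^ 3)))"
      unfolding A4_def A2_def by Groebner_Basis.algebra
    ultimately have "A2 ^ 2 - 4 * A4 \<noteq> 0" using \<open>t \<noteq> 0\<close> by simp
    hence "A4 ^ 2 * (A2 ^ 2 - 4 * A4) \<noteq> 0" using \<open>A4 \<noteq> 0\<close> by simp
    thus ?thesis by (simp add: algebra_simps eval_nat_numeral)
  qed
  have "adjoin \<iota> {u, m, W} \<subseteq> ?A" using gen' by (intro adjoin_subset) auto
  hence "?A = UNIV" using gen by auto
  moreover have "t \<in> adjoin \<iota> {t}" by (simp add: adjoin.gen)
  ultimately have "weierstrass_fibration \<iota> t x y A2 A4 0"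
    using tx eq disc A_in adjoin_0[OF \<iota>] \<iota>
    by (simp add: weierstrass_fibration_def ring_morphism_const_embedding)
  hence "III_star_fibration r \<iota> t x y"
    by (simp add: III_star_fibration_def Let_def A2_def A4_def \<rho>)
  thus ?thesis using that by blast
qed

section \<open>Orders along curves\<close>

lemma discrete_valuation_arith:
  fixes \<iota> :: "complex \<Rightarrow> 'k::field"
  assumes \<iota>: "ring_morphism \<iota>" and v: "discrete_valuation \<iota> v"
  shows "z \<noteq> 0 \<Longrightarrow> w \<noteq> 0 \<Longrightarrow> v (z * w) = v z + v w"
    and "z \<noteq> 0 \<Longrightarrow> w \<noteq> 0 \<Longrightarrow> v (z / w) = v z - v w"
    and "z \<noteq> 0 \<Longrightarrow> v (z ^ n) = int n * v z"
    and "z \<noteq> 0 \<Longrightarrow> v (- z) = v z"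
    and "v 1 = 0"
proof -
  have mult: "v (z * w) = v z + v w" if "z \<noteq> 0" "w \<noteq> 0" for z w
    using v that by (simp add: discrete_valuation_def)
  have const: "v (\<iota> c) = 0" if "c \<noteq> 0" for c
    using v that by (simp add: discrete_valuation_def)
  have one: "v 1 = 0" using const[of 1] by (simp add: ring_morphism_1[OF \<iota>])
  show "z \<noteq> 0 \<Longrightarrow> w \<noteq> 0 \<Longrightarrow> v (z * w) = v z + v w" by (rule mult)
  show "v (z / w) = v z - v w" if "z \<noteq> 0" "w \<noteq> 0"
    using mult[of "z / w" w] that by simp
  show "v (z ^ n) = int n * v z" if "z \<noteq> 0"
    by (induction n) (use that in \<open>simp_all add: one mult algebra_simps\<close>)
  show "v (- z) = v z" if "z \<noteq> 0"
    using mult[of "- 1" z] const[of "- 1"] that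
    by (simp add: ring_morphism_uminus[OF \<iota>] ring_morphism_1[OF \<iota>])
  show "v 1 = 0" by (rule one)
qed

lemma discrete_valuation_add_less:
  fixes \<iota> :: "complex \<Rightarrow> 'k::field"
  assumes \<iota>: "ring_morphism \<iota>" and v: "discrete_valuation \<iota> v"
    and "z \<noteq> 0" "w \<noteq> 0" "v z < v w"
  shows "v (z + w) = v z"
proof -
  note arith = discrete_valuation_arith[OF \<iota> v]
  have ultra: "min (v z) (v w) \<le> v (z + w)" if "z \<noteq> 0" "w \<noteq> 0" "z + w \<noteq> 0" for z w
    using v that by (simp add: discrete_valuation_def)
  have "z + w \<noteq> 0"
  proof
    assume "z + w = 0"
    hence "z = - w" by (simp add: eq_neg_iff_add_eq_0)
    thus False using arith(4)[of w] assms by simp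
  qed
  have "min (v (z + w)) (v (- w)) \<le> v z"
    using ultra[of "z + w" "- w"] \<open>z + w \<noteq> 0\<close> assms by simp
  thus ?thesis
    using ultra[of z w] arith(4)[of w] \<open>z + w \<noteq> 0\<close> assms by simp
qed

lemma discrete_valuation_translate:
  fixes \<iota> :: "complex \<Rightarrow> 'k::field"
  assumes \<iota>: "ring_morphism \<iota>" and v: "discrete_valuation \<iota> v" and "t \<noteq> 0" "c \<noteq> 0"
  shows "v t < 0 \<Longrightarrow> v (t - \<iota> c) = v t" and "v t > 0 \<Longrightarrow> v (t - \<iota> c) = 0"
proof -
  note arith = discrete_valuation_arith[OF \<iota> v]
  have nz: "\<iota> c \<noteq> 0" using \<open>c \<noteq> 0\<close> by (simp add: ring_morphism_eq_0_iff[OF \<iota>])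
  have c: "v (\<iota> c) = 0" "v (- \<iota> c) = 0"
    using v \<open>c \<noteq> 0\<close> arith(4)[OF nz] by (simp_all add: discrete_valuation_def)
  show "v (t - \<iota> c) = v t" if "v t < 0"
    using discrete_valuation_add_less[OF \<iota> v, of t "- \<iota> c"] that c nz \<open>t \<noteq> 0\<close> by simp
  show "v (t - \<iota> c) = 0" if "v t > 0"
    using discrete_valuation_add_less[OF \<iota> v, of "- \<iota> c" t] that c nz \<open>t \<noteq> 0\<close> by simp
qed

text \<open>
  The order of this function is \<open>v x - 2 v t - v (t - c)\<close>, so it is determined by the
  orders that define each of the nine curves.
\<close>

lemma I4_star_parameter_orders:
  fixes \<iota> :: "complex \<Rightarrow> 'k::field"
  assumes \<iota>: "ring_morphism \<iota>" and nz: "t \<noteq> 0" "x \<noteq> 0" "t - \<iota> c \<noteq> 0" and c: "c \<noteq> 0" and g: "g \<noteq> 0"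
    and D: "(v, n) \<in> I4_star_divisor \<iota> t x y c"
  shows "v (\<iota> g * (x / (t ^ 2 * (t - \<iota> c)))) = - int n"
proof -
  have v: "discrete_valuation \<iota> v"
    using D by (auto simp: I4_star_divisor_def zero_section_def identity_component_def curve_orders_def)
  note arith = discrete_valuation_arith[OF \<iota> v] and translate = discrete_valuation_translate[OF \<iota> v nz(1) c]
  have "\<iota> g \<noteq> 0" "v (\<iota> g) = 0"
    using g v by (simp_all add: ring_morphism_eq_0_iff[OF \<iota>] discrete_valuation_def)
  hence u: "v (\<iota> g * (x / (t ^ 2 * (t - \<iota> c)))) = v x - 2 * v t - v (t - \<iota> c)"
    using nz by (simp add: arith)
  consider
      (zero) "zero_section \<iota> t x y v" "n = 2"
    | (two) k where "k \<in> {Near1, Near2, Near3, Mid4}" "III_star_component \<iota> t x y k v" "n = 2"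
    | (one) k where "k \<in> {Branch2, Far3}" "III_star_component \<iota> t x y k v" "n = 1"
    | (infinity) "identity_component \<iota> (1 / t) (x / t ^ 4) (y / t ^ 6) v" "n = 1"
    | (I2) "identity_component \<iota> (t - \<iota> c) x y v" "n = 1"
    using D unfolding I4_star_divisor_def by blast
  thus ?thesis
  proof cases
    case zero
    hence "v t = 0" "v x = - 2" "v (t - \<iota> c) = 0"
      by (auto simp: zero_section_def curve_orders_def nonconstant_along_def)
    thus ?thesis using u zero by simp
  next
    case two
    hence "v x - 2 * v t = - 2" "v t > 0" by (auto simp: curve_orders_def)
    thus ?thesis using u translate(2) two by simp
  next
    case one
    hence "v x - 2 * v t = - 1" "v t > 0" by (auto simp: curve_orders_def)
    thus ?thesis using u translate(2) one by simp
  next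
    case infinity
    hence "v (1 / t) = 1" "v (x / t ^ 4) = 0"
      by (auto simp: identity_component_def curve_orders_def)
    hence "v t = - 1" "v x = - 4" using nz arith(5) by (simp_all add: arith)
    thus ?thesis using u translate(1) infinity by simp
  next
    case I2
    hence T: "v (t - \<iota> c) = 1" "v x = 0"
      by (auto simp: identity_component_def curve_orders_def)
    have "v (\<iota> c) = 0" using v c by (simp add: discrete_valuation_def)
    moreover have "\<iota> c \<noteq> 0" using c by (simp add: ring_morphism_eq_0_iff[OF \<iota>])
    ultimately have "v t = 0"
      using discrete_valuation_add_less[OF \<iota> v, of "\<iota> c" "t - \<iota> c"] nz T by simp
    thus ?thesis using u T I2 by simp
  qed
qed

text \<open>
  Substituting \<open>x = w t\<^sup>2 (t - c)\<close> and dividing by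
  \<open>t\<^sup>4 (t - c)\<^sup>2\<close> leaves a cubic in \<open>t\<close> with root \<open>0\<close>, because
  \<open>t - c\<close> divides the quadratic factor of the coefficient of \<open>x\<close>. The constants
  \<open>g\<close> and \<open>k\<close> scale the base and the fibres; the numbers \<open>n0\<close>,
  \<open>n1\<close>, \<open>n2\<close>, \<open>n4\<close> are the coefficients after scaling.
\<close>

lemma I4_star_fibration:
  fixes \<iota> :: "complex \<Rightarrow> 'k::field"
  assumes III: "III_star_fibration r \<iota> t x y" and r: "r \<noteq> 0" and c: "I2_fibre r c"
    and g: "g \<noteq> 0" and k: "k \<noteq> 0"
    and n0: "g * n0 = 2 * k ^ 2 * r ^ 3" and n1: "g ^ 2 * n1 = - 8 * k ^ 2 * (1 + 2 * r)"
    and n2: "g ^ 3 * n2 = - c * k ^ 2" and n4: "c * g ^ 4 * n4 = - 128 * r * k ^ 4"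
  obtains u x' y' where "induced_fibration \<iota> (I4_star_divisor \<iota> t x y c) u x' y'
      (eval1 \<iota> u [:0, n0, n1, n2:]) (eval1 \<iota> u [:0, 0, 0, 0, n4:]) 0"
proof -
  define \<rho> \<gamma> where "\<rho> = \<iota> r" and "\<gamma> = \<iota> c"
  have \<iota>: "ring_morphism \<iota>" and tx: "alg_independent \<iota> t x" and gen: "adjoin \<iota> {t, x, y} = UNIV"
    and y: "y ^ 2 = x ^ 3 + (- (8 * t ^ 2 * (1 + 2 * \<rho>))) * x ^ 2
      + (2 * t ^ 3 * (64 * \<rho> + 8 * t - 32 * \<rho> * t + 16 * \<rho> ^ 2 * t + t ^ 2 * \<rho> ^ 3)) * x"
    using III by (simp_all add: III_star_fibration_def weierstrass_fibration_def Let_def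
        ring_morphism_const_embedding \<rho>_def)
  note m\<iota> = ring_morphism_simps[OF \<iota>]
  note I = adjoin_intros(1-3,9)[OF \<iota>] adjoin_intros(4-8,10)
  note num = ring_morphism_numeral_nonzero[OF \<iota>]
  have "c \<noteq> 0" using c r by (auto simp: I2_fibre_def)
  have t_nz: "t \<noteq> 0" "t - \<gamma> \<noteq> 0"
    using alg_independent_eval1_nonzero[OF \<iota> tx, of "[:0, 1:]"]
      alg_independent_eval1_nonzero[OF \<iota> tx, of "[:- c, 1:]"]
    by (simp_all add: eval1_pCons[OF \<iota>] eval1_0 m\<iota> \<gamma>_def)
  have "x \<noteq> 0" using alg_independent_not_in_adjoin[OF \<iota> tx] adjoin_0[OF \<iota>] by metis
  define T where "T = t - \<gamma>"
  have "T \<noteq> 0" using t_nz by (simp add: T_def)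
  have \<gamma>: "64 * \<rho> + 8 * \<gamma> - 32 * \<rho> * \<gamma> + 16 * \<rho> ^ 2 * \<gamma> + \<gamma> ^ 2 * \<rho> ^ 3 = 0"
  proof -
    have "\<iota> (64 * r + 8 * c - 32 * r * c + 16 * r ^ 2 * c + c ^ 2 * r ^ 3) = \<iota> 0"
      using c by (simp add: I2_fibre_def)
    thus ?thesis by (simp add: m\<iota> \<rho>_def \<gamma>_def)
  qed
  have \<gamma>_nz: "\<gamma> \<noteq> 0" using \<open>c \<noteq> 0\<close> by (simp add: \<gamma>_def ring_morphism_eq_0_iff[OF \<iota>])
  have factor: "\<gamma> * (64 * \<rho> + 8 * t - 32 * \<rho> * t + 16 * \<rho> ^ 2 * t + t ^ 2 * \<rho> ^ 3) = T * (\<rho> ^ 3 * \<gamma> * t - 64 * \<rho>)"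
    using \<gamma> unfolding T_def by Groebner_Basis.algebra
  define G K N0 N1 N2 N4 where "G = \<iota> g" "K = \<iota> k" "N0 = \<iota> n0" "N1 = \<iota> n1" "N2 = \<iota> n2" "N4 = \<iota> n4"
  note defs = this
  have nz: "G \<noteq> 0" "K \<noteq> 0" using g k by (simp_all add: defs ring_morphism_eq_0_iff[OF \<iota>])
  have N: "G * N0 = 2 * K ^ 2 * \<rho> ^ 3" "G ^ 2 * N1 = - 8 * K ^ 2 * (1 + 2 * \<rho>)"
    "G ^ 3 * N2 = - \<gamma> * K ^ 2" "\<gamma> * G ^ 4 * N4 = - 128 * \<rho> * K ^ 4"
    using n0[THEN arg_cong[where f = \<iota>]] n1[THEN arg_cong[where f = \<iota>]]
      n2[THEN arg_cong[where f = \<iota>]] n4[THEN arg_cong[where f = \<iota>]]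
    by (simp_all add: defs \<rho>_def \<gamma>_def m\<iota>)
  have const_in: "G \<in> adjoin \<iota> S" "K \<in> adjoin \<iota> S" "\<rho> \<in> adjoin \<iota> S" "\<gamma> \<in> adjoin \<iota> S" for S
    by (simp_all add: defs \<rho>_def \<gamma>_def adjoin.const)
  define w where "w = x / (t ^ 2 * T)"
  define u where "u = G * w"
  define x' where "x' = K ^ 2 * w ^ 3 * t"
  define z where "z = y / (t ^ 2 * T)"
  define y' where "y' = K ^ 3 * w ^ 3 * z"
  have "w \<noteq> 0" using \<open>x \<noteq> 0\<close> \<open>T \<noteq> 0\<close> t_nz by (simp add: w_def)
  have x: "x = w * (t ^ 2 * T)" using \<open>T \<noteq> 0\<close> t_nz by (simp add: w_def)
  have w: "w = u / G" using nz by (simp add: u_def)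
  have t: "t = x' / (K ^ 2 * w ^ 3)" using \<open>w \<noteq> 0\<close> nz by (simp add: x'_def)
  have y_eq: "y = t ^ 2 * T * y' / (K ^ 3 * w ^ 3)"
    using \<open>w \<noteq> 0\<close> \<open>T \<noteq> 0\<close> nz t_nz by (simp add: y'_def z_def)
  have A: "eval1 \<iota> u [:0, n0, n1, n2:] = K ^ 2 * (w * (2 * \<rho> ^ 3 - 8 * (1 + 2 * \<rho>) * w - \<gamma> * w ^ 2))"
  proof -
    have "eval1 \<iota> u [:0, n0, n1, n2:] = w * (G * N0) + w ^ 2 * (G ^ 2 * N1) + w ^ 3 * (G ^ 3 * N2)"
      unfolding u_def by (simp add: eval1_pCons[OF \<iota>] eval1_0 m\<iota> defs) Groebner_Basis.algebra
    also have "\<dots> = K ^ 2 * (w * (2 * \<rho> ^ 3 - 8 * (1 + 2 * \<rho>) * w - \<gamma> * w ^ 2))"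
      unfolding N by Groebner_Basis.algebra
    finally show ?thesis .
  qed
  have B: "\<gamma> * eval1 \<iota> u [:0, 0, 0, 0, n4:] = - 128 * \<rho> * K ^ 4 * w ^ 4"
  proof -
    have "\<gamma> * eval1 \<iota> u [:0, 0, 0, 0, n4:] = w ^ 4 * (\<gamma> * G ^ 4 * N4)"
      unfolding u_def by (simp add: eval1_pCons[OF \<iota>] eval1_0 m\<iota> defs) Groebner_Basis.algebra
    thus ?thesis unfolding N by (simp add: algebra_simps)
  qed
  have eq: "y' ^ 2 = x' ^ 3 + eval1 \<iota> u [:0, n0, n1, n2:] * x' ^ 2 + eval1 \<iota> u [:0, 0, 0, 0, n4:] * x' + 0"
    (is "_ = ?R")
  proof -
    have yz: "y = z * (t ^ 2 * T)" using \<open>T \<noteq> 0\<close> t_nz by (simp add: z_def)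
    have "(t ^ 4 * T ^ 2) * (\<gamma> * z ^ 2) = \<gamma> * y ^ 2"
      unfolding yz by Groebner_Basis.algebra
    also have "\<dots> = \<gamma> * x ^ 3 - 8 * \<gamma> * (1 + 2 * \<rho>) * t ^ 2 * x ^ 2 + 2 * t ^ 3 * x * (T * (\<rho> ^ 3 * \<gamma> * t - 64 * \<rho>))"
      unfolding y factor[symmetric] by Groebner_Basis.algebra
    also have "\<dots> = (t ^ 4 * T ^ 2) * (\<gamma> * w ^ 3 * t ^ 2 * T - 8 * \<gamma> * (1 + 2 * \<rho>) * t ^ 2 * w ^ 2 + 2 * t * w * (\<rho> ^ 3 * \<gamma> * t - 64 * \<rho>))"
      unfolding x by Groebner_Basis.algebra
    finally have z: "\<gamma> * z ^ 2 = \<gamma> * w ^ 3 * t ^ 2 * T - 8 * \<gamma> * (1 + 2 * \<rho>) * t ^ 2 * w ^ 2 + 2 * t * w * (\<rho> ^ 3 * \<gamma> * t - 64 * \<rho>)"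
      using \<open>T \<noteq> 0\<close> t_nz by simp
    have "\<gamma> * y' ^ 2 = K ^ 6 * w ^ 6 * (\<gamma> * z ^ 2)"
      unfolding y'_def by Groebner_Basis.algebra
    also have "\<dots> = \<gamma> * x' ^ 3 + \<gamma> * eval1 \<iota> u [:0, n0, n1, n2:] * x' ^ 2 + (\<gamma> * eval1 \<iota> u [:0, 0, 0, 0, n4:]) * x'"
      unfolding z A B x'_def T_def by Groebner_Basis.algebra
    also have "\<dots> = \<gamma> * ?R" by (simp add: algebra_simps)
    finally show ?thesis using \<gamma>_nz by simp
  qed
  have tu: "alg_independent \<iota> t u"
  proof (rule alg_independent_exchange[OF \<iota> tx, of "{}"])
    have g: "t \<in> adjoin \<iota> {t, u}" "u \<in> adjoin \<iota> {t, u}" by (simp_all add: adjoin.gen)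
    have "x \<in> adjoin \<iota> {t, u}" unfolding x w T_def by (intro I g const_in)
    thus "x \<in> adjoin \<iota> ({} \<union> {t, u})" by simp
  qed simp
  have ux: "alg_independent \<iota> u x'"
  proof (rule alg_independent_exchange[OF \<iota> alg_independent_sym[OF \<iota> tu], of "{}"])
    have g: "x' \<in> adjoin \<iota> {u, x'}" "u \<in> adjoin \<iota> {u, x'}" by (simp_all add: adjoin.gen)
    have "t \<in> adjoin \<iota> {u, x'}" by (subst t, subst w) (intro I g const_in)
    thus "t \<in> adjoin \<iota> ({} \<union> {u, x'})" by simp
  qed simp
  have gen': "adjoin \<iota> {u, x', y'} = UNIV"
  proof -
    let ?A = "adjoin \<iota> {u, x', y'}"
    have g: "u \<in> ?A" "x' \<in> ?A" "y' \<in> ?A" by (simp_all add: adjoin.gen)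
    have w_in: "w \<in> ?A" unfolding w by (intro I g const_in)
    have t_in: "t \<in> ?A" by (subst t) (intro I g const_in w_in)
    have "x \<in> ?A" unfolding x T_def by (intro I const_in w_in t_in)
    moreover have "y \<in> ?A" by (subst y_eq, unfold T_def) (intro I const_in w_in t_in g)
    ultimately have "adjoin \<iota> {t, x, y} \<subseteq> ?A" using t_in by (intro adjoin_subset) simp
    thus ?thesis using gen by auto
  qed
  have nonzero: "p \<noteq> 0 \<Longrightarrow> eval1 \<iota> u p \<noteq> 0" for p
    by (rule alg_independent_eval1_nonzero[OF \<iota> ux])
  have "n0 \<noteq> 0" using n0 k r by auto
  have "n4 \<noteq> 0" using n4 k r by auto
  have disc: "eval1 \<iota> u [:0, n0, n1, n2:] ^ 2 * eval1 \<iota> u [:0, 0, 0, 0, n4:] ^ 2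
      - 4 * eval1 \<iota> u [:0, 0, 0, 0, n4:] ^ 3 \<noteq> 0"
  proof -
    have "u \<noteq> 0" using nz \<open>w \<noteq> 0\<close> by (simp add: u_def)
    have "eval1 \<iota> u [:0, n0, n1, n2:] ^ 2 - 4 * eval1 \<iota> u [:0, 0, 0, 0, n4:] =
        u ^ 2 * eval1 \<iota> u [:n0 ^ 2, 2 * n0 * n1, n1 ^ 2 + 2 * n0 * n2 - 4 * n4, 2 * n1 * n2, n2 ^ 2:]"
      by (simp add: eval1_pCons[OF \<iota>] eval1_0 m\<iota>) Groebner_Basis.algebra
    also have "\<dots> \<noteq> 0"
      using \<open>u \<noteq> 0\<close> \<open>n0 \<noteq> 0\<close> by (simp add: nonzero)
    finally have "eval1 \<iota> u [:0, 0, 0, 0, n4:] ^ 2 *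
        (eval1 \<iota> u [:0, n0, n1, n2:] ^ 2 - 4 * eval1 \<iota> u [:0, 0, 0, 0, n4:]) \<noteq> 0"
      using \<open>n4 \<noteq> 0\<close> by (simp add: nonzero)
    thus ?thesis by (simp add: algebra_simps eval_nat_numeral)
  qed
  have "weierstrass_fibration \<iota> u x' y' (eval1 \<iota> u [:0, n0, n1, n2:]) (eval1 \<iota> u [:0, 0, 0, 0, n4:]) 0"
    unfolding weierstrass_fibration_def ring_morphism_const_embedding
    using \<iota> ux gen' eq disc adjoin_0[OF \<iota>]
    by (simp add: eval1_in_adjoin[OF \<iota> adjoin.gen])
  moreover have "u = \<iota> g * (x / (t ^ 2 * (t - \<iota> c)))"
    by (simp add: u_def w_def T_def defs \<gamma>_def)
  hence "\<forall>(v, n) \<in> I4_star_divisor \<iota> t x y c. v u = - int n"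
    using I4_star_parameter_orders[OF \<iota> t_nz(1) \<open>x \<noteq> 0\<close> _ \<open>c \<noteq> 0\<close> g] t_nz(2) by (auto simp: \<gamma>_def)
  ultimately show ?thesis
    using that by (auto simp: induced_fibration_def)
qed

section \<open>The quotient by the two-torsion translation\<close>

lemma eval1_in_adjoin_singleton:
  "ring_morphism \<iota> \<Longrightarrow> s \<in> S \<Longrightarrow> eval1 \<iota> s p \<in> adjoin \<iota> S"
  by (rule eval1_in_adjoin) (auto intro: adjoin.gen)

text \<open>
  The translation sends \<open>x\<close> to \<open>B / x\<close> and \<open>y\<close> to
  \<open>- B y / x\<^sup>2\<close>; it exists because these satisfy the same equation. It changes the sign
  of the slope \<open>\<theta> = y / x\<close>, so the fixed field is generated by the invariant functions
  \<open>\<theta>\<^sup>2 = x + A + B / x\<close> and \<open>\<theta> (x - B / x)\<close>.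
\<close>

lemma two_torsion_quotient:
  fixes \<iota> :: "complex \<Rightarrow> 'k::field" and a b :: "complex poly"
  assumes W: "weierstrass_fibration \<iota> u x y (eval1 \<iota> u a) (eval1 \<iota> u b) 0"
  obtains \<tau> x' y' where "two_torsion_translation \<iota> u x y (eval1 \<iota> u a) \<tau>"
    "fixed_field \<tau> = adjoin \<iota> {u, x', y'}" "alg_independent \<iota> u x'"
    "y' ^ 2 = eval2 \<iota> u x' [:0, a ^ 2 - 4 * b, - 2 * a, 1:]"
proof -
  define A B where "A = eval1 \<iota> u a" and "B = eval1 \<iota> u b"
  have \<iota>: "ring_morphism \<iota>" and ux: "alg_independent \<iota> u x" and gen: "adjoin \<iota> {u, x, y} = UNIV"
    and y: "y ^ 2 = x ^ 3 + A * x ^ 2 + B * x" and disc: "A ^ 2 * B ^ 2 - 4 * B ^ 3 \<noteq> 0"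
    using W by (simp_all add: weierstrass_fibration_def ring_morphism_const_embedding A_def B_def)
  note I = adjoin_intros(1-3,9)[OF \<iota>] adjoin_intros(4-8,10)
  note m = eval1_morphism[OF \<iota>, of u]
  have AB_in: "A \<in> adjoin \<iota> S" "B \<in> adjoin \<iota> S" if "u \<in> S" for S
    unfolding A_def B_def using that by (simp_all add: eval1_in_adjoin_singleton[OF \<iota>])
  have "B \<noteq> 0" using disc by auto
  have eval: "eval2 \<iota> u z [:0, b, a, 1:] = z ^ 3 + A * z ^ 2 + B * z"
    "eval2 \<iota> u z [:0, a ^ 2 - 4 * b, - 2 * a, 1:] = z * ((z - A) ^ 2 - 4 * B)" for z
    unfolding A_def B_def
    by (simp_all add: eval1_pCons[OF m] eval1_0 ring_morphism_simps[OF m], (Groebner_Basis.algebra)+)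
  have "x \<noteq> 0" using alg_independent_not_in_adjoin[OF \<iota> ux] adjoin_0[OF \<iota>] by metis
  have "eval2 \<iota> u x [:0, b, a, 1:] \<noteq> 0" using ux by (simp add: alg_independent_eval2)
  hence "y \<noteq> 0" using y by (auto simp: eval)
  define \<xi> where "\<xi> = B / x"
  define \<eta> where "\<eta> = - (y * \<xi> / x)"
  have \<xi>: "x * \<xi> = B" using \<open>x \<noteq> 0\<close> by (simp add: \<xi>_def)
  have "\<xi> \<noteq> 0" using \<xi> \<open>B \<noteq> 0\<close> by auto
  have x_eq: "x = B / \<xi>" using \<open>\<xi> \<noteq> 0\<close> unfolding \<xi>[symmetric] by simp
  have y_eq: "y = - (\<eta> * x / \<xi>)" using \<open>x \<noteq> 0\<close> \<open>\<xi> \<noteq> 0\<close> by (simp add: \<eta>_def)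
  have slope: "(y / x) ^ 2 = x + A + \<xi>"
  proof -
    have "x ^ 2 * (x + A + \<xi>) = x ^ 3 + A * x ^ 2 + (x * \<xi>) * x" by Groebner_Basis.algebra
    also have "\<dots> = y ^ 2" unfolding \<xi> y ..
    finally show ?thesis using \<open>x \<noteq> 0\<close> by (simp add: power_divide field_simps)
  qed
  have \<eta>: "\<eta> ^ 2 = \<xi> ^ 3 + A * \<xi> ^ 2 + B * \<xi>"
  proof -
    have "\<eta> ^ 2 = (y / x) ^ 2 * \<xi> ^ 2" by (simp add: \<eta>_def power_mult_distrib power_divide)
    also have "\<dots> = \<xi> ^ 3 + A * \<xi> ^ 2 + (x * \<xi>) * \<xi>" unfolding slope by Groebner_Basis.algebra
    finally show ?thesis unfolding \<xi> .
  qed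
  have u\<xi>: "alg_independent \<iota> u \<xi>"
  proof (rule alg_independent_exchange[OF \<iota> ux, of "{}"])
    have "x \<in> adjoin \<iota> {u, \<xi>}" by (subst x_eq) (intro I AB_in adjoin.gen; simp)
    thus "x \<in> adjoin \<iota> ({} \<union> {u, \<xi>})" by simp
  qed simp
  have gen': "adjoin \<iota> {u, \<xi>, \<eta>} = UNIV"
  proof -
    have g: "u \<in> adjoin \<iota> {u, \<xi>, \<eta>}" "\<xi> \<in> adjoin \<iota> {u, \<xi>, \<eta>}" "\<eta> \<in> adjoin \<iota> {u, \<xi>, \<eta>}"
      by (simp_all add: adjoin.gen)
    have x: "x \<in> adjoin \<iota> {u, \<xi>, \<eta>}" by (subst x_eq) (intro I AB_in g; simp)
    have "y \<in> adjoin \<iota> {u, \<xi>, \<eta>}" by (subst y_eq) (intro I g x)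
    hence "adjoin \<iota> {u, x, y} \<subseteq> adjoin \<iota> {u, \<xi>, \<eta>}" using g x by (intro adjoin_subset) simp
    thus ?thesis using gen by auto
  qed
  have odd: "odd (Polynomial.degree [:0, b, a, 1:])" by simp
  have weq: "y ^ 2 = eval2 \<iota> u x [:0, b, a, 1:]" "\<eta> ^ 2 = eval2 \<iota> u \<xi> [:0, b, a, 1:]"
    unfolding eval by (rule y \<eta>)+
  obtain \<tau> where bij: "bij_betw \<tau> UNIV UNIV"
    and hom: "\<And>z w. \<tau> (z + w) = \<tau> z + \<tau> w \<and> \<tau> (z * w) = \<tau> z * \<tau> w"
    and \<tau>: "\<And>c. \<tau> (\<iota> c) = \<iota> c" "\<tau> u = u" "\<tau> x = \<xi>" "\<tau> y = \<eta>"
    using double_plane_isomorphism[OF \<iota> \<iota> ux u\<xi> odd weq] unfolding gen gen'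
    by (metis (no_types, lifting) UNIV_I)
  have aut: "const_automorphism \<iota> \<tau>"
    using bij hom \<tau>(1) by (simp add: const_automorphism_def)
  note \<tau>m = const_automorphism_morphism[OF \<iota> aut]
  have translation: "two_torsion_translation \<iota> u x y A \<tau>"
    using aut \<tau> by (simp add: two_torsion_translation_def slope \<eta>_def)
  define \<theta> where "\<theta> = y / x"
  define x' where "x' = \<theta> ^ 2"
  define y' where "y' = \<theta> * (x - \<xi>)"
  have "\<theta> \<noteq> 0" using \<open>x \<noteq> 0\<close> \<open>y \<noteq> 0\<close> by (simp add: \<theta>_def)
  have x': "x' = x + A + \<xi>" unfolding x'_def \<theta>_def by (rule slope)
  have eq: "y' ^ 2 = x' * ((x' - A) ^ 2 - 4 * B)"
  proof -
    have "y' ^ 2 = x' * (x - \<xi>) ^ 2" by (simp add: y'_def x'_def power_mult_distrib)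
    also have "(x - \<xi>) ^ 2 = (x' - A) ^ 2 - 4 * (x * \<xi>)"
      unfolding x' by Groebner_Basis.algebra
    finally show ?thesis unfolding \<xi> .
  qed
  have "(2::'k) \<noteq> 0" by (rule ring_morphism_numeral_nonzero[OF \<iota>])
  have x_form: "x = (x' - A + y' / \<theta>) / 2"
  proof -
    have "x' - A + y' / \<theta> = 2 * x" using \<open>\<theta> \<noteq> 0\<close> by (simp add: y'_def x')
    thus ?thesis using \<open>2 \<noteq> 0\<close> by simp
  qed
  have fixed: "fixed_field \<tau> = adjoin \<iota> {u, x', y'}"
  proof (rule fixed_field_quadratic[OF \<iota> aut])
    have "\<tau> B = B"
      using const_automorphism_fixes_adjoin[OF \<iota> aut, of "{u}" B] \<tau>(2) AB_in by simp
    hence \<tau>\<xi>: "\<tau> \<xi> = x"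
      using ring_morphism_divide[OF \<tau>m, of B x] x_eq unfolding \<xi>_def[symmetric] \<tau>(3) by simp
    show \<tau>\<theta>: "\<tau> \<theta> = - \<theta>"
      using \<open>\<xi> \<noteq> 0\<close> by (simp add: \<theta>_def ring_morphism_divide[OF \<tau>m] \<tau> \<eta>_def)
    have "\<tau> x' = x'" by (simp add: x'_def ring_morphism_simps[OF \<tau>m] \<tau>\<theta>)
    moreover have "\<tau> y' = y'"
      by (simp add: y'_def ring_morphism_mult[OF \<tau>m] ring_morphism_diff[OF \<tau>m] \<tau>\<theta> \<tau>\<xi> \<tau>(3) algebra_simps)
    ultimately show "\<tau> z = z" if "z \<in> {u, x', y'}" for z
      using that \<tau>(2) by auto
    show "\<theta> ^ 2 \<in> adjoin \<iota> {u, x', y'}" by (auto simp: x'_def[symmetric] intro: adjoin.gen)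
    have g: "z \<in> adjoin \<iota> {\<theta>, u, x', y'}" if "z \<in> {\<theta>, u, x', y'}" for z
      using that by (rule adjoin.gen)
    have x: "x \<in> adjoin \<iota> {\<theta>, u, x', y'}" by (subst x_form) (intro I AB_in g; simp)
    have "y = \<theta> * x" using \<open>x \<noteq> 0\<close> by (simp add: \<theta>_def)
    hence "y \<in> adjoin \<iota> {\<theta>, u, x', y'}" using x g by (simp add: adjoin.mult)
    hence "adjoin \<iota> {u, x, y} \<subseteq> adjoin \<iota> {\<theta>, u, x', y'}" using g x by (intro adjoin_subset) simp
    thus "adjoin \<iota> (insert \<theta> {u, x', y'}) = UNIV" using gen by auto
  qed (use \<open>\<theta> \<noteq> 0\<close> in auto)
  have ind: "alg_independent \<iota> u x'"
  proof (rule alg_independent_exchange[OF \<iota> ux, of "{\<theta>, y'}"])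
    have "u \<in> {\<theta>, y'} \<union> {u, x'}" by simp
    thus "x \<in> adjoin \<iota> ({\<theta>, y'} \<union> {u, x'})"
      by (subst x_form) (intro I AB_in adjoin.gen; simp)
    fix z assume z: "z \<in> {\<theta>, y'}"
    have g: "u \<in> adjoin \<iota> {u, x'}" "x' \<in> adjoin \<iota> {u, x'}" by (simp_all add: adjoin.gen)
    have "x' * ((x' - A) ^ 2 - 4 * B) \<in> adjoin \<iota> {u, x'}" by (intro I AB_in g; simp)
    thus "z ^ 2 \<in> adjoin \<iota> {u, x'}" using z g by (auto simp: x'_def[symmetric] eq)
  qed
  show ?thesis
    by (rule that[OF translation[unfolded A_def] fixed ind]) (simp only: eq eval)
qed

section \<open>Elliptic curves with the given invariants\<close>

text \<open>
  Equality of the invariants means \<open>a\<^sup>3 b0\<^sup>2 = a0\<^sup>3 b\<^sup>2\<close>, so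
  \<open>\<delta>\<^sup>2\<close> is \<open>b a0 / (a b0)\<close> unless a coefficient vanishes; in the two
  exceptional cases one root extraction is enough.
\<close>

lemma twist_of_equal_j_invariant:
  assumes e: "elliptic_curve a b" "elliptic_curve a0 b0" and j: "j_invariant a b = j_invariant a0 b0"
  obtains \<delta> where "\<delta> \<noteq> 0" "a = \<delta> ^ 4 * a0" "b = \<delta> ^ 6 * b0"
proof -
  have nz: "4 * a ^ 3 + 27 * b ^ 2 \<noteq> 0" "4 * a0 ^ 3 + 27 * b0 ^ 2 \<noteq> 0"
    using e by (simp_all add: elliptic_curve_def)
  have "a ^ 3 * (4 * a0 ^ 3 + 27 * b0 ^ 2) = a0 ^ 3 * (4 * a ^ 3 + 27 * b ^ 2)"
    using j nz by (simp add: j_invariant_def frac_eq_eq)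
  hence cross: "a ^ 3 * b0 ^ 2 = a0 ^ 3 * b ^ 2" by (simp add: algebra_simps)
  have root: "\<exists>w. w ^ n = z" if "n > 0" for z :: complex and n
  proof -
    have "Polynomial.degree (Polynomial.monom 1 n + [:- z:]) = n"
      using that by (subst degree_add_eq_left) (simp_all add: degree_monom_eq)
    hence "\<not> constant (poly (Polynomial.monom 1 n + [:- z:]))"
      using that by (simp add: constant_degree)
    then obtain w where "poly (Polynomial.monom 1 n + [:- z:]) w = 0"
      using fundamental_theorem_of_algebra by blast
    thus ?thesis by (auto simp: poly_monom)
  qed
  consider "a0 = 0" | "b0 = 0" "a0 \<noteq> 0" | "a0 \<noteq> 0" "b0 \<noteq> 0" by blast
  thus ?thesis
  proof cases
    case 1
    hence "b0 \<noteq> 0" "a = 0" using nz cross by auto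
    obtain \<delta> where d: "\<delta> ^ 6 = b / b0" using root[of 6] by auto
    have "b \<noteq> 0" using nz \<open>a = 0\<close> by auto
    hence "\<delta> \<noteq> 0" using d \<open>b0 \<noteq> 0\<close> by auto
    thus ?thesis using that[of \<delta>] 1 \<open>a = 0\<close> d \<open>b0 \<noteq> 0\<close> by simp
  next
    case 2
    hence "b = 0" using cross by auto
    obtain \<delta> where d: "\<delta> ^ 4 = a / a0" using root[of 4] by auto
    have "a \<noteq> 0" using nz \<open>b = 0\<close> by auto
    hence "\<delta> \<noteq> 0" using d 2 by auto
    thus ?thesis using that[of \<delta>] 2 \<open>b = 0\<close> d by simp
  next
    case 3
    have ab: "a \<noteq> 0" "b \<noteq> 0" using cross nz 3 by auto
    obtain \<delta> where d: "\<delta> ^ 2 = b * a0 / (a * b0)" using root[of 2] by auto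
    hence "\<delta> \<noteq> 0" using ab 3 by auto
    have "\<delta> ^ 4 = (\<delta> ^ 2) ^ 2" "\<delta> ^ 6 = (\<delta> ^ 2) ^ 3" by simp_all
    moreover have "a * (a * b0) ^ 2 = (b * a0) ^ 2 * a0"
      using cross by (simp add: power_mult_distrib eval_nat_numeral mult_ac)
    hence "a = (\<delta> ^ 2) ^ 2 * a0"
      using ab 3 unfolding d by (simp add: power_divide field_simps)
    moreover have "b * (a * b0) ^ 3 = (b * a0) ^ 3 * b0"
    proof -
      have "b * (a * b0) ^ 3 = b * b0 * (a ^ 3 * b0 ^ 2)" by Groebner_Basis.algebra
      also have "\<dots> = (b * a0) ^ 3 * b0" unfolding cross by Groebner_Basis.algebra
      finally show ?thesis .
    qed
    hence "b = (\<delta> ^ 2) ^ 3 * b0"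
      using ab 3 unfolding d by (simp add: power_divide field_simps)
    ultimately show ?thesis using that[of \<delta>] \<open>\<delta> \<noteq> 0\<close> by simp
  qed
qed

text \<open>
  The curve \<open>y\<^sup>2 = x (x\<^sup>2 + M x + N)\<close> has invariant
  \<open>256 (h - 3)\<^sup>3 / (h - 4)\<close> with \<open>h = M\<^sup>2 / N\<close>. For the invariant
  \<open>quer_j s\<close> one of the three solutions \<open>h\<close> is rational in \<open>s\<close>, namely
  \<open>- 3 (2 s\<^sup>2 + 2 s - 1)\<^sup>2 / ((s + 1) (s - 1)\<^sup>3)\<close>.
\<close>

definition quer_M :: "complex \<Rightarrow> complex" where
  "quer_M s = 3 * (2 * s ^ 2 + 2 * s - 1)"

definition quer_N :: "complex \<Rightarrow> complex" where
  "quer_N s = - 3 * (s + 1) * (s - 1) ^ 3"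

lemma quer_discriminant: "quer_M s ^ 2 - 4 * quer_N s = 3 * (2 * s - 1) * (2 * s + 1) ^ 3"
  unfolding quer_M_def quer_N_def by Groebner_Basis.algebra

text \<open>
  Here \<open>a0\<close> and \<open>b0\<close> are the coefficients after completing the cube.
\<close>

lemma quer_model:
  fixes s :: complex
  assumes s: "s \<noteq> 1" "s \<noteq> - 1" "2 * s \<noteq> 1" "2 * s \<noteq> - 1"
  defines "M \<equiv> quer_M s" and "N \<equiv> quer_N s"
  defines "a0 \<equiv> N - M ^ 2 / 3" and "b0 \<equiv> M * (2 * M ^ 2 - 9 * N) / 27"
  shows "elliptic_curve a0 b0" "j_invariant a0 b0 = quer_j s"
proof -
  have nz: "s - 1 \<noteq> 0" "s + 1 \<noteq> 0" "2 * s - 1 \<noteq> 0" "2 * s + 1 \<noteq> 0"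
    using s by (auto simp: eq_neg_iff_add_eq_0)
  define d where "d = (2 * s - 1) * (s + 1) ^ 2 * (2 * s + 1) ^ 3 * (s - 1) ^ 6"
  have "d \<noteq> 0" using nz by (simp add: d_def)
  have disc: "4 * a0 ^ 3 + 27 * b0 ^ 2 = - 27 * d"
  proof -
    have "27 * (4 * a0 ^ 3 + 27 * b0 ^ 2) = 4 * (3 * N - M ^ 2) ^ 3 + (M * (2 * M ^ 2 - 9 * N)) ^ 2"
      unfolding a0_def b0_def by (simp add: field_simps eval_nat_numeral)
    also have "\<dots> = - 27 * (N ^ 2 * (M ^ 2 - 4 * N))" by Groebner_Basis.algebra
    also have "\<dots> = 27 * (- 27 * d)"
      unfolding M_def N_def quer_discriminant unfolding quer_N_def d_def by Groebner_Basis.algebra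
    finally show ?thesis unfolding mult_left_cancel[OF zero_neq_numeral[symmetric]] .
  qed
  show "elliptic_curve a0 b0" using \<open>d \<noteq> 0\<close> by (simp add: elliptic_curve_def disc)
  have "M ^ 2 - 3 * N = 9 * s * (5 * s ^ 3 + 6 * s ^ 2 - 2)"
    unfolding M_def N_def quer_M_def quer_N_def by Groebner_Basis.algebra
  hence "a0 = - 3 * (s * (5 * s ^ 3 + 6 * s ^ 2 - 2))"
    unfolding a0_def by (simp add: field_simps)
  hence "1728 * (4 * a0 ^ 3) = - 27 * (6912 * (5 * s ^ 3 + 6 * s ^ 2 - 2) ^ 3 * s ^ 3)"
    by (simp add: power_mult_distrib)
  hence "j_invariant a0 b0 = - 27 * (6912 * (5 * s ^ 3 + 6 * s ^ 2 - 2) ^ 3 * s ^ 3) / (- 27 * d)"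
    unfolding j_invariant_def disc by (simp only:)
  thus "j_invariant a0 b0 = quer_j s"
    using \<open>d \<noteq> 0\<close> unfolding quer_j_def d_def[symmetric] by simp
qed

lemma quadratic_roots:
  fixes M N :: complex
  obtains g1 g2 where "M = - (g1 + g2)" "N = g1 * g2"
proof -
  define D where "D = csqrt (M ^ 2 - 4 * N)"
  have D: "D ^ 2 = M ^ 2 - 4 * N" by (simp add: D_def)
  have "N = ((- M + D) / 2) * ((- M - D) / 2)"
    using D by (simp add: field_simps power2_eq_square)
  thus ?thesis using that[of "(- M + D) / 2" "(- M - D) / 2"] by (simp add: field_simps)
qed

section \<open>A fibration on the Kummer surface\<close>

text \<open>
  Write \<open>g1\<close>, \<open>g2\<close> and \<open>g1'\<close>, \<open>g2'\<close> for the roots of the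
  quadratic factors. With \<open>p = u p'\<close> the function \<open>w = q q' / p'\<close> satisfies
  \<open>w\<^sup>2 = u (u p' - g1) (u p' - g2) (p' - g1') (p' - g2')\<close>. The Weierstrass coordinate
  \<open>x\<close> is a fractional linear function of \<open>p'\<close> with its zero at \<open>g2'\<close> and its
  pole at \<open>g1'\<close>. Besides \<open>0\<close> the roots of the cubic are
  \<open>Q1 = u (u g1' - g2) (u g2' - g1)\<close> and \<open>Q2 = u (u g1' - g1) (u g2' - g2)\<close>, whose sum
  and squared difference are polynomials in \<open>M\<close>, \<open>N\<close>, \<open>M'\<close>, \<open>N'\<close>
  and \<open>u\<close>.
\<close>

lemma kummer_field_normalised:
  fixes \<kappa> :: "complex \<Rightarrow> 'l::field"
  assumes \<kappa>: "ring_morphism \<kappa>" and pp: "alg_independent \<kappa> p p'"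
    and gen: "adjoin \<kappa> {p, q, p', q'} = UNIV"
    and q: "q ^ 2 = p * (p ^ 2 + \<kappa> M * p + \<kappa> N)" and q': "q' ^ 2 = p' * (p' ^ 2 + \<kappa> M' * p' + \<kappa> N')"
    and \<sigma>: "product_negation \<kappa> p q p' q' \<sigma>"
    and nz: "N' \<noteq> 0" "M' ^ 2 \<noteq> 4 * N'"
  obtains u x y where "fixed_field \<sigma> = adjoin \<kappa> {u, x, y}" "alg_independent \<kappa> u x"
    "y ^ 2 = x * ((x - eval1 \<kappa> u [:0, N, - (M * M' / 2), N':]) ^ 2
       - 4 * eval1 \<kappa> u [:0, 0, 0, 0, (M ^ 2 - 4 * N) * (M' ^ 2 - 4 * N') / 16:])"
proof -
  note m\<kappa> = ring_morphism_simps[OF \<kappa>]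
  note I = adjoin_intros(1-3,9)[OF \<kappa>] adjoin_intros(4-8,10)
  note num = ring_morphism_numeral_nonzero[OF \<kappa>]
  obtain g1 g2 where g: "M = - (g1 + g2)" "N = g1 * g2" by (rule quadratic_roots)
  obtain g1' g2' where g': "M' = - (g1' + g2')" "N' = g1' * g2'" by (rule quadratic_roots)
  have g_nz: "g1' \<noteq> 0" "g1' - g2' \<noteq> 0"
    using nz by (auto simp: g' power2_eq_square algebra_simps)
  define e1 e2 e1' e2' where "e1 = \<kappa> g1" "e2 = \<kappa> g2" "e1' = \<kappa> g1'" "e2' = \<kappa> g2'"
  note e_defs = this
  have e_in: "e1 \<in> adjoin \<kappa> S" "e2 \<in> adjoin \<kappa> S" "e1' \<in> adjoin \<kappa> S" "e2' \<in> adjoin \<kappa> S" for S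
    by (simp_all add: e_defs adjoin.const)
  define h where "h = e1' - e2'"
  have "h \<noteq> 0"
    using g_nz ring_morphism_eq_0_iff[OF \<kappa>, of "g1' - g2'"] by (simp add: h_def e_defs m\<kappa>)
  have q_fac: "q ^ 2 = p * (p - e1) * (p - e2)" and q'_fac: "q' ^ 2 = p' * (p' - e1') * (p' - e2')"
    unfolding q q' g g' e_defs by (simp_all add: m\<kappa>, (Groebner_Basis.algebra)+)
  have p_nz: "p \<noteq> 0" "p' \<noteq> 0" "p - e1 \<noteq> 0" "p - e2 \<noteq> 0" "p' - e1' \<noteq> 0"
    using alg_independent_eval1_nonzero[OF \<kappa> pp, of "[:0, 1:]"]
      alg_independent_eval1_nonzero[OF \<kappa> pp, of "[:- g1, 1:]"]
      alg_independent_eval1_nonzero[OF \<kappa> pp, of "[:- g2, 1:]"]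
      alg_independent_eval1_nonzero[OF \<kappa> alg_independent_sym[OF \<kappa> pp], of "[:0, 1:]"]
      alg_independent_eval1_nonzero[OF \<kappa> alg_independent_sym[OF \<kappa> pp], of "[:- g1', 1:]"]
    by (simp_all add: eval1_pCons[OF \<kappa>] eval1_0 m\<kappa> e_defs)
  have "q \<noteq> 0" using q_fac p_nz by auto
  define u where "u = p / p'"
  have p: "p = u * p'" using p_nz by (simp add: u_def)
  have p'u: "alg_independent \<kappa> p' u"
  proof (rule alg_independent_exchange[OF \<kappa> alg_independent_sym[OF \<kappa> pp], of "{}"])
    show "p \<in> adjoin \<kappa> ({} \<union> {p', u})" by (subst p) (intro I adjoin.gen; simp)
  qed simp
  note up' = alg_independent_sym[OF \<kappa> p'u]
  have "u \<noteq> 0" using p_nz by (simp add: u_def)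
  define f1 f2 where "f1 = u * e1' - e1" and "f2 = u * e1' - e2"
  have f: "f1 \<noteq> 0" "f2 \<noteq> 0"
    using alg_independent_eval1_nonzero[OF \<kappa> up', of "[:- g1, g1':]"] g_nz
      alg_independent_eval1_nonzero[OF \<kappa> up', of "[:- g2, g1':]"]
    by (simp_all add: eval1_pCons[OF \<kappa>] eval1_0 m\<kappa> e_defs f1_def f2_def)
  define e where "e = p' - e1'"
  have "e \<noteq> 0" using p_nz by (simp add: e_def)
  define \<nu> where "\<nu> = (e + h) / e"
  define x where "x = u * f1 * f2 * \<nu>"
  define w where "w = q * q' / p'"
  define y where "y = u * f1 * f2 * h * w / e ^ 2"
  have w: "w ^ 2 = u * (u * e + f1) * (u * e + f2) * e * (e + h)"
  proof -
    have "p' ^ 2 * w ^ 2 = q ^ 2 * q' ^ 2" using p_nz by (simp add: w_def power_divide power_mult_distrib)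
    also have "\<dots> = p' ^ 2 * (u * (u * e + f1) * (u * e + f2) * e * (e + h))"
      unfolding q_fac q'_fac p f1_def f2_def e_def h_def by Groebner_Basis.algebra
    finally show ?thesis using p_nz by simp
  qed
  define Q1 Q2 where "Q1 = u * f2 * (f1 - u * h)" and "Q2 = u * f1 * (f2 - u * h)"
  have eq: "y ^ 2 = x * ((x - Q1) * (x - Q2))"
  proof -
    have xe: "e * x = u * f1 * f2 * (e + h)" using \<open>e \<noteq> 0\<close> by (simp add: x_def \<nu>_def)
    have "e ^ 2 * y = u * f1 * f2 * h * w" using \<open>e \<noteq> 0\<close> by (simp add: y_def)
    hence "e ^ 4 * y ^ 2 = (u * f1 * f2 * h) ^ 2 * w ^ 2" by Groebner_Basis.algebra
    also have "\<dots> = e * ((u * f1 * f2 * (e + h)) * ((u * f1 * f2 * (e + h) - e * Q1) * (u * f1 * f2 * (e + h) - e * Q2)))"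
      unfolding w Q1_def Q2_def by Groebner_Basis.algebra
    also have "\<dots> = e ^ 4 * (x * ((x - Q1) * (x - Q2)))"
      unfolding xe[symmetric] by Groebner_Basis.algebra
    finally show ?thesis using \<open>e \<noteq> 0\<close> by simp
  qed
  define A B where "A = eval1 \<kappa> u [:0, N, - (M * M' / 2), N':]"
    and "B = eval1 \<kappa> u [:0, 0, 0, 0, (M ^ 2 - 4 * N) * (M' ^ 2 - 4 * N') / 16:]"
  have A: "2 * A = Q1 + Q2"
  proof -
    have "2 * A = 2 * u * (\<kappa> N + \<kappa> N' * u ^ 2) - \<kappa> M * \<kappa> M' * u ^ 2"
      unfolding A_def using num
      by (simp add: eval1_pCons[OF \<kappa>] eval1_0 m\<kappa> ring_morphism_divide[OF \<kappa>] field_simps eval_nat_numeral)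
    also have "\<dots> = Q1 + Q2"
      unfolding g g' Q1_def Q2_def f1_def f2_def h_def e_defs by (simp add: m\<kappa>) Groebner_Basis.algebra
    finally show ?thesis .
  qed
  have B: "16 * B = (Q1 - Q2) ^ 2"
  proof -
    have "16 * B = (\<kappa> M ^ 2 - 4 * \<kappa> N) * (\<kappa> M' ^ 2 - 4 * \<kappa> N') * u ^ 4"
      unfolding B_def using num
      by (simp add: eval1_pCons[OF \<kappa>] eval1_0 m\<kappa> ring_morphism_divide[OF \<kappa>] eval_nat_numeral)
    also have "\<dots> = (Q1 - Q2) ^ 2"
      unfolding g g' Q1_def Q2_def f1_def f2_def h_def e_defs by (simp add: m\<kappa>) Groebner_Basis.algebra
    finally show ?thesis .
  qed
  have eq': "y ^ 2 = x * ((x - A) ^ 2 - 4 * B)"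
  proof -
    have "4 * ((x - A) ^ 2 - 4 * B) = (2 * x - 2 * A) ^ 2 - 16 * B" by Groebner_Basis.algebra
    also have "\<dots> = 4 * ((x - Q1) * (x - Q2))" unfolding A B by Groebner_Basis.algebra
    finally show ?thesis unfolding eq mult_left_cancel[OF num] by simp
  qed
  have "\<nu> - 1 = h / e" using \<open>e \<noteq> 0\<close> by (simp add: \<nu>_def add_divide_distrib)
  hence "\<nu> - 1 \<noteq> 0" using \<open>h \<noteq> 0\<close> \<open>e \<noteq> 0\<close> by simp
  have p'_eq: "p' = (\<nu> * e1' - e2') / (\<nu> - 1)"
  proof -
    have "(\<nu> - 1) * p' = (\<nu> - 1) * e + (\<nu> - 1) * e1'" by (simp add: e_def algebra_simps)
    also have "\<dots> = h + (\<nu> - 1) * e1'" using \<open>\<nu> - 1 = _\<close> \<open>e \<noteq> 0\<close> by simp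
    also have "\<dots> = \<nu> * e1' - e2'" by (simp add: h_def algebra_simps)
    finally show ?thesis using \<open>\<nu> - 1 \<noteq> 0\<close> by (simp add: field_simps)
  qed
  have p'_in: "p' \<in> adjoin \<kappa> S" if "u \<in> adjoin \<kappa> S" "x \<in> adjoin \<kappa> S" for S
  proof -
    have "\<nu> = x / (u * f1 * f2)" using \<open>u \<noteq> 0\<close> f by (simp add: x_def)
    also have "\<dots> \<in> adjoin \<kappa> S" unfolding f1_def f2_def by (intro I that e_in)
    finally have "\<nu> \<in> adjoin \<kappa> S" .
    thus ?thesis by (subst p'_eq) (intro I e_in)
  qed
  have ux: "alg_independent \<kappa> u x"
    by (rule alg_independent_exchange[OF \<kappa> up', of "{}"], rule p'_in) (simp_all add: adjoin.gen)
  have aut: "const_automorphism \<kappa> \<sigma>" and \<sigma>p: "\<sigma> p = p" "\<sigma> p' = p'" and \<sigma>q: "\<sigma> q = - q" "\<sigma> q' = - q'"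
    using \<sigma> by (simp_all add: product_negation_def)
  note \<sigma>m = const_automorphism_morphism[OF \<kappa> aut]
  have fixed: "fixed_field \<sigma> = adjoin \<kappa> {u, x, y}"
  proof (rule fixed_field_quadratic[OF \<kappa> aut])
    have "\<sigma> w = w" by (simp add: w_def ring_morphism_divide[OF \<sigma>m] ring_morphism_mult[OF \<sigma>m] \<sigma>p \<sigma>q)
    hence fix_w: "\<sigma> z = z" if "z \<in> {p, p', w}" for z using that \<sigma>p by auto
    show "\<sigma> z = z" if "z \<in> {u, x, y}" for z
    proof (rule const_automorphism_fixes_adjoin[OF \<kappa> aut fix_w])
      have G: "p \<in> adjoin \<kappa> {p, p', w}" "p' \<in> adjoin \<kappa> {p, p', w}" "w \<in> adjoin \<kappa> {p, p', w}"
        by (simp_all add: adjoin.gen)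
      have "u \<in> adjoin \<kappa> {p, p', w}" unfolding u_def by (intro I G)
      moreover from this have "x \<in> adjoin \<kappa> {p, p', w}" "y \<in> adjoin \<kappa> {p, p', w}"
        unfolding x_def y_def f1_def f2_def e_def h_def \<nu>_def by (intro I G e_in; simp)+
      ultimately show "z \<in> adjoin \<kappa> {p, p', w}" using that by auto
    qed
    have p_in: "p \<in> adjoin \<kappa> S" "p' \<in> adjoin \<kappa> S" "w \<in> adjoin \<kappa> S" if "{u, x, y} \<subseteq> adjoin \<kappa> S" for S
    proof -
      have uxy: "u \<in> adjoin \<kappa> S" "x \<in> adjoin \<kappa> S" "y \<in> adjoin \<kappa> S" using that by auto
      show p': "p' \<in> adjoin \<kappa> S" by (rule p'_in[OF uxy(1,2)])
      show "p \<in> adjoin \<kappa> S" by (subst p) (intro I uxy p')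
      have "w = y * e ^ 2 / (u * f1 * f2 * h)"
        using \<open>e \<noteq> 0\<close> \<open>u \<noteq> 0\<close> f \<open>h \<noteq> 0\<close> by (simp add: y_def)
      also have "\<dots> \<in> adjoin \<kappa> S" unfolding e_def f1_def f2_def h_def by (intro I uxy p' e_in)
      finally show "w \<in> adjoin \<kappa> S" .
    qed
    show "q ^ 2 \<in> adjoin \<kappa> {u, x, y}"
      unfolding q_fac by (intro I e_in p_in) (auto intro: adjoin.gen)
    have "{u, x, y} \<subseteq> adjoin \<kappa> (insert q {u, x, y})" by (auto intro: adjoin.gen)
    note p_in' = p_in[OF this]
    have q_in: "q \<in> adjoin \<kappa> (insert q {u, x, y})" by (simp add: adjoin.gen)
    have "q' = w * p' / q" using \<open>q \<noteq> 0\<close> p_nz by (simp add: w_def)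
    also have "\<dots> \<in> adjoin \<kappa> (insert q {u, x, y})" by (intro I p_in' q_in)
    finally have "adjoin \<kappa> {p, q, p', q'} \<subseteq> adjoin \<kappa> (insert q {u, x, y})"
      using p_in' q_in by (intro adjoin_subset) simp
    thus "adjoin \<kappa> (insert q {u, x, y}) = UNIV" using gen by auto
  qed (use \<sigma>q \<open>q \<noteq> 0\<close> in auto)
  show ?thesis by (rule that[OF fixed ux eq'[unfolded A_def B_def]])
qed

text \<open>
  Over the complex numbers a curve may be replaced by a twist, and
  \<open>p = \<delta>\<^sup>2 (P + M / 3)\<close> moves the marked two-torsion point to the origin.
\<close>

lemma kummer_field:
  fixes \<kappa> :: "complex \<Rightarrow> 'l::field"
  assumes E: "elliptic_product \<kappa> a b a' b' p q p' q'" and \<sigma>: "product_negation \<kappa> p q p' q' \<sigma>"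
    and \<delta>: "\<delta> \<noteq> 0" "a = \<delta> ^ 4 * (N - M ^ 2 / 3)" "b = \<delta> ^ 6 * (M * (2 * M ^ 2 - 9 * N) / 27)"
    and \<delta>': "\<delta>' \<noteq> 0" "a' = \<delta>' ^ 4 * (N' - M' ^ 2 / 3)" "b' = \<delta>' ^ 6 * (M' * (2 * M' ^ 2 - 9 * N') / 27)"
    and nz: "N' \<noteq> 0" "M' ^ 2 \<noteq> 4 * N'"
  obtains u x y where "fixed_field \<sigma> = adjoin \<kappa> {u, x, y}" "alg_independent \<kappa> u x"
    "y ^ 2 = x * ((x - eval1 \<kappa> u [:0, N, - (M * M' / 2), N':]) ^ 2
       - 4 * eval1 \<kappa> u [:0, 0, 0, 0, (M ^ 2 - 4 * N) * (M' ^ 2 - 4 * N') / 16:])"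
proof -
  have \<kappa>: "ring_morphism \<kappa>" and pp: "alg_independent \<kappa> p p'" and gen: "adjoin \<kappa> {p, q, p', q'} = UNIV"
    and q: "q ^ 2 = p ^ 3 + \<kappa> a * p + \<kappa> b" and q': "q' ^ 2 = p' ^ 3 + \<kappa> a' * p' + \<kappa> b'"
    using E by (simp_all add: elliptic_product_def ring_morphism_const_embedding)
  note m\<kappa> = ring_morphism_simps[OF \<kappa>] ring_morphism_divide[OF \<kappa>]
  note I = adjoin_intros(1-3,9)[OF \<kappa>] adjoin_intros(4-8,10)
  note num = ring_morphism_numeral_nonzero[OF \<kappa>]
  have shift: "(q / \<kappa> d ^ 3) ^ 2 = z * (z ^ 2 + \<kappa> m * z + \<kappa> n)"
    if d: "d \<noteq> 0" and z: "z = p / \<kappa> d ^ 2 - \<kappa> m / 3"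
      and q: "q ^ 2 = p ^ 3 + \<kappa> a * p + \<kappa> b"
      and a: "a = d ^ 4 * (n - m ^ 2 / 3)" and b: "b = d ^ 6 * (m * (2 * m ^ 2 - 9 * n) / 27)"
    for d m n a b p q z
  proof -
    define D \<mu> \<nu> where "D = \<kappa> d" "\<mu> = \<kappa> m / 3" "\<nu> = \<kappa> n"
    note defs = this
    have "D \<noteq> 0" using d by (simp add: defs ring_morphism_eq_0_iff[OF \<kappa>])
    have m: "\<kappa> m = 3 * \<mu>" using num by (simp add: defs)
    have p: "p = D ^ 2 * (z + \<mu>)" using \<open>D \<noteq> 0\<close> by (simp add: z defs)
    have a': "\<kappa> a = D ^ 4 * (\<nu> - 3 * \<mu> ^ 2)"
    proof -
      have "3 * (\<nu> - (3 * \<mu>) ^ 2 / 3) = 3 * (\<nu> - 3 * \<mu> ^ 2)"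
        using num by (simp add: right_diff_distrib power_mult_distrib)
      hence "\<nu> - (3 * \<mu>) ^ 2 / 3 = \<nu> - 3 * \<mu> ^ 2" unfolding mult_left_cancel[OF num] .
      thus ?thesis unfolding a by (simp only: m\<kappa> m defs(1,3)[symmetric])
    qed
    have b': "\<kappa> b = D ^ 6 * (2 * \<mu> ^ 3 - \<mu> * \<nu>)"
    proof -
      have cancel: "27 * (w / 27) = w" for w :: 'l using num by simp
      have "27 * (3 * \<mu> * (2 * (3 * \<mu>) ^ 2 - 9 * \<nu>) / 27) = 27 * (2 * \<mu> ^ 3 - \<mu> * \<nu>)"
        unfolding cancel by Groebner_Basis.algebra
      hence "3 * \<mu> * (2 * (3 * \<mu>) ^ 2 - 9 * \<nu>) / 27 = 2 * \<mu> ^ 3 - \<mu> * \<nu>"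
        unfolding mult_left_cancel[OF num] .
      thus ?thesis unfolding b by (simp only: m\<kappa> m defs(1,3)[symmetric])
    qed
    have "q ^ 2 = (D ^ 3) ^ 2 * (z * (z ^ 2 + 3 * \<mu> * z + \<nu>))"
      unfolding q a' b' p by Groebner_Basis.algebra
    thus ?thesis using \<open>D \<noteq> 0\<close> unfolding power_divide m defs(1,3)[symmetric] by simp
  qed
  define P Q P' Q' where "P = p / \<kappa> \<delta> ^ 2 - \<kappa> M / 3" and "Q = q / \<kappa> \<delta> ^ 3"
    and "P' = p' / \<kappa> \<delta>' ^ 2 - \<kappa> M' / 3" and "Q' = q' / \<kappa> \<delta>' ^ 3"
  have \<kappa>\<delta>: "\<kappa> \<delta> \<noteq> 0" "\<kappa> \<delta>' \<noteq> 0" using \<delta> \<delta>' by (simp_all add: ring_morphism_eq_0_iff[OF \<kappa>])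
  have p: "p = \<kappa> \<delta> ^ 2 * (P + \<kappa> M / 3)" and p': "p' = \<kappa> \<delta>' ^ 2 * (P' + \<kappa> M' / 3)"
    and q_eq: "q = \<kappa> \<delta> ^ 3 * Q" and q'_eq: "q' = \<kappa> \<delta>' ^ 3 * Q'"
    using \<kappa>\<delta> by (simp_all add: P_def Q_def P'_def Q'_def)
  have "alg_independent \<kappa> p P'"
  proof (rule alg_independent_exchange[OF \<kappa> pp, of "{}"])
    show "p' \<in> adjoin \<kappa> ({} \<union> {p, P'})" by (subst p') (intro I adjoin.gen; simp)
  qed simp
  hence "alg_independent \<kappa> P' P"
  proof (intro alg_independent_exchange[OF \<kappa> alg_independent_sym[OF \<kappa>], of p P' "{}"])
    show "p \<in> adjoin \<kappa> ({} \<union> {P', P})" by (subst p) (intro I adjoin.gen; simp)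
  qed simp_all
  hence PP: "alg_independent \<kappa> P P'" by (rule alg_independent_sym[OF \<kappa>])
  have gen': "adjoin \<kappa> {P, Q, P', Q'} = UNIV"
  proof -
    have "p \<in> adjoin \<kappa> {P, Q, P', Q'}" by (subst p) (intro I adjoin.gen; simp)
    moreover have "q \<in> adjoin \<kappa> {P, Q, P', Q'}" by (subst q_eq) (intro I adjoin.gen; simp)
    moreover have "p' \<in> adjoin \<kappa> {P, Q, P', Q'}" by (subst p') (intro I adjoin.gen; simp)
    moreover have "q' \<in> adjoin \<kappa> {P, Q, P', Q'}" by (subst q'_eq) (intro I adjoin.gen; simp)
    ultimately have "adjoin \<kappa> {p, q, p', q'} \<subseteq> adjoin \<kappa> {P, Q, P', Q'}"
      by (intro adjoin_subset) simp
    thus ?thesis using gen by auto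
  qed
  have aut: "const_automorphism \<kappa> \<sigma>" using \<sigma> by (simp add: product_negation_def)
  note \<sigma>m = const_automorphism_morphism[OF \<kappa> aut]
  have \<sigma>\<kappa>: "\<sigma> (\<kappa> c) = \<kappa> c" for c using aut by (simp add: const_automorphism_def)
  have neg: "product_negation \<kappa> P Q P' Q' \<sigma>"
    using \<sigma> by (simp add: product_negation_def P_def Q_def P'_def Q'_def \<sigma>\<kappa>
        ring_morphism_simps[OF \<sigma>m] ring_morphism_divide[OF \<sigma>m])
  show ?thesis
    using kummer_field_normalised[OF \<kappa> PP gen' shift[OF \<delta>(1) P_def q \<delta>(2,3), folded Q_def]
        shift[OF \<delta>'(1) P'_def q' \<delta>'(2,3), folded Q'_def] neg nz] that by blast
qed

section \<open>Matching the parameters\<close>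

lemma hauptmodul_parametrisation:
  assumes "2 * s ^ 2 \<noteq> 1" "r \<noteq> 1 / 4" "hauptmodul s = - (2 * (r + 2) / (4 * r - 1))"
  shows "2 * s ^ 2 + 1 \<noteq> 0" "r = - 2 * (4 * s ^ 2 - 1) * (s ^ 2 - 1) / (2 * s ^ 2 + 1) ^ 2"
proof -
  have nz: "2 * s ^ 2 - 1 \<noteq> 0" "4 * r - 1 \<noteq> 0"
    using assms(1,2) by (simp_all add: nonzero_eq_divide_eq mult.commute)
  have "(2 * s) ^ 2 * (4 * r - 1) = - (2 * (r + 2)) * (2 * s ^ 2 - 1) ^ 2"
    using assms(3) nz by (simp add: hauptmodul_def power_divide frac_eq_eq minus_divide_left)
  hence eq: "r * (2 * s ^ 2 + 1) ^ 2 = - 2 * (4 * s ^ 2 - 1) * (s ^ 2 - 1)"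
    by Groebner_Basis.algebra
  show "2 * s ^ 2 + 1 \<noteq> 0"
  proof
    assume 0: "2 * s ^ 2 + 1 = 0"
    hence "s ^ 2 = - 1 / 2" by (simp add: field_simps eq_neg_iff_add_eq_0)
    thus False using eq 0 by simp
  qed
  thus "r = - 2 * (4 * s ^ 2 - 1) * (s ^ 2 - 1) / (2 * s ^ 2 + 1) ^ 2"
    using eq by (simp add: field_simps)
qed

text \<open>
  Put \<open>\<rho> = 3 (2 s\<^sup>2 - 1) / (2 s\<^sup>2 + 1)\<close>, so that
  \<open>\<rho>\<^sup>2 = 1 - 4 r\<close>. The zeros of the quadratic polynomial of the \<open>I\<^sub>2\<close>
  fibres are \<open>- (1 - \<rho>)\<^sup>4 / (2 r\<^sup>3)\<close> and
  \<open>- (1 + \<rho>)\<^sup>4 / (2 r\<^sup>3)\<close>; the first one is the right choice of \<open>c\<close>.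
  The quotients of the required identities determine \<open>g\<close> and \<open>k\<^sup>2\<close>.
\<close>

lemma quer_parameters:
  assumes E: "2 * s ^ 2 + 1 \<noteq> 0" and r: "r = - 2 * (4 * s ^ 2 - 1) * (s ^ 2 - 1) / (2 * s ^ 2 + 1) ^ 2"
    and "r \<noteq> 0"
  obtains c g k where "I2_fibre r c" "g \<noteq> 0" "k \<noteq> 0"
    "g * quer_N s = 2 * k ^ 2 * r ^ 3"
    "g ^ 2 * - (quer_M s * quer_M (- s) / 2) = - 8 * k ^ 2 * (1 + 2 * r)"
    "g ^ 3 * quer_N (- s) = - c * k ^ 2"
    "c * g ^ 4 * ((quer_M s ^ 2 - 4 * quer_N s) * (quer_M (- s) ^ 2 - 4 * quer_N (- s)) / 16)
       = - 128 * r * k ^ 4"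
proof -
  define e f h l where "e = 2 * s ^ 2 + 1" and "f = 4 * s ^ 2 - 1" and "h = s + 1" and "l = s - 1"
  have hl: "s ^ 2 - 1 = h * l" unfolding h_def l_def by Groebner_Basis.algebra
  have r': "r = - 2 * f * h * l / e ^ 2" using r by (simp add: e_def f_def hl)
  have nz: "e \<noteq> 0" "f \<noteq> 0" "h \<noteq> 0" "l \<noteq> 0" using E \<open>r \<noteq> 0\<close> by (auto simp: e_def[symmetric] r')
  define c where "c = 16 * h * l * e ^ 2 / f ^ 3"
  define g where "g = - (e ^ 4 / (f ^ 3 * h ^ 2))"
  define w where "w = csqrt (- 3)"
  have w: "w ^ 2 = - 3" unfolding w_def by (rule power2_csqrt)
  define k where "k = w / 4 * e ^ 5 / (f ^ 3 * h ^ 2)"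
  have k2: "k ^ 2 = - 3 * e ^ 10 / (16 * f ^ 6 * h ^ 4)"
    by (simp add: k_def power_divide power_mult_distrib w)
  have k4: "k ^ 4 = 9 * e ^ 20 / (256 * f ^ 12 * h ^ 8)"
  proof -
    have "k ^ 4 = (k ^ 2) ^ 2" by simp
    thus ?thesis unfolding k2 by (simp add: power_divide power_mult_distrib)
  qed
  have N: "quer_N s = - 3 * h * l ^ 3" "quer_N (- s) = - 3 * l * h ^ 3"
    unfolding quer_N_def h_def l_def by Groebner_Basis.algebra+
  have M: "2 * (quer_M s * quer_M (- s)) = - 6 * (e ^ 2 - 4 * f * h * l)"
    unfolding quer_M_def e_def f_def h_def l_def by Groebner_Basis.algebra
  have D: "(quer_M s ^ 2 - 4 * quer_N s) * (quer_M (- s) ^ 2 - 4 * quer_N (- s)) = 9 * f ^ 4"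
    unfolding quer_discriminant f_def by Groebner_Basis.algebra
  show ?thesis
  proof
    have rel: "e ^ 4 + 8 * f * (h * l) * e ^ 2 + 8 * f ^ 2 * (h * l) ^ 2 = f ^ 4 + 16 * (h * l) ^ 4"
      unfolding hl[symmetric] e_def f_def by Groebner_Basis.algebra
    have "64 * r + 8 * c - 32 * r * c + 16 * r ^ 2 * c + c ^ 2 * r ^ 3 =
        128 * (h * l) / (e ^ 2 * f ^ 3) *
        (e ^ 4 + 8 * f * (h * l) * e ^ 2 + 8 * f ^ 2 * (h * l) ^ 2 - f ^ 4 - 16 * (h * l) ^ 4)"
      unfolding r' c_def using nz by (simp add: power_divide power_mult_distrib field_simps eval_nat_numeral)
    thus "I2_fibre r c" unfolding I2_fibre_def rel by simp
    show "g \<noteq> 0" using nz by (simp add: g_def)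
    show "k \<noteq> 0" using nz w by (auto simp: k_def)
    show "g * quer_N s = 2 * k ^ 2 * r ^ 3"
      unfolding g_def k2 N r' using nz by (simp add: power_divide power_mult_distrib field_simps eval_nat_numeral)
    show "g ^ 2 * - (quer_M s * quer_M (- s) / 2) = - 8 * k ^ 2 * (1 + 2 * r)"
    proof -
      have m: "quer_M s * quer_M (- s) / 2 = - 3 / 2 * (e ^ 2 - 4 * f * h * l)" using M by (simp add: field_simps)
      have r2: "1 + 2 * r = (e ^ 2 - 4 * f * h * l) / e ^ 2" unfolding r' using nz by (simp add: field_simps)
      show ?thesis unfolding g_def k2 m r2 using nz by (simp add: power_divide power_mult_distrib field_simps eval_nat_numeral)
    qed
    show "g ^ 3 * quer_N (- s) = - c * k ^ 2"
      unfolding g_def k2 N c_def using nz by (simp add: power_divide power_mult_distrib field_simps eval_nat_numeral)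
    show "c * g ^ 4 * ((quer_M s ^ 2 - 4 * quer_N s) * (quer_M (- s) ^ 2 - 4 * quer_N (- s)) / 16)
       = - 128 * r * k ^ 4"
      unfolding g_def k4 D c_def r' using nz by (simp add: power_divide power_mult_distrib field_simps eval_nat_numeral)
  qed
qed

theorem theorem14:
  fixes r s a b a' b' :: complex
    and \<iota> :: "complex \<Rightarrow> 'k::field" and t x y :: 'k
    and \<kappa> :: "complex \<Rightarrow> 'l::field" and p q p' q' :: 'l and \<sigma> :: "'l \<Rightarrow> 'l"
  assumes "r \<noteq> 0" "r \<noteq> 1/4" "r \<noteq> 1/2" "2 * s^2 \<noteq> 1"
    and "hauptmodul s = - (2 * (r + 2) / (4 * r - 1))"
    and "X3 r \<iota> t x y"
    and "j_invariant a b = quer_j s" "j_invariant a' b' = quer_j (- s)"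
    and "elliptic_product \<kappa> a b a' b' p q p' q'"
    and "product_negation \<kappa> p q p' q' \<sigma>"
  shows "\<exists>t' x' y' c \<tau>.
           III_star_fibration r \<iota> t' x' y' \<and> I2_fibre r c \<and>
           kummer_translation \<iota> t' x' y' c \<tau> \<and>
           const_isomorphic \<iota> (fixed_field \<tau>) \<kappa> (fixed_field \<sigma>)"
proof -
  have \<iota>: "ring_morphism \<iota>"
    using assms(6) by (simp add: X3_def weierstrass_fibration_def Let_def ring_morphism_const_embedding)
  have \<kappa>: "ring_morphism \<kappa>" and e: "elliptic_curve a b" "elliptic_curve a' b'"
    using assms(9) by (simp_all add: elliptic_product_def ring_morphism_const_embedding)
  note hm = hauptmodul_parametrisation[OF assms(4,2,5)]
  have nz: "s \<noteq> 1" "s \<noteq> - 1" "2 * s \<noteq> 1" "2 * s \<noteq> - 1"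
  proof -
    have "(2 * s - 1) * (2 * s + 1) * ((s - 1) * (s + 1)) = (4 * s ^ 2 - 1) * (s ^ 2 - 1)"
      by Groebner_Basis.algebra
    also have "\<dots> \<noteq> 0" using hm(2) assms(1) by auto
    finally show "s \<noteq> 1" "s \<noteq> - 1" "2 * s \<noteq> 1" "2 * s \<noteq> - 1" by auto
  qed
  obtain u m W where "alg_independent \<iota> u m" "adjoin \<iota> {u, m, W} = UNIV"
    "W ^ 2 = u * (u * m ^ 2 + \<iota> r) * (2 * u * m ^ 2 + (1 - \<iota> r * u) * m + 1)"
    by (rule X3_double_plane[OF assms(6) refl])
  then obtain t' x' y' where III: "III_star_fibration r \<iota> t' x' y'"
    by (rule III_star_fibration_of_double_plane[OF \<iota> assms(1) refl])
  define M N M' N' where "M = quer_M s" and "N = quer_N s" and "M' = quer_M (- s)" and "N' = quer_N (- s)"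
  obtain c g k where c: "I2_fibre r c" and gk: "g \<noteq> 0" "k \<noteq> 0"
    and param: "g * N = 2 * k ^ 2 * r ^ 3" "g ^ 2 * - (M * M' / 2) = - 8 * k ^ 2 * (1 + 2 * r)"
      "g ^ 3 * N' = - c * k ^ 2"
      "c * g ^ 4 * ((M ^ 2 - 4 * N) * (M' ^ 2 - 4 * N') / 16) = - 128 * r * k ^ 4"
    unfolding M_def N_def M'_def N'_def by (rule quer_parameters[OF hm assms(1)])
  define A where "A = [:0, N, - (M * M' / 2), N':]"
  define B where "B = [:0, 0, 0, 0, (M ^ 2 - 4 * N) * (M' ^ 2 - 4 * N') / 16:]"
  obtain U V1 W1 where fib: "induced_fibration \<iota> (I4_star_divisor \<iota> t' x' y' c) U V1 W1 (eval1 \<iota> U A) (eval1 \<iota> U B) 0"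
    unfolding A_def B_def by (rule I4_star_fibration[OF III assms(1) c gk param])
  hence "weierstrass_fibration \<iota> U V1 W1 (eval1 \<iota> U A) (eval1 \<iota> U B) 0"
    by (simp add: induced_fibration_def)
  then obtain \<tau> V2 W2 where \<tau>: "two_torsion_translation \<iota> U V1 W1 (eval1 \<iota> U A) \<tau>"
    "fixed_field \<tau> = adjoin \<iota> {U, V2, W2}" "alg_independent \<iota> U V2"
    "W2 ^ 2 = eval2 \<iota> U V2 [:0, A ^ 2 - 4 * B, - 2 * A, 1:]"
    by (rule two_torsion_quotient)
  have kummer: "kummer_translation \<iota> t' x' y' c \<tau>"
    using fib \<tau>(1) unfolding kummer_translation_def by blast
  have "j_invariant a b = j_invariant (N - M ^ 2 / 3) (M * (2 * M ^ 2 - 9 * N) / 27)"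
    unfolding assms(7) M_def N_def by (rule quer_model(2)[OF nz, symmetric])
  then obtain \<delta> where \<delta>: "\<delta> \<noteq> 0" "a = \<delta> ^ 4 * (N - M ^ 2 / 3)" "b = \<delta> ^ 6 * (M * (2 * M ^ 2 - 9 * N) / 27)"
    using twist_of_equal_j_invariant[OF e(1) quer_model(1)[OF nz, folded M_def N_def]] by blast
  have nz': "- s \<noteq> 1" "- s \<noteq> - 1" "2 * - s \<noteq> 1" "2 * - s \<noteq> - 1"
    using nz by (metis minus_minus mult_minus_right)+
  have "j_invariant a' b' = j_invariant (N' - M' ^ 2 / 3) (M' * (2 * M' ^ 2 - 9 * N') / 27)"
    unfolding assms(8) M'_def N'_def by (rule quer_model(2)[OF nz', symmetric])
  then obtain \<delta>' where \<delta>': "\<delta>' \<noteq> 0" "a' = \<delta>' ^ 4 * (N' - M' ^ 2 / 3)" "b' = \<delta>' ^ 6 * (M' * (2 * M' ^ 2 - 9 * N') / 27)"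
    using twist_of_equal_j_invariant[OF e(2) quer_model(1)[OF nz', folded M'_def N'_def]] by blast
  have "N' \<noteq> 0" "M' ^ 2 \<noteq> 4 * N'"
  proof -
    have n: "- s - 1 \<noteq> 0" "- s + 1 \<noteq> 0" "2 * (- s) - 1 \<noteq> 0" "2 * (- s) + 1 \<noteq> 0"
      using nz' by (metis add_eq_0_iff2 eq_iff_diff_eq_0)+
    show "N' \<noteq> 0" unfolding N'_def quer_N_def using n by simp
    have "M' ^ 2 - 4 * N' \<noteq> 0" unfolding M'_def N'_def quer_discriminant
      by (intro no_zero_divisors power_not_zero n zero_neq_numeral[symmetric])
    thus "M' ^ 2 \<noteq> 4 * N'" by simp
  qed
  then obtain U' V3 W3 where \<sigma>: "fixed_field \<sigma> = adjoin \<kappa> {U', V3, W3}" "alg_independent \<kappa> U' V3"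
    "W3 ^ 2 = V3 * ((V3 - eval1 \<kappa> U' A) ^ 2 - 4 * eval1 \<kappa> U' B)"
    unfolding A_def B_def by (rule kummer_field[OF assms(9,10) \<delta> \<delta>'])
  note m = eval1_morphism[OF \<kappa>, of U']
  have eq: "W3 ^ 2 = eval2 \<kappa> U' V3 [:0, A ^ 2 - 4 * B, - 2 * A, 1:]"
    unfolding \<sigma>(3) by (simp add: eval1_pCons[OF m] eval1_0 ring_morphism_simps[OF m]) Groebner_Basis.algebra
  have odd: "odd (Polynomial.degree [:0, A ^ 2 - 4 * B, - 2 * A, 1:])" by simp
  obtain \<phi> where "bij_betw \<phi> (adjoin \<iota> {U, V2, W2}) (adjoin \<kappa> {U', V3, W3})"
    "\<And>z w. z \<in> adjoin \<iota> {U, V2, W2} \<Longrightarrow> w \<in> adjoin \<iota> {U, V2, W2} \<Longrightarrow>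
       \<phi> (z + w) = \<phi> z + \<phi> w \<and> \<phi> (z * w) = \<phi> z * \<phi> w"
    "\<And>c. \<phi> (\<iota> c) = \<kappa> c" "\<phi> U = U'" "\<phi> V2 = V3" "\<phi> W2 = W3"
    using double_plane_isomorphism[OF \<iota> \<kappa> \<tau>(3) \<sigma>(2) odd \<tau>(4) eq] by metis
  hence "const_isomorphic \<iota> (fixed_field \<tau>) \<kappa> (fixed_field \<sigma>)"
    unfolding const_isomorphic_def \<tau>(2) \<sigma>(1) by (intro exI[of _ \<phi>]) simp
  thus ?thesis using III c kummer by blast
qed

end
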